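(* Let $G$ be a compact Lie group, let $H$ be a closed subgroup of $G$, and let $\mathcal{V}$, $\mathcal{W}$ be (finite dimensional) orthogonal $H$-representations. If $\dim \mathcal{V}^H$ is odd, then $$\chi_G\left(G^+\wedge_H S^{\mathcal{W}\oplus\mathcal{V}}\right)\neq \chi_G\left(G^+\wedge_H S^{\mathcal{W}}\right)$$ in the Euler ring $U(G)$.
   Context: $\mathcal{V}^H$ is the subspace of vectors fixed by every element of $H$. For an orthogonal $H$-representation $\mathcal{W}$, $S^{\mathcal{W}}=\mathcal{W}\cup\{\infty\}$ is its one-point compactification, a pointed $H$-space with base point $\infty$. For a space $Y$ without base point, $Y^+=Y\sqcup\{*\}$. For a pointed $H$-space $X$ (base point fixed by $H$), $G^+\wedge_H X$ is the orbit space of $G^+\wedge X$ under the $H$-action $(h,(g,x))\mapsto (gh^{-1},hx)$; it is a pointed $G$-space with action $(g',[g,x])\mapsto[g'g,x]$. A pointed $G$-CW-complex is a $G$-space $X$ with base point $*$ and a finite filtration $X_0\subset X_1\subset\dots\subset X_p=X$ such that $X_0$ is $G$-homeomorphic to $\{*\}\sqcup\bigsqcup_j G/H_{j,0}$ (a finite disjoint union, $H_{j,0}$ closed subgroups of $G$) and $X_k$ is obtained from $X_{k-1}$ by attaching a finite family of $k$-cells, i.e. there are closed subgroups $H_{j,k}$ and a $G$-equivariant map of pairs $\left(\bigsqcup_j D^k\times G/H_{j,k},\bigsqcup_j S^{k-1}\times G/H_{j,k}\right)\to (X_k,X_{k-1})$ mapping $\bigsqcup_j B^k\times G/H_{j,k}$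 homeomorphically onto $X_k\setminus X_{k-1}$ (here $D^k$, $B^k$, $S^{k-1}$ are the closed unit ball, open unit ball and unit sphere of $\mathbb{R}^k$ with trivial $G$-action). Let $\mathbf{F}$ be the free abelian group generated by the pointed $G$-homotopy types $[X]$ of pointed $G$-CW-complexes and $\mathbf{N}$ the subgroup generated by all $[A]-[X]+[X/A]$ for pointed $G$-CW-subcomplexes $A$ of pointed $G$-CW-complexes $X$. Then $U(G)=\mathbf{F}/\mathbf{N}$, and the $G$-equivariant Euler characteristic $\chi_G(X)$ is the class of $[X]$ in $U(G)$. With $\chi_G(X)+\chi_G(Y)=\chi_G(X\vee Y)$ and $\chi_G(X)\star\chi_G(Y)=\chi_G(X\wedge Y)$, $U(G)$ is a commutative ring (the Euler ring); as an abelian group it is free with basis $\chi_G(G/K^+)$, $(K)$ ranging over conjugacy classes of closed subgroups of $G$, and the coefficient of $\chi_G(X)$ at $\chi_G(G/K^+)$ is the alternating sum over $k$ of $(-1)^k$ times the number of $k$-cells of type $(K)$ in $X$. *)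

theory Defs
  imports "HOL-Analysis.Analysis" "HOL-Algebra.Free_Abelian_Groups"
begin

section \<open>Quotient topologies\<close>

definition quot_topology :: "'a topology \<Rightarrow> ('a \<Rightarrow> 'b) \<Rightarrow> 'b topology" where
  "quot_topology X q =
     topology (\<lambda>U. U \<subseteq> q ` topspace X \<and> openin X {x \<in> topspace X. q x \<in> U})"

lemma openin_quot_topology:
  "openin (quot_topology X q) U \<longleftrightarrow>
     U \<subseteq> q ` topspace X \<and> openin X {x \<in> topspace X. q x \<in> U}"
proof -
  have "istopology (\<lambda>U. U \<subseteq> q ` topspace X \<and> openin X {x \<in> topspace X. q x \<in> U})"
    unfolding istopology_def
  proof (intro conjI allI impI)
    fix S T assume "S \<subseteq> q ` topspace X \<and> openin X {x \<in> topspace X. q x \<in> S}"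
      "T \<subseteq> q ` topspace X \<and> openin X {x \<in> topspace X. q x \<in> T}"
    moreover have "{x \<in> topspace X. q x \<in> S \<inter> T} =
        {x \<in> topspace X. q x \<in> S} \<inter> {x \<in> topspace X. q x \<in> T}" by blast
    ultimately show "S \<inter> T \<subseteq> q ` topspace X" "openin X {x \<in> topspace X. q x \<in> S \<inter> T}"
      by auto
  next
    fix \<K> assume *: "\<forall>K\<in>\<K>. K \<subseteq> q ` topspace X \<and> openin X {x \<in> topspace X. q x \<in> K}"
    have "{x \<in> topspace X. q x \<in> \<Union>\<K>} = (\<Union>K\<in>\<K>. {x \<in> topspace X. q x \<in> K})" by blast
    then show "openin X {x \<in> topspace X. q x \<in> \<Union>\<K>}" using * by (metis (lifting) imageE openin_Union)
    show "\<Union>\<K> \<subseteq> q ` topspace X" using * by blast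
  qed
  then show ?thesis by (simp add: quot_topology_def)
qed

lemma topspace_quot_topology: "topspace (quot_topology X q) = q ` topspace X"
proof -
  have "{x \<in> topspace X. q x \<in> q ` topspace X} = topspace X" by blast
  then have "openin (quot_topology X q) (q ` topspace X)"
    by (simp add: openin_quot_topology)
  then show ?thesis
    by (meson openin_quot_topology openin_subset openin_topspace subset_antisym)
qed

lemma quotient_map_quot_topology: "quotient_map X (quot_topology X q) q"
  by (auto simp: quotient_map_def openin_quot_topology topspace_quot_topology)


section \<open>Compact Lie groups\<close>

text \<open>Smoothness is expressed in coordinates: the space \<open>Euclidean_space n\<close> consists of the
  functions on the natural numbers vanishing from \<open>n\<close> on, so that the dimension can be an
  arbitrary natural number (including 0, hence finite groups are Lie groups).\<close>

definition partial_deriv :: "nat \<Rightarrow> ((nat \<Rightarrow> real) \<Rightarrow> real) \<Rightarrow> (nat \<Rightarrow> real) \<Rightarrow> real" where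
  "partial_deriv i f x = deriv (\<lambda>t. f (x(i := t))) (x i)"

text \<open>\<open>Ck_on n U k f\<close>: on the open subset \<open>U\<close> of \<open>n\<close>-space, all iterated partial derivatives
  of \<open>f\<close> of order at most \<open>k\<close> exist and are continuous.\<close>

primrec Ck_on :: "nat \<Rightarrow> (nat \<Rightarrow> real) set \<Rightarrow> nat \<Rightarrow> ((nat \<Rightarrow> real) \<Rightarrow> real) \<Rightarrow> bool" where
  "Ck_on n U 0 f \<longleftrightarrow>
     continuous_map (subtopology (Euclidean_space n) U) euclideanreal f"
| "Ck_on n U (Suc k) f \<longleftrightarrow>
     continuous_map (subtopology (Euclidean_space n) U) euclideanreal f \<and>
     (\<forall>i<n. (\<forall>x\<in>U. (\<lambda>t. f (x(i := t))) differentiable (at (x i))) \<and>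
            Ck_on n U k (partial_deriv i f))"

definition smooth_map ::
    "nat \<Rightarrow> nat \<Rightarrow> (nat \<Rightarrow> real) set \<Rightarrow> ((nat \<Rightarrow> real) \<Rightarrow> nat \<Rightarrow> real) \<Rightarrow> bool" where
  "smooth_map n m U F \<longleftrightarrow> (\<forall>j<m. \<forall>k. Ck_on n U k (\<lambda>x. F x j))"

definition chart :: "'g topology \<Rightarrow> nat \<Rightarrow> 'g set \<times> ('g \<Rightarrow> nat \<Rightarrow> real) \<Rightarrow> bool" where
  "chart T n = (\<lambda>(U, \<phi>). openin T U \<and> openin (Euclidean_space n) (\<phi> ` U) \<and>
     homeomorphic_map (subtopology T U) (subtopology (Euclidean_space n) (\<phi> ` U)) \<phi>)"

definition smooth_atlas ::
    "'g topology \<Rightarrow> nat \<Rightarrow> ('g set \<times> ('g \<Rightarrow> nat \<Rightarrow> real)) set \<Rightarrow> bool" where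
  "smooth_atlas T n \<A> \<longleftrightarrow>
     (\<forall>c\<in>\<A>. chart T n c) \<and> (\<Union>(U, \<phi>)\<in>\<A>. U) = topspace T \<and>
     (\<forall>(U, \<phi>)\<in>\<A>. \<forall>(V, \<psi>)\<in>\<A>. smooth_map n n (\<phi> ` (U \<inter> V)) (\<psi> \<circ> inv_into U \<phi>))"

text \<open>The two projections of \<open>2n\<close>-space onto \<open>n\<close>-space; they give coordinates on a product
  of two charts.\<close>

definition fst_coords :: "nat \<Rightarrow> (nat \<Rightarrow> real) \<Rightarrow> nat \<Rightarrow> real" where
  "fst_coords n z = (\<lambda>i. if i < n then z i else 0)"

definition snd_coords :: "nat \<Rightarrow> (nat \<Rightarrow> real) \<Rightarrow> nat \<Rightarrow> real" where
  "snd_coords n z = (\<lambda>i. if i < n then z (n + i) else 0)"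

definition smooth_mult ::
    "('g, 'b) monoid_scheme \<Rightarrow> nat \<Rightarrow> ('g set \<times> ('g \<Rightarrow> nat \<Rightarrow> real)) set \<Rightarrow> bool" where
  "smooth_mult G n \<A> \<longleftrightarrow>
     (\<forall>(U, \<phi>)\<in>\<A>. \<forall>(V, \<psi>)\<in>\<A>. \<forall>(W, \<theta>)\<in>\<A>.
        let \<mu> = (\<lambda>z. inv_into U \<phi> (fst_coords n z) \<otimes>\<^bsub>G\<^esub> inv_into V \<psi> (snd_coords n z)) in
        smooth_map (2 * n) n
          {z \<in> topspace (Euclidean_space (2 * n)).
             fst_coords n z \<in> \<phi> ` U \<and> snd_coords n z \<in> \<psi> ` V \<and> \<mu> z \<in> W}
          (\<theta> \<circ> \<mu>))"

definition smooth_inv ::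
    "('g, 'b) monoid_scheme \<Rightarrow> nat \<Rightarrow> ('g set \<times> ('g \<Rightarrow> nat \<Rightarrow> real)) set \<Rightarrow> bool" where
  "smooth_inv G n \<A> \<longleftrightarrow>
     (\<forall>(U, \<phi>)\<in>\<A>. \<forall>(V, \<psi>)\<in>\<A>.
        smooth_map n n (\<phi> ` {g \<in> U. inv\<^bsub>G\<^esub> g \<in> V}) (\<lambda>x. \<psi> (inv\<^bsub>G\<^esub> (inv_into U \<phi> x))))"

definition lie_group ::
    "('g, 'b) monoid_scheme \<Rightarrow> 'g topology \<Rightarrow> nat \<Rightarrow> ('g set \<times> ('g \<Rightarrow> nat \<Rightarrow> real)) set \<Rightarrow> bool"
where
  "lie_group G T n \<A> \<longleftrightarrow>
     group G \<and> topspace T = carrier G \<and>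
     Hausdorff_space T \<and> second_countable T \<and> smooth_atlas T n \<A> \<and>
     continuous_map (prod_topology T T) T (\<lambda>(g, h). g \<otimes>\<^bsub>G\<^esub> h) \<and>
     continuous_map T T (\<lambda>g. inv\<^bsub>G\<^esub> g) \<and>
     smooth_mult G n \<A> \<and> smooth_inv G n \<A>"

definition compact_lie_group :: "('g, 'b) monoid_scheme \<Rightarrow> 'g topology \<Rightarrow> bool" where
  "compact_lie_group G T \<longleftrightarrow> (\<exists>n \<A>. lie_group G T n \<A>) \<and> compact_space T"

definition closed_subgroup :: "('g, 'b) monoid_scheme \<Rightarrow> 'g topology \<Rightarrow> 'g set \<Rightarrow> bool" where
  "closed_subgroup G T K \<longleftrightarrow> subgroup K G \<and> closedin T K"


section \<open>Pointed spaces with a group action\<close>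

record ('g, 'x) gspace =
  gtop :: "'x topology"
  gact :: "'g \<Rightarrow> 'x \<Rightarrow> 'x"
  gbase :: 'x

definition pointed_gspace ::
    "('g, 'b) monoid_scheme \<Rightarrow> 'g topology \<Rightarrow> ('g, 'x) gspace \<Rightarrow> bool" where
  "pointed_gspace G T X \<longleftrightarrow>
     continuous_map (prod_topology T (gtop X)) (gtop X) (\<lambda>(g, x). gact X g x) \<and>
     (\<forall>x\<in>topspace (gtop X). gact X \<one>\<^bsub>G\<^esub> x = x) \<and>
     (\<forall>g\<in>carrier G. \<forall>h\<in>carrier G. \<forall>x\<in>topspace (gtop X).
        gact X (g \<otimes>\<^bsub>G\<^esub> h) x = gact X g (gact X h x)) \<and>
     gbase X \<in> topspace (gtop X) \<and> (\<forall>g\<in>carrier G. gact X g (gbase X) = gbase X)"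

definition pointed_equivariant ::
    "('g, 'b) monoid_scheme \<Rightarrow> ('g, 'x) gspace \<Rightarrow> ('g, 'y) gspace \<Rightarrow> ('x \<Rightarrow> 'y) \<Rightarrow> bool" where
  "pointed_equivariant G X Y f \<longleftrightarrow>
     f (gbase X) = gbase Y \<and>
     (\<forall>g\<in>carrier G. \<forall>x\<in>topspace (gtop X). f (gact X g x) = gact Y g (f x))"

definition G_homotopy_equivalent ::
    "('g, 'b) monoid_scheme \<Rightarrow> ('g, 'x) gspace \<Rightarrow> ('g, 'y) gspace \<Rightarrow> bool" where
  "G_homotopy_equivalent G X Y \<longleftrightarrow>
     (\<exists>f k. continuous_map (gtop X) (gtop Y) f \<and> pointed_equivariant G X Y f \<and>
            continuous_map (gtop Y) (gtop X) k \<and> pointed_equivariant G Y X k \<and>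
            homotopic_with (pointed_equivariant G X X) (gtop X) (gtop X) (k \<circ> f) id \<and>
            homotopic_with (pointed_equivariant G Y Y) (gtop Y) (gtop Y) (f \<circ> k) id)"


section \<open>Pointed G-CW-complexes\<close>

text \<open>The homogeneous space \<open>G/K\<close>; the group acts on it by \<open>(g, C) \<mapsto> g <# C\<close>.\<close>

definition coset_space :: "('g, 'b) monoid_scheme \<Rightarrow> 'g topology \<Rightarrow> 'g set \<Rightarrow> 'g set topology" where
  "coset_space G T K = quot_topology T (\<lambda>a. a <#\<^bsub>G\<^esub> K)"

definition closed_disk :: "nat \<Rightarrow> (nat \<Rightarrow> real) set" where
  "closed_disk k = {x \<in> topspace (Euclidean_space k). (\<Sum>i<k. (x i)\<^sup>2) \<le> 1}"

definition open_disk :: "nat \<Rightarrow> (nat \<Rightarrow> real) set" where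
  "open_disk k = {x \<in> topspace (Euclidean_space k). (\<Sum>i<k. (x i)\<^sup>2) < 1}"

definition bd_sphere :: "nat \<Rightarrow> (nat \<Rightarrow> real) set" where
  "bd_sphere k = {x \<in> topspace (Euclidean_space k). (\<Sum>i<k. (x i)\<^sup>2) = 1}"

text \<open>The disjoint union of the spaces \<open>D\<^sup>k \<times> G/K j\<close>, \<open>j < m\<close>.\<close>

definition cell_space ::
    "('g, 'b) monoid_scheme \<Rightarrow> 'g topology \<Rightarrow> nat \<Rightarrow> nat \<Rightarrow> (nat \<Rightarrow> 'g set) \<Rightarrow>
     (nat \<times> (nat \<Rightarrow> real) \<times> 'g set) topology" where
  "cell_space G T k m K =
     sum_topology (\<lambda>j. prod_topology (subtopology (Euclidean_space k) (closed_disk k))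
                                     (coset_space G T (K j))) {..<m}"

text \<open>\<open>\<Phi>\<close> attaches \<open>m\<close> cells of dimension \<open>k\<close> and types \<open>K 0, \<dots>, K (m - 1)\<close> to \<open>B\<close>, with
  result \<open>C\<close> (both \<open>B\<close> and \<open>C\<close> are subspaces of \<open>X\<close>).\<close>

definition attaches_cells ::
    "('g, 'b) monoid_scheme \<Rightarrow> 'g topology \<Rightarrow> ('g, 'x) gspace \<Rightarrow> 'x set \<Rightarrow> 'x set \<Rightarrow> nat \<Rightarrow>
     nat \<Rightarrow> (nat \<Rightarrow> 'g set) \<Rightarrow> (nat \<times> (nat \<Rightarrow> real) \<times> 'g set \<Rightarrow> 'x) \<Rightarrow> bool" where
  "attaches_cells G T X B C k m K \<Phi> \<longleftrightarrow>
     (\<forall>j<m. closed_subgroup G T (K j)) \<and>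
     continuous_map (cell_space G T k m K) (subtopology (gtop X) C) \<Phi> \<and>
     (\<forall>g\<in>carrier G. \<forall>(j, v, D)\<in>topspace (cell_space G T k m K).
        \<Phi> (j, v, g <#\<^bsub>G\<^esub> D) = gact X g (\<Phi> (j, v, D))) \<and>
     (\<forall>(j, v, D)\<in>topspace (cell_space G T k m K). v \<in> bd_sphere k \<longrightarrow> \<Phi> (j, v, D) \<in> B) \<and>
     homeomorphic_map
       (subtopology (cell_space G T k m K) {(j, v, D). v \<in> open_disk k})
       (subtopology (gtop X) (C - B)) \<Phi>"

text \<open>\<open>Xs k\<close> is the \<open>k\<close>-th stage of the filtration, and \<open>m k\<close>, \<open>K k\<close>, \<open>\<Phi> k\<close> are the number,
  the types and the joint characteristic map of the cells of dimension \<open>k\<close>. Since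
  \<open>D\<^sup>0\<close> is a point and \<open>S\<^sup>-\<^sup>1\<close> is empty, the orbits
  making up \<open>Xs 0\<close> are treated as cells of dimension 0 attached to the base point; the base
  point is required to be isolated in \<open>Xs 0\<close>, so that \<open>Xs 0\<close> is indeed the disjoint union of
  the base point and these orbits. As usual, G-spaces carrying a CW structure are Hausdorff.
  By compactness, the topology of \<open>Xs k\<close> is then the one obtained by glueing the
  cells to \<open>Xs (k - 1)\<close>.\<close>

definition gcw_structure ::
    "('g, 'b) monoid_scheme \<Rightarrow> 'g topology \<Rightarrow> ('g, 'x) gspace \<Rightarrow> nat \<Rightarrow> (nat \<Rightarrow> 'x set) \<Rightarrow>
     (nat \<Rightarrow> nat) \<Rightarrow> (nat \<Rightarrow> nat \<Rightarrow> 'g set) \<Rightarrow>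
     (nat \<Rightarrow> nat \<times> (nat \<Rightarrow> real) \<times> 'g set \<Rightarrow> 'x) \<Rightarrow> bool" where
  "gcw_structure G T X p Xs m K \<Phi> \<longleftrightarrow>
     pointed_gspace G T X \<and> Hausdorff_space (gtop X) \<and>
     gbase X \<in> Xs 0 \<and> openin (subtopology (gtop X) (Xs 0)) {gbase X} \<and>
     (\<forall>k<p. Xs k \<subseteq> Xs (Suc k)) \<and> Xs p = topspace (gtop X) \<and>
     attaches_cells G T X {gbase X} (Xs 0) 0 (m 0) (K 0) (\<Phi> 0) \<and>
     (\<forall>k<p. attaches_cells G T X (Xs k) (Xs (Suc k)) (Suc k) (m (Suc k)) (K (Suc k)) (\<Phi> (Suc k)))"

definition pointed_gcw_complex ::
    "('g, 'b) monoid_scheme \<Rightarrow> 'g topology \<Rightarrow> ('g, 'x) gspace \<Rightarrow> bool" where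
  "pointed_gcw_complex G T X \<longleftrightarrow> (\<exists>p Xs m K \<Phi>. gcw_structure G T X p Xs m K \<Phi>)"

text \<open>A pointed subcomplex is a closed union of the base point and of (open) cells.\<close>

definition pointed_gcw_subcomplex ::
    "('g, 'b) monoid_scheme \<Rightarrow> 'g topology \<Rightarrow> ('g, 'x) gspace \<Rightarrow> 'x set \<Rightarrow> bool" where
  "pointed_gcw_subcomplex G T X A \<longleftrightarrow>
     (\<exists>p Xs m K \<Phi>. gcw_structure G T X p Xs m K \<Phi> \<and> closedin (gtop X) A \<and>
        (\<exists>S \<subseteq> {(k, j). k \<le> p \<and> j < m k}.
           A = insert (gbase X)
                 (\<Union>(k, j)\<in>S. \<Phi> k ` ({j} \<times> open_disk k \<times> topspace (coset_space G T (K k j))))))"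

definition gsubspace :: "('g, 'x) gspace \<Rightarrow> 'x set \<Rightarrow> ('g, 'x) gspace" where
  "gsubspace X A = X\<lparr>gtop := subtopology (gtop X) A\<rparr>"

text \<open>The quotient \<open>X/A\<close>, for an invariant subspace \<open>A\<close> containing the base point; the
  collapsed subspace is represented by the base point.\<close>

definition gcollapse :: "('g, 'x) gspace \<Rightarrow> 'x set \<Rightarrow> ('g, 'x) gspace" where
  "gcollapse X A = X\<lparr>gtop := quot_topology (gtop X) (\<lambda>x. if x \<in> A then gbase X else x)\<rparr>"


section \<open>The Euler ring and the equivariant Euler characteristic\<close>

text \<open>A compact Lie group has at most the cardinality of the continuum, and hence so does
  every (finite) pointed G-CW-complex. Up to G-homeomorphism, all of them therefore live on
  subsets of type \<^typ>\<open>real\<close>, which serves as the universe in which homotopy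
  types are formed. The homotopy type of a space over any type is the set of all pointed
  G-spaces in this universe that are G-homotopy equivalent to it.\<close>

definition homotopy_type ::
    "('g, 'b) monoid_scheme \<Rightarrow> 'g topology \<Rightarrow> ('g, 'x) gspace \<Rightarrow> ('g, real) gspace set" where
  "homotopy_type G T X = {Y. pointed_gspace G T Y \<and> G_homotopy_equivalent G X Y}"

definition gcw_homotopy_types ::
    "('g, 'b) monoid_scheme \<Rightarrow> 'g topology \<Rightarrow> ('g, real) gspace set set" where
  "gcw_homotopy_types G T = {homotopy_type G T X | X :: ('g, real) gspace. pointed_gcw_complex G T X}"

definition euler_free ::
    "('g, 'b) monoid_scheme \<Rightarrow> 'g topology \<Rightarrow> (('g, real) gspace set \<Rightarrow>\<^sub>0 int) monoid" where
  "euler_free G T = free_Abelian_group (gcw_homotopy_types G T)"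

definition euler_relations ::
    "('g, 'b) monoid_scheme \<Rightarrow> 'g topology \<Rightarrow> (('g, real) gspace set \<Rightarrow>\<^sub>0 int) set" where
  "euler_relations G T =
     generate (euler_free G T)
       {frag_of (homotopy_type G T (gsubspace X A)) - frag_of (homotopy_type G T X)
          + frag_of (homotopy_type G T (gcollapse X A)) |
        (X :: ('g, real) gspace) A. pointed_gcw_subcomplex G T X A}"

text \<open>The underlying additive group of the Euler ring \<open>U(G)\<close>.\<close>

definition euler_ring_add ::
    "('g, 'b) monoid_scheme \<Rightarrow> 'g topology \<Rightarrow> (('g, real) gspace set \<Rightarrow>\<^sub>0 int) set monoid" where
  "euler_ring_add G T = euler_free G T Mod euler_relations G T"

text \<open>The class of \<open>[X]\<close>. It is an element of \<open>U(G)\<close> when \<open>X\<close> has the homotopy type of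
  a pointed G-CW-complex; otherwise it is a coset of the same subgroup lying outside of \<open>U(G)\<close>.\<close>

definition euler_char ::
    "('g, 'b) monoid_scheme \<Rightarrow> 'g topology \<Rightarrow> ('g, 'x) gspace \<Rightarrow>
     (('g, real) gspace set \<Rightarrow>\<^sub>0 int) set" where
  "euler_char G T X =
     euler_relations G T #>\<^bsub>euler_free G T\<^esub> frag_of (homotopy_type G T X)"


section \<open>Representation spheres and induced spaces\<close>

text \<open>A finite-dimensional orthogonal \<open>H\<close>-representation, carried by a linear subspace \<open>W\<close> of a
  Euclidean space (so that the zero representation is included).\<close>

definition orthogonal_representation ::
    "('g, 'b) monoid_scheme \<Rightarrow> 'g topology \<Rightarrow> 'g set \<Rightarrow> 'w::euclidean_space set \<Rightarrow>
     ('g \<Rightarrow> 'w \<Rightarrow> 'w) \<Rightarrow> bool" where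
  "orthogonal_representation G T H W \<rho> \<longleftrightarrow>
     subspace W \<and>
     (\<forall>h\<in>H. \<forall>x\<in>W. \<rho> h x \<in> W) \<and>
     (\<forall>h\<in>H. \<forall>x\<in>W. \<forall>y\<in>W. \<rho> h (x + y) = \<rho> h x + \<rho> h y) \<and>
     (\<forall>h\<in>H. \<forall>c. \<forall>x\<in>W. \<rho> h (c *\<^sub>R x) = c *\<^sub>R \<rho> h x) \<and>
     (\<forall>h\<in>H. \<forall>x\<in>W. \<forall>y\<in>W. \<rho> h x \<bullet> \<rho> h y = x \<bullet> y) \<and>
     (\<forall>x\<in>W. \<rho> \<one>\<^bsub>G\<^esub> x = x) \<and>
     (\<forall>g\<in>H. \<forall>h\<in>H. \<forall>x\<in>W. \<rho> (g \<otimes>\<^bsub>G\<^esub> h) x = \<rho> g (\<rho> h x)) \<and>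
     continuous_map (prod_topology (subtopology T H) (top_of_set W)) (top_of_set W)
       (\<lambda>(h, x). \<rho> h x)"

definition fixed_vectors :: "'g set \<Rightarrow> 'w set \<Rightarrow> ('g \<Rightarrow> 'w \<Rightarrow> 'w) \<Rightarrow> 'w set" where
  "fixed_vectors H W \<rho> = {x \<in> W. \<forall>h\<in>H. \<rho> h x = x}"

definition direct_sum_action ::
    "('g \<Rightarrow> 'w \<Rightarrow> 'w) \<Rightarrow> ('g \<Rightarrow> 'v \<Rightarrow> 'v) \<Rightarrow> 'g \<Rightarrow> 'w \<times> 'v \<Rightarrow> 'w \<times> 'v" where
  "direct_sum_action \<rho> \<sigma> h = (\<lambda>(x, y). (\<rho> h x, \<sigma> h y))"

definition rep_sphere ::
    "'w::euclidean_space set \<Rightarrow> ('g \<Rightarrow> 'w \<Rightarrow> 'w) \<Rightarrow> ('g, 'w option) gspace" where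
  "rep_sphere W \<rho> =
     \<lparr>gtop = Alexandroff_compactification (top_of_set W),
      gact = (\<lambda>h. map_option (\<rho> h)),
      gbase = None\<rparr>"

text \<open>\<open>Y\<^sup>+\<close>, with the added isolated base point \<open>None\<close>.\<close>

definition plus_topology :: "'a topology \<Rightarrow> 'a option topology" where
  "plus_topology Y =
     topology (\<lambda>U. U \<subseteq> insert None (Some ` topspace Y) \<and> openin Y {y. Some y \<in> U})"

lemma openin_plus_topology:
  "openin (plus_topology Y) U \<longleftrightarrow>
     U \<subseteq> insert None (Some ` topspace Y) \<and> openin Y {y. Some y \<in> U}"
proof -
  have "istopology (\<lambda>U. U \<subseteq> insert None (Some ` topspace Y) \<and> openin Y {y. Some y \<in> U})"
    unfolding istopology_def
  proof (intro conjI allI impI)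
    fix S T assume "S \<subseteq> insert None (Some ` topspace Y) \<and> openin Y {y. Some y \<in> S}"
      "T \<subseteq> insert None (Some ` topspace Y) \<and> openin Y {y. Some y \<in> T}"
    moreover have "{y. Some y \<in> S \<inter> T} = {y. Some y \<in> S} \<inter> {y. Some y \<in> T}" by blast
    ultimately show "S \<inter> T \<subseteq> insert None (Some ` topspace Y)" "openin Y {y. Some y \<in> S \<inter> T}"
      by auto
  next
    fix \<K> assume *: "\<forall>K\<in>\<K>. K \<subseteq> insert None (Some ` topspace Y) \<and> openin Y {y. Some y \<in> K}"
    have "{y. Some y \<in> \<Union>\<K>} = (\<Union>K\<in>\<K>. {y. Some y \<in> K})" by blast
    then show "openin Y {y. Some y \<in> \<Union>\<K>}" using * by (metis (lifting) imageE openin_Union)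
    show "\<Union>\<K> \<subseteq> insert None (Some ` topspace Y)" using * by blast
  qed
  then show ?thesis by (simp add: plus_topology_def)
qed

text \<open>The smash product of two pointed spaces; the collapsed wedge is represented by the pair of
  base points.\<close>

definition smash_topology ::
    "'a topology \<Rightarrow> 'a \<Rightarrow> 'b topology \<Rightarrow> 'b \<Rightarrow> ('a \<times> 'b) topology" where
  "smash_topology X x0 Y y0 =
     quot_topology (prod_topology X Y) (\<lambda>(x, y). if x = x0 \<or> y = y0 then (x0, y0) else (x, y))"

definition H_orbit ::
    "('g, 'b) monoid_scheme \<Rightarrow> 'g set \<Rightarrow> ('g, 'x) gspace \<Rightarrow> 'g option \<times> 'x \<Rightarrow>
     ('g option \<times> 'x) set" where
  "H_orbit G H X =
     (\<lambda>(a, x). (\<lambda>h. (map_option (\<lambda>g. g \<otimes>\<^bsub>G\<^esub> inv\<^bsub>G\<^esub> h) a, gact X h x)) ` H)"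

text \<open>\<open>G\<^sup>+ \<and>\<^sub>H X\<close>, for a pointed \<open>H\<close>-space \<open>X\<close>: its points are the orbits of the \<open>H\<close>-action on the
  smash product of \<open>G\<^sup>+\<close> and \<open>X\<close>.\<close>

definition induced_gspace ::
    "('g, 'b) monoid_scheme \<Rightarrow> 'g topology \<Rightarrow> 'g set \<Rightarrow> ('g, 'x) gspace \<Rightarrow>
     ('g, ('g option \<times> 'x) set) gspace" where
  "induced_gspace G T H X =
     \<lparr>gtop = quot_topology (smash_topology (plus_topology T) None (gtop X) (gbase X))
               (H_orbit G H X),
      gact = (\<lambda>g' Z. (\<lambda>(a, x). (map_option (\<lambda>g. g' \<otimes>\<^bsub>G\<^esub> g) a, x)) ` Z),
      gbase = H_orbit G H X (None, gbase X)\<rparr>"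

end

theory Submission
  imports Defs "HOL-Homology.Homology"
begin

text \<open>For a pointed \<open>G\<close>-space \<open>X\<close> let \<open>Z(X)\<close> be the quotient of the fixed point set \<open>X\<^sup>H\<close> in which
  points of one \<open>G\<close>-orbit are identified, and all points whose isotropy group is larger than \<open>H\<close>
  are collapsed to the base point. Equivariant maps and homotopies pass to \<open>Z\<close>, so the reduced
  Euler characteristic of the singular homology of \<open>Z(X)\<close> depends only on the \<open>G\<close>-homotopy type
  of \<open>X\<close>. A \<open>G\<close>-cell \<open>D\<^sup>k \<times> G/K\<close> of a \<open>G\<close>-CW-complex contributes one \<open>k\<close>-cell to \<open>Z(X)\<close> if \<open>K\<close> is
  conjugate to \<open>H\<close>, and none otherwise; hence this number is additive, and it
  is the coefficient at \<open>\<chi>\<^sub>G(G/H\<^sup>+)\<close>. On the other hand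
  \<open>Z(G\<^sup>+ \<and>\<^sub>H S\<^sup>W)\<close> is the sphere of \<open>W\<^sup>H\<close>, so that the coefficient is \<open>(-1)\<^sup>d\<close> with \<open>d\<close> the
  dimension of \<open>W\<^sup>H\<close>. Its sign changes when \<open>V\<close> with \<open>dim V\<^sup>H\<close> odd is added. In this way
  no triangulation of the induced spaces is needed.\<close>

section \<open>Ranks of abelian groups\<close>

text \<open>Both operations in Z answer an obstacle. The fixed set of G/H under H is N(H)/H, whose
  Euler characteristic vanishes as soon as its dimension is positive, so X^H alone would lose the
  coefficient; passing to orbits turns this set into a single point. And an equivariant map can only
  enlarge isotropy groups, so the points with larger isotropy are sent to such points again and can
  be collapsed consistently. That the orbits behave well rests on compactness of G: if g^-1 H g is
  contained in H then it equals H, because some powers of g come arbitrarily close to g^-1. Ranks of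
  singular homology provide the homotopy invariance, which is what turns the number into a function
  on the homotopy types generating U(G); its value on a complex comes from an induction over cells.
  These types are sets of spaces on subsets of \<open>real\<close>, so an induced sphere also has to
  be embedded into this universe: an empty type would carry no information.\<close>

primrec zcomb :: "('a, 'b) monoid_scheme \<Rightarrow> (nat \<Rightarrow> 'a) \<Rightarrow> (nat \<Rightarrow> int) \<Rightarrow> nat \<Rightarrow> 'a" where
  "zcomb A x c 0 = \<one>\<^bsub>A\<^esub>"
| "zcomb A x c (Suc n) = zcomb A x c n \<otimes>\<^bsub>A\<^esub> x n [^]\<^bsub>A\<^esub> c n"

definition zindep :: "('a, 'b) monoid_scheme \<Rightarrow> 'a set \<Rightarrow> nat \<Rightarrow> (nat \<Rightarrow> 'a) \<Rightarrow> bool" where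
  "zindep A S n x \<longleftrightarrow> (\<forall>i<n. x i \<in> S) \<and> (\<forall>c. zcomb A x c n = \<one>\<^bsub>A\<^esub> \<longrightarrow> (\<forall>i<n. c i = 0))"

text \<open>A relation, so that infinite rank needs no conventional value. \<open>S\<close> is a
  subset of the carrier because kernels and images enter exact sequences in this form. Torsion
  elements never belong to an independent family.\<close>

definition zrank :: "('a, 'b) monoid_scheme \<Rightarrow> 'a set \<Rightarrow> nat \<Rightarrow> bool" where
  "zrank A S n \<longleftrightarrow> (\<exists>x. zindep A S n x) \<and> \<not> (\<exists>x. zindep A S (Suc n) x)"

lemma zcomb_cong:
  "(\<And>i. i < n \<Longrightarrow> x i = y i) \<Longrightarrow> (\<And>i. i < n \<Longrightarrow> c i = d i) \<Longrightarrow> zcomb A x c n = zcomb A y d n"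
  by (induction n) auto

context comm_group
begin

lemma zcomb_closed: "(\<And>i. i < n \<Longrightarrow> x i \<in> carrier G) \<Longrightarrow> zcomb G x c n \<in> carrier G"
  by (induction n) auto

lemma zcomb_zero: "(\<And>i. i < n \<Longrightarrow> x i \<in> carrier G) \<Longrightarrow> (\<And>i. i < n \<Longrightarrow> c i = 0) \<Longrightarrow> zcomb G x c n = \<one>"
  by (induction n) auto

lemma zcomb_add:
  assumes "\<And>i. i < n \<Longrightarrow> x i \<in> carrier G"
  shows "zcomb G x (\<lambda>i. c i + d i) n = zcomb G x c n \<otimes> zcomb G x d n"
  using assms
proof (induction n)
  case (Suc n)
  have "zcomb G x c n \<in> carrier G" "zcomb G x d n \<in> carrier G" "x n \<in> carrier G"
    using Suc.prems by (auto intro!: zcomb_closed)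
  then show ?case using Suc by (simp add: int_pow_mult m_ac)
qed simp

lemma zcomb_scale:
  assumes "\<And>i. i < n \<Longrightarrow> x i \<in> carrier G"
  shows "zcomb G x (\<lambda>i. m * c i) n = zcomb G x c n [^] (m::int)"
  using assms
proof (induction n)
  case (Suc n)
  have "zcomb G x c n \<in> carrier G" "x n \<in> carrier G"
    using Suc.prems by (auto intro!: zcomb_closed)
  then show ?case using Suc by (simp add: int_pow_distrib int_pow_pow mult.commute)
qed (simp add: int_pow_one)

lemma zcomb_append:
  assumes "\<And>i. i < a \<Longrightarrow> x i \<in> carrier G" "\<And>i. i < b \<Longrightarrow> y i \<in> carrier G"
  shows "zcomb G (\<lambda>i. if i < a then x i else y (i - a)) c (a + b)
       = zcomb G x c a \<otimes> zcomb G y (\<lambda>i. c (i + a)) b"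
  using assms(2)
proof (induction b)
  case 0
  have "zcomb G (\<lambda>i. if i < a then x i else y (i - a)) c a = zcomb G x c a"
    by (rule zcomb_cong) auto
  then show ?case using zcomb_closed[OF assms(1)] by simp
next
  case (Suc b)
  have "zcomb G x c a \<in> carrier G" "zcomb G y (\<lambda>i. c (i + a)) b \<in> carrier G" "y b \<in> carrier G"
    using Suc.prems assms(1) by (auto intro!: zcomb_closed)
  then show ?case using Suc by (simp add: m_assoc add.commute)
qed

lemma zcomb_in_subgroup:
  assumes "subgroup S G"  "\<And>i. i < n \<Longrightarrow> x i \<in> S"
  shows "zcomb G x c n \<in> S"
  using assms(2)
proof (induction n)
  case (Suc n)
  then show ?case
    using assms(1) by (auto intro!: subgroup.m_closed subgroup_int_pow_closed)
qed (simp add: subgroup.one_closed[OF assms(1)])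

end

lemma hom_zcomb:
  assumes "comm_group A" "comm_group B" "f \<in> hom A B" "\<And>i. i < n \<Longrightarrow> x i \<in> carrier A"
  shows "f (zcomb A x c n) = zcomb B (f \<circ> x) c n"
  using assms(4)
proof (induction n)
  case 0
  then show ?case using assms by (simp add: hom_one comm_group_def)
next
  case (Suc n)
  have "zcomb A x c n \<in> carrier A" "x n \<in> carrier A"
    using Suc.prems by (auto intro!: comm_group.zcomb_closed[OF assms(1)])
  moreover have "f (x n [^]\<^bsub>A\<^esub> c n) = f (x n) [^]\<^bsub>B\<^esub> c n"
    using group_hom.hom_int_pow[of A B f "x n" "c n"] assms calculation
    by (simp add: group_hom_def group_hom_axioms_def comm_group_def)
  ultimately show ?case using Suc assms
    by (simp add: hom_mult group.int_pow_closed comm_group.axioms(2))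
qed

text \<open>One unknown and one equation are eliminated at a time, by cross-multiplication so that
  all coefficients stay integers. This takes the place of linear algebra over the rationals in the
  comparison of ranks.\<close>

lemma integer_system_solvable:
  fixes a :: "'j \<Rightarrow> nat \<Rightarrow> int"
  assumes "finite J" "n < card J"
  shows "\<exists>d. (\<exists>j\<in>J. d j \<noteq> 0) \<and> (\<forall>i<n. (\<Sum>j\<in>J. d j * a j i) = 0)"
  using assms
proof (induction n arbitrary: J a)
  case 0
  then show ?case by (intro exI[of _ "\<lambda>_. 1"]) (auto simp: card_gt_0_iff)
next
  case (Suc n)
  show ?case
  proof (cases "\<forall>j\<in>J. a j n = 0")
    case True
    obtain d where "\<exists>j\<in>J. d j \<noteq> 0" "\<forall>i<n. (\<Sum>j\<in>J. d j * a j i) = 0"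
      using Suc.IH[of J a] Suc.prems by auto
    with True show ?thesis by (intro exI[of _ d]) (auto simp: less_Suc_eq)
  next
    case False
    then obtain p where p: "p \<in> J" "a p n \<noteq> 0" by blast
    define b where "b = (\<lambda>j i. a p n * a j i - a j n * a p i)"
    have "n < card (J - {p})" using Suc.prems p by simp
    then obtain d where d: "\<exists>j\<in>J - {p}. d j \<noteq> 0" "\<forall>i<n. (\<Sum>j\<in>J-{p}. d j * b j i) = 0"
      using Suc.IH[of "J - {p}" b] Suc.prems by auto
    \<comment> \<open>The unknown at the pivot \<open>p\<close> is chosen to cancel the cross terms;
      the others are scaled by \<open>a p n\<close> instead of being divided by it, and a nonzero
      one stays nonzero because the pivot entry is nonzero.\<close>
    define e where "e = (\<lambda>j. if j = p then - (\<Sum>j\<in>J-{p}. d j * a j n) else a p n * d j)"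
    have split: "(\<Sum>j\<in>J. e j * a j i) = (\<Sum>j\<in>J-{p}. d j * b j i)" for i
    proof -
      have "(\<Sum>j\<in>J. e j * a j i) = e p * a p i + (\<Sum>j\<in>J-{p}. e j * a j i)"
        using Suc.prems p by (simp add: sum.remove)
      also have "(\<Sum>j\<in>J-{p}. e j * a j i) = (\<Sum>j\<in>J-{p}. a p n * d j * a j i)"
        by (rule sum.cong) (auto simp: e_def)
      also have "e p * a p i = (\<Sum>j\<in>J-{p}. - (d j * a j n * a p i))"
        by (simp add: e_def sum_negf sum_distrib_right)
      also have "\<dots> + (\<Sum>j\<in>J-{p}. a p n * d j * a j i) = (\<Sum>j\<in>J-{p}. d j * b j i)"
        unfolding sum.distrib[symmetric] by (rule sum.cong) (auto simp: b_def algebra_simps)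
      finally show ?thesis .
    qed
    have "(\<Sum>j\<in>J-{p}. d j * b j n) = 0" by (rule sum.neutral) (auto simp: b_def)
    moreover have "\<exists>j\<in>J. e j \<noteq> 0" using d(1) p(2) by (auto simp: e_def)
    ultimately show ?thesis using d(2) split by (intro exI[of _ e]) (auto simp: less_Suc_eq)
  qed
qed

context comm_group
begin

lemma zindep_mono:
  assumes "zindep G S n x" "m \<le> n" "S \<subseteq> carrier G"
  shows "zindep G S m x"
  unfolding zindep_def
proof (intro conjI allI impI)
  fix i assume "i < m" then show "x i \<in> S" using assms by (simp add: zindep_def)
next
  fix c i assume c: "zcomb G x c m = \<one>" and i: "i < m"
  have xin: "i < n \<Longrightarrow> x i \<in> carrier G" for i using assms by (auto simp: zindep_def)
  define d where "d = (\<lambda>i. if i < m then c i else 0)"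
  have "zcomb G x d (m + k) = \<one>" if "m + k \<le> n" for k
    using that
  proof (induction k)
    case 0
    have "zcomb G x d m = zcomb G x c m" by (rule zcomb_cong) (auto simp: d_def)
    then show ?case using c by simp
  qed (simp add: d_def)
  from this[of "n - m"] have "zcomb G x d n = \<one>" using assms by simp
  then have "d i = 0" using assms i by (simp add: zindep_def)
  then show "c i = 0" using i by (simp add: d_def)
qed

text \<open>The exchange bound, with spanning understood up to nonzero multiples as over the
  rationals. If \<open>k\<close> exceeded \<open>n\<close>, a solution \<open>d\<close> of the
  system with coefficients \<open>a j i\<close>, weighted by the multiples \<open>m j\<close>, would
  be a nontrivial relation among the \<open>y j\<close>.\<close>

lemma zindep_le_spanning:
  assumes S: "S \<subseteq> carrier G" and x: "\<And>i. i < n \<Longrightarrow> x i \<in> S"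
    and span: "\<And>z. z \<in> S \<Longrightarrow> \<exists>m c. m \<noteq> (0::int) \<and> z [^] m = zcomb G x c n"
    and y: "zindep G S k y"
  shows "k \<le> n"
proof (rule ccontr)
  assume "\<not> k \<le> n"
  then have "n < card {..<k}" by simp
  have yin: "j < k \<Longrightarrow> y j \<in> S" for j using y by (simp add: zindep_def)
  have xc: "i < n \<Longrightarrow> x i \<in> carrier G" for i using x S by auto
  have "\<forall>j. \<exists>m c. j < k \<longrightarrow> m \<noteq> (0::int) \<and> y j [^] m = zcomb G x c n"
    using span yin by blast
  then obtain m a where ma: "\<And>j. j < k \<Longrightarrow> m j \<noteq> (0::int) \<and> y j [^] m j = zcomb G x (a j) n"
    unfolding choice_iff by blast
  obtain d where d: "\<exists>j\<in>{..<k}. d j \<noteq> 0" "\<forall>i<n. (\<Sum>j\<in>{..<k}. d j * a j i) = 0"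
    using integer_system_solvable[OF _ \<open>n < card {..<k}\<close>, of a] by auto
  have "zcomb G y (\<lambda>j. m j * d j) l = zcomb G x (\<lambda>i. \<Sum>j<l. d j * a j i) n" if "l \<le> k" for l
    using that
  proof (induction l)
    case 0
    then show ?case using xc by (simp add: zcomb_zero)
  next
    case (Suc l)
    have "y l \<in> carrier G" using yin S Suc.prems by auto
    then have "y l [^] (m l * d l) = zcomb G x (\<lambda>i. d l * a l i) n"
      using ma[of l] Suc.prems xc by (simp add: int_pow_pow[symmetric] zcomb_scale)
    then show ?case using Suc xc by (simp add: zcomb_add)
  qed
  from this[of k] have "zcomb G y (\<lambda>j. m j * d j) k = \<one>" using d xc by (simp add: zcomb_zero)
  then have "\<forall>j<k. m j * d j = 0"
    using y unfolding zindep_def by (elim conjE allE[of _ "\<lambda>j. m j * d j"] impE)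
  then show False using d ma by auto
qed

text \<open>Maximality of the family: adding \<open>z\<close> destroys independence, and
  \<open>z\<close> must occur in the resulting relation because the family alone admits
  none.\<close>

lemma zrank_spanning:
  assumes r: "zrank G S n" and S: "S \<subseteq> carrier G" and x: "zindep G S n x" and z: "z \<in> S"
  shows "\<exists>m c. m \<noteq> (0::int) \<and> z [^] m = zcomb G x c n"
proof -
  define y where "y = x(n := z)"
  have xin: "i < n \<Longrightarrow> x i \<in> carrier G" for i using x S by (auto simp: zindep_def)
  have yx: "zcomb G y c n = zcomb G x c n" for c by (rule zcomb_cong) (auto simp: y_def)
  have "\<not> zindep G S (Suc n) y" using r by (auto simp: zrank_def)
  moreover have "\<forall>i<Suc n. y i \<in> S" using x z by (auto simp: y_def zindep_def)
  ultimately obtain c i where c: "zcomb G y c (Suc n) = \<one>" and i: "i < Suc n" "c i \<noteq> 0"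
    by (auto simp: zindep_def)
  have eq: "zcomb G x c n \<otimes> z [^] c n = \<one>" using c yx by (simp add: y_def)
  have zc: "z \<in> carrier G" using z S by auto
  have cc: "zcomb G x c n \<in> carrier G" using xin by (rule zcomb_closed)
  have "c n \<noteq> 0"
  proof
    assume "c n = 0"
    then have "zcomb G x c n = \<one>" using eq cc by simp
    then have "\<forall>i<n. c i = 0" using x by (simp add: zindep_def)
    then show False using i \<open>c n = 0\<close> by (auto simp: less_Suc_eq)
  qed
  moreover have "z [^] c n = zcomb G x (\<lambda>i. (-1) * c i) n"
  proof -
    have "z [^] c n \<otimes> zcomb G x c n = \<one>" using eq cc zc by (simp add: m_comm)
    then have "inv (zcomb G x c n) = z [^] c n" using cc zc by (intro inv_equality) auto
    moreover have "zcomb G x (\<lambda>i. (-1) * c i) n = zcomb G x c n [^] (-1::int)"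
      using xin by (rule zcomb_scale)
    ultimately show ?thesis using cc by (simp add: int_pow_neg int_pow_1)
  qed
  ultimately show ?thesis by blast
qed

lemma zrankI:
  assumes "S \<subseteq> carrier G" "zindep G S n x"
    "\<And>z. z \<in> S \<Longrightarrow> \<exists>m c. m \<noteq> (0::int) \<and> z [^] m = zcomb G x c n"
  shows "zrank G S n"
  unfolding zrank_def
proof (intro conjI notI)
  show "\<exists>x. zindep G S n x" using assms by auto
  assume "\<exists>x. zindep G S (Suc n) x"
  then obtain y where "zindep G S (Suc n) y" by blast
  then have "Suc n \<le> n"
    using assms by (intro zindep_le_spanning[of S n x "Suc n" y]) (auto simp: zindep_def)
  then show False by simp
qed

lemma zrank_unique:
  assumes "zrank G S m" "zrank G S n" "S \<subseteq> carrier G"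
  shows "m = n"
proof -
  have *: "\<not> m < n" if mn: "zrank G S m" "zrank G S n" for m n
  proof
    assume "m < n"
    obtain x where "zindep G S n x" using mn unfolding zrank_def by blast
    then have "zindep G S (Suc m) x" using \<open>m < n\<close> assms(3) by (auto intro: zindep_mono)
    then show False using that by (auto simp: zrank_def)
  qed
  show ?thesis using *[of m n] *[of n m] assms by (meson linorder_neqE_nat)
qed

lemma zrank_bounded:
  assumes "\<And>k x. zindep G S k x \<Longrightarrow> k \<le> n"
  shows "\<exists>r\<le>n. zrank G S r"
proof -
  let ?P = "\<lambda>k. \<exists>x. zindep G S k x"
  have P0: "?P 0" by (simp add: zindep_def)
  have bound: "\<And>k. ?P k \<Longrightarrow> k \<le> n" using assms by blast
  have "?P (Greatest ?P)" by (rule GreatestI_nat[of ?P, OF P0 bound])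
  moreover have "\<not> ?P (Suc (Greatest ?P))"
    using Greatest_le_nat[of ?P "Suc (Greatest ?P)" n] bound by auto
  ultimately show ?thesis using assms unfolding zrank_def by blast
qed

lemma zrank_max:
  assumes "zrank G S n" "S \<subseteq> carrier G" "zindep G S k x"
  shows "k \<le> n"
  using assms zindep_mono[of S k x "Suc n"] by (metis zrank_def not_less_eq_eq)

lemma zrank_subset:
  assumes "zrank G S n" "S \<subseteq> carrier G" "S' \<subseteq> S"
  shows "\<exists>r\<le>n. zrank G S' r"
proof (rule zrank_bounded)
  fix k x assume "zindep G S' k x"
  then have "zindep G S k x" using assms by (auto simp: zindep_def)
  then show "k \<le> n" using zrank_max assms by blast
qed

lemma zrank_trivial: "zrank G {\<one>} 0"
proof (rule zrankI)
  show "zindep G {\<one>} 0 (\<lambda>_. \<one>)" by (simp add: zindep_def)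
  fix z assume "z \<in> {\<one>}"
  then show "\<exists>m c. m \<noteq> (0::int) \<and> z [^] m = zcomb G (\<lambda>_. \<one>) c 0"
    by (intro exI[of _ 1]) (simp)
qed simp

end

text \<open>An independent family of the kernel, followed by lifts of one of the image, is
  independent and spans up to multiples.\<close>

lemma zrank_rank_nullity:
  assumes A: "comm_group A" and B: "comm_group B" and f: "f \<in> hom A B" and S: "subgroup S A"
    and a: "zrank A {x \<in> S. f x = \<one>\<^bsub>B\<^esub>} a" and b: "zrank B (f ` S) b"
  shows "zrank A S (a + b)"
proof -
  interpret A: comm_group A by fact
  interpret B: comm_group B by fact
  let ?K = "{x \<in> S. f x = \<one>\<^bsub>B\<^esub>}"
  have Sc: "S \<subseteq> carrier A" using S by (rule subgroup.subset)
  have fSc: "f ` S \<subseteq> carrier B" using Sc f by (auto simp: hom_def)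
  obtain x where x: "zindep A ?K a x" using a by (auto simp: zrank_def)
  obtain y' where y': "zindep B (f ` S) b y'" using b by (auto simp: zrank_def)
  then have "\<forall>i<b. \<exists>z\<in>S. f z = y' i" unfolding zindep_def by (metis imageE)
  then obtain y where y: "\<And>i. i < b \<Longrightarrow> y i \<in> S \<and> f (y i) = y' i" by metis
  have xK: "i < a \<Longrightarrow> x i \<in> ?K" for i using x by (auto simp: zindep_def)
  have xc: "i < a \<Longrightarrow> x i \<in> carrier A" and yc: "j < b \<Longrightarrow> y j \<in> carrier A" for i j
    using xK y Sc by auto
  have fy: "f (zcomb A y c b) = zcomb B y' c b" for c
    using hom_zcomb[OF A B f, of b y c] yc y by (auto intro!: zcomb_cong)
  have fx: "f (zcomb A x c a) = \<one>\<^bsub>B\<^esub>" for c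
  proof -
    have "f (zcomb A x c a) = zcomb B (f \<circ> x) c a" using hom_zcomb[OF A B f, of a x c] xc by blast
    also have "\<dots> = zcomb B (\<lambda>_. \<one>\<^bsub>B\<^esub>) c a" using xK by (intro zcomb_cong) auto
    also have "\<dots> = \<one>\<^bsub>B\<^esub>" by (induction a) (auto simp: B.int_pow_one)
    finally show ?thesis .
  qed
  have cx: "zcomb A x c a \<in> carrier A" and cy: "zcomb A y c b \<in> carrier A" for c
    using xc yc by (auto intro: A.zcomb_closed)
  define z where "z = (\<lambda>i. if i < a then x i else y (i - a))"
  have zc: "zcomb A z c (a + b) = zcomb A x c a \<otimes>\<^bsub>A\<^esub> zcomb A y (\<lambda>i. c (i + a)) b" for c
    unfolding z_def using xc yc by (rule A.zcomb_append)
  show ?thesis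
  proof (rule A.zrankI[OF Sc])
    show "zindep A S (a + b) z"
      unfolding zindep_def
    proof (intro conjI allI impI)
      fix i assume "i < a + b" then show "z i \<in> S" using xK y by (auto simp: z_def)
    next
      fix c i assume c: "zcomb A z c (a + b) = \<one>\<^bsub>A\<^esub>" and i: "i < a + b"
      have "f (zcomb A x c a \<otimes>\<^bsub>A\<^esub> zcomb A y (\<lambda>i. c (i + a)) b) = \<one>\<^bsub>B\<^esub>"
        using c f zc by (simp add: hom_one[OF f A.is_group B.is_group])
      then have "zcomb B y' (\<lambda>i. c (i + a)) b = \<one>\<^bsub>B\<^esub>"
        using hom_mult[OF f cx cy] fx fy f cy by (metis B.l_one hom_in_carrier)
      then have cb: "\<forall>i<b. c (i + a) = 0" using y' by (auto simp: zindep_def)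
      then have "zcomb A y (\<lambda>i. c (i + a)) b = \<one>\<^bsub>A\<^esub>" using yc by (intro A.zcomb_zero) auto
      then have "zcomb A x c a = \<one>\<^bsub>A\<^esub>" using c zc cx by simp
      then have ca: "\<forall>i<a. c i = 0" using x by (auto simp: zindep_def)
      show "c i = 0" using ca cb i by (cases "i < a") (auto dest!: spec[of _ "i - a"])
    qed
  next
    fix s assume s: "s \<in> S"
    then have sc: "s \<in> carrier A" using Sc by auto
    obtain m :: int and c where m: "m \<noteq> 0" "f s [^]\<^bsub>B\<^esub> m = zcomb B y' c b"
      using B.zrank_spanning[OF b fSc y', of "f s"] s by auto
    \<comment> \<open>A multiple of \<open>s\<close>, corrected by the lifts, falls into the kernel,
      where a further multiple is a combination of the \<open>x i\<close>; hence the factor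
      \<open>m * n\<close> at the end.\<close>
    define t where "t = s [^]\<^bsub>A\<^esub> m \<otimes>\<^bsub>A\<^esub> zcomb A y (\<lambda>i. (-1) * c i) b"
    have tS: "t \<in> S" unfolding t_def
      using s y S by (intro subgroup.m_closed[OF S] A.subgroup_int_pow_closed[OF S] A.zcomb_in_subgroup[OF S]) auto
    have ycm: "zcomb A y (\<lambda>i. (-1) * c i) b = inv\<^bsub>A\<^esub> (zcomb A y c b)"
      using cy[of c] A.zcomb_scale[of b y "-1" c] yc by (simp add: A.int_pow_neg)
    have sm: "s [^]\<^bsub>A\<^esub> m \<in> carrier A" using sc by simp
    have "f t = f s [^]\<^bsub>B\<^esub> m \<otimes>\<^bsub>B\<^esub> inv\<^bsub>B\<^esub> (zcomb B y' c b)"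
    proof -
      interpret group_hom A B f using f by unfold_locales
      show ?thesis unfolding t_def ycm using sm cy sc by (simp add: hom_int_pow fy)
    qed
    then have "f t = \<one>\<^bsub>B\<^esub>" using m(2) sc f by (metis B.int_pow_closed B.r_inv hom_in_carrier)
    then have tK: "t \<in> ?K" using tS by simp
    have "?K \<subseteq> carrier A" using Sc by auto
    then obtain n :: int and d where n: "n \<noteq> 0" "t [^]\<^bsub>A\<^esub> n = zcomb A x d a"
      using A.zrank_spanning[OF a _ x tK] by auto
    have tc: "t \<in> carrier A" using tS Sc by auto
    have "s [^]\<^bsub>A\<^esub> m = t \<otimes>\<^bsub>A\<^esub> zcomb A y c b"
      unfolding t_def ycm using sm cy[of c] by (simp add: A.m_assoc)
    then have "s [^]\<^bsub>A\<^esub> (m * n) = (t \<otimes>\<^bsub>A\<^esub> zcomb A y c b) [^]\<^bsub>A\<^esub> n"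
      using sc by (simp add: A.int_pow_pow[symmetric])
    also have "\<dots> = zcomb A x d a \<otimes>\<^bsub>A\<^esub> zcomb A y (\<lambda>i. n * c i) b"
      using n(2) tc cy yc by (simp add: A.int_pow_distrib A.zcomb_scale)
    also have "\<dots> = zcomb A z (\<lambda>i. if i < a then d i else n * c (i - a)) (a + b)"
      unfolding zc by (intro arg_cong2[of _ _ _ _ "mult A"] zcomb_cong) auto
    finally show "\<exists>m c. m \<noteq> (0::int) \<and> s [^]\<^bsub>A\<^esub> m = zcomb A z c (a + b)"
      using m(1) n(1) by (metis mult_eq_0_iff)
  qed
qed

text \<open>Independent elements of the image lift to independent elements of \<open>S\<close>,
  since a relation among the lifts maps to a relation below.\<close>

lemma zrank_image:
  assumes A: "comm_group A" and B: "comm_group B" and f: "f \<in> hom A B" and S: "S \<subseteq> carrier A"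
    and r: "zrank A S n"
  shows "\<exists>b\<le>n. zrank B (f ` S) b"
proof (rule comm_group.zrank_bounded[OF B])
  fix k y' assume y': "zindep B (f ` S) k y'"
  then have "\<forall>i<k. \<exists>z\<in>S. f z = y' i" unfolding zindep_def by (metis imageE)
  then obtain y where y: "\<And>i. i < k \<Longrightarrow> y i \<in> S \<and> f (y i) = y' i" by metis
  then have yc: "i < k \<Longrightarrow> y i \<in> carrier A" for i using S by auto
  have "zindep A S k y"
    unfolding zindep_def
  proof (intro conjI allI impI)
    fix c i assume c: "zcomb A y c k = \<one>\<^bsub>A\<^esub>" "i < k"
    have "zcomb B y' c k = zcomb B (f \<circ> y) c k" using y by (intro zcomb_cong) auto
    also have "\<dots> = f (zcomb A y c k)" using hom_zcomb[OF A B f, of k y c] yc by simp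
    also have "\<dots> = \<one>\<^bsub>B\<^esub>" using c hom_one[OF f] A B by (simp add: comm_group_def)
    finally show "c i = 0" using y' c by (simp add: zindep_def)
  qed (use y in auto)
  then show "k \<le> n" using comm_group.zrank_max[OF A r S] by blast
qed

text \<open>Meant for the terms of an exact sequence: a finite rank of \<open>S\<close> bounds the
  ranks of kernel and image, which therefore exist and add up to it.\<close>

lemma zrank_split:
  assumes A: "comm_group A" and B: "comm_group B" and f: "f \<in> hom A B" and S: "subgroup S A"
    and r: "zrank A S n"
  obtains a b where "zrank A {x \<in> S. f x = \<one>\<^bsub>B\<^esub>} a" "zrank B (f ` S) b" "n = a + b"
proof -
  have Sc: "S \<subseteq> carrier A" using S by (rule subgroup.subset)
  obtain a where a: "zrank A {x \<in> S. f x = \<one>\<^bsub>B\<^esub>} a"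
    using comm_group.zrank_subset[OF A r Sc, of "{x \<in> S. f x = \<one>\<^bsub>B\<^esub>}"] by auto
  obtain b where b: "zrank B (f ` S) b" using zrank_image[OF A B f Sc r] by blast
  have "zrank A S (a + b)" by (rule zrank_rank_nullity[OF A B f S a b])
  then have "n = a + b" using comm_group.zrank_unique[OF A r _ Sc] by blast
  with a b show ?thesis by (rule that)
qed

lemma zrank_iso:
  assumes A: "comm_group A" and B: "comm_group B" and "A \<cong> B" "zrank A (carrier A) n"
  shows "zrank B (carrier B) n"
proof -
  obtain f where f: "f \<in> hom A B" "bij_betw f (carrier A) (carrier B)"
    using assms by (auto simp: is_iso_def iso_def)
  have "subgroup (carrier A) A" using A by (simp add: comm_group_def group.subgroup_self)
  then obtain a b where ab: "zrank A {x \<in> carrier A. f x = \<one>\<^bsub>B\<^esub>} a" "zrank B (f ` carrier A) b" "n = a + b"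
    using zrank_split[OF A B f(1) _ assms(4)] by blast
  have oneA: "\<one>\<^bsub>A\<^esub> \<in> carrier A" using A by (simp add: comm_group_def group.is_monoid)
  have "{x \<in> carrier A. f x = \<one>\<^bsub>B\<^esub>} = {\<one>\<^bsub>A\<^esub>}"
  proof -
    have 1: "f \<one>\<^bsub>A\<^esub> = \<one>\<^bsub>B\<^esub>" using hom_one[OF f(1)] A B by (simp add: comm_group_def)
    moreover have "inj_on f (carrier A)" using f by (simp add: bij_betw_def)
    ultimately have "x = \<one>\<^bsub>A\<^esub>" if "x \<in> carrier A" "f x = \<one>\<^bsub>B\<^esub>" for x
      using inj_onD[of f "carrier A" x "\<one>\<^bsub>A\<^esub>"] oneA that by simp
    then show ?thesis using 1 oneA by blast
  qed
  then have "a = 0"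
    using ab(1) comm_group.zrank_trivial[OF A] comm_group.zrank_unique[OF A, of "{\<one>\<^bsub>A\<^esub>}"] oneA by auto
  then show ?thesis using ab f by (simp add: bij_betw_def)
qed

lemma zrank_trivial_group:
  assumes "trivial_group A" shows "zrank A (carrier A) 0"
proof -
  have "comm_group A"
    using assms by (auto simp: trivial_group_def intro!: group.group_comm_groupI)
  then show ?thesis using assms comm_group.zrank_trivial[of A] by (simp add: trivial_group_def)
qed

lemma zrank_integer_group: "zrank integer_group (carrier integer_group) 1"
proof -
  interpret comm_group integer_group by (rule abelian_integer_group)
  show ?thesis
  proof (rule zrankI)
    show "zindep integer_group (carrier integer_group) 1 (\<lambda>_. 1)"
      by (auto simp: zindep_def group_int_pow_integer_group)
    fix z :: int
    show "\<exists>m c. m \<noteq> (0::int) \<and> z [^]\<^bsub>integer_group\<^esub> m = zcomb integer_group (\<lambda>_. 1) c 1"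
      by (rule exI[of _ 1], rule exI[of _ "\<lambda>_. z"]) (simp add: group_int_pow_integer_group)
  qed simp
qed

section \<open>The Euler characteristic of a pair\<close>

text \<open>Again a relation: finiteness of the ranks and their vanishing in high degrees are part
  of the claim. Natural numbers suffice as degrees since homology in negative degrees is trivial.
  With \<open>S\<close> a point this is the reduced Euler characteristic.\<close>

definition euler_number :: "'a topology \<Rightarrow> 'a set \<Rightarrow> int \<Rightarrow> bool" where
  "euler_number X S c \<longleftrightarrow>
     (\<exists>r N. (\<forall>p::nat. zrank (relative_homology_group (int p) X S)
                           (carrier (relative_homology_group (int p) X S)) (r p)) \<and>
            (\<forall>p\<ge>N. r p = 0) \<and> c = (\<Sum>p<N. (- 1) ^ p * int (r p)))"

lemma sum_eventually_zero:
  fixes f :: "nat \<Rightarrow> int"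
  assumes "\<And>p. p \<ge> M \<Longrightarrow> f p = 0" "M \<le> N"
  shows "(\<Sum>p<N. f p) = (\<Sum>p<M. f p)"
  using assms by (intro sum.mono_neutral_right) auto

lemma euler_number_unique:
  assumes "euler_number X S c" "euler_number X S d"
  shows "c = d"
proof -
  obtain r M where r: "\<forall>p::nat. zrank (relative_homology_group (int p) X S)
        (carrier (relative_homology_group (int p) X S)) (r p)"
    "\<forall>p\<ge>M. r p = 0" "c = (\<Sum>p<M. (- 1) ^ p * int (r p))"
    using assms(1) by (auto simp: euler_number_def)
  obtain s N where s: "\<forall>p::nat. zrank (relative_homology_group (int p) X S)
        (carrier (relative_homology_group (int p) X S)) (s p)"
    "\<forall>p\<ge>N. s p = 0" "d = (\<Sum>p<N. (- 1) ^ p * int (s p))"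
    using assms(2) by (auto simp: euler_number_def)
  have "r = s"
    by (rule ext) (metis r(1) s(1) comm_group.zrank_unique abelian_relative_homology_group subset_refl)
  moreover have "c = (\<Sum>p<max M N. (- 1) ^ p * int (r p))"
    unfolding r(3) using r(2) by (intro sum_eventually_zero[symmetric]) auto
  moreover have "d = (\<Sum>p<max M N. (- 1) ^ p * int (s p))"
    unfolding s(3) using s(2) by (intro sum_eventually_zero[symmetric]) auto
  ultimately show ?thesis by simp
qed

lemma euler_number_iso:
  assumes "\<And>p. relative_homology_group p X S \<cong> relative_homology_group p Y T" "euler_number X S c"
  shows "euler_number Y T c"
  using assms zrank_iso[OF abelian_relative_homology_group abelian_relative_homology_group]
  unfolding euler_number_def by blast

lemma alternating_telescope:
  fixes d :: "nat \<Rightarrow> int"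
  shows "(\<Sum>p<N. (- 1) ^ p * (d (Suc p) + d p)) = d 0 - (- 1) ^ N * d N"
  by (induction N) (auto simp: algebra_simps)

text \<open>Additivity along the long exact sequence of the triple. The ranks of the two outer terms
  split into ranks of a kernel and an image; the image of each boundary map is counted in two
  neighbouring degrees with opposite signs and cancels.\<close>

lemma euler_number_triple:
  assumes "T \<subseteq> S" and A: "euler_number (subtopology X S) T a" and C: "euler_number X S c"
  shows "euler_number X T (a + c)"
proof -
  let ?A = "\<lambda>p. relative_homology_group p (subtopology X S) T"
  let ?X = "\<lambda>p. relative_homology_group p X T"
  let ?C = "\<lambda>p. relative_homology_group p X S"
  let ?i = "\<lambda>p. hom_induced p (subtopology X S) T X T id"
  let ?j = "\<lambda>p. hom_induced p X T X S id"
  let ?b = "\<lambda>p. hom_relboundary p X S T"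
  obtain rA NA where rA: "\<And>p::nat. zrank (?A p) (carrier (?A p)) (rA p)"
    "\<And>p. p \<ge> NA \<Longrightarrow> rA p = 0" "a = (\<Sum>p<NA. (- 1) ^ p * int (rA p))"
    using A by (auto simp: euler_number_def)
  obtain rC NC where rC: "\<And>p::nat. zrank (?C p) (carrier (?C p)) (rC p)"
    "\<And>p. p \<ge> NC \<Longrightarrow> rC p = 0" "c = (\<Sum>p<NC. (- 1) ^ p * int (rC p))"
    using C by (auto simp: euler_number_def)
  have sub: "subgroup (carrier (relative_homology_group p Y U)) (relative_homology_group p Y U)"
    for p and Y :: "'a topology" and U
    by (simp add: group.subgroup_self)
  have ib: "?i p \<in> hom (?A p) (?X p)" and jb: "?j p \<in> hom (?X p) (?C p)"
    and bb: "?b p \<in> hom (?C p) (?A (p - 1))" for p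
    by (auto simp: hom_induced_hom group_homomorphism_hom_relboundary)
  have ex1: "?j p ` carrier (?X p) = {x \<in> carrier (?C p). ?b p x = \<one>\<^bsub>?A (p - 1)\<^esub>}" for p
    using homology_exactness_triple_1[OF assms(1), of p X] by (auto simp: kernel_def)
  have ex2: "?b (p + 1) ` carrier (?C (p + 1)) = {x \<in> carrier (?A p). ?i p x = \<one>\<^bsub>?X p\<^esub>}" for p
    using homology_exactness_triple_2[OF assms(1), of "p + 1" X] by (auto simp: kernel_def)
  have ex3: "?i p ` carrier (?A p) = {x \<in> carrier (?X p). ?j p x = \<one>\<^bsub>?C p\<^esub>}" for p
    using homology_exactness_triple_3[OF assms(1), of p X] by (auto simp: kernel_def)
  have "\<exists>k d. zrank (?C p) {x \<in> carrier (?C p). ?b p x = \<one>\<^bsub>?A (int p - 1)\<^esub>} k \<and>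
      zrank (?A (int p - 1)) (?b p ` carrier (?C p)) d \<and> rC p = k + d" for p :: nat
    by (rule zrank_split[OF abelian_relative_homology_group abelian_relative_homology_group bb sub rC(1)]) blast
  then have "\<forall>p. \<exists>k d. zrank (?C (int p)) {x \<in> carrier (?C (int p)). ?b p x = \<one>\<^bsub>?A (int p - 1)\<^esub>} k \<and>
      zrank (?A (int p - 1)) (?b (int p) ` carrier (?C (int p))) d \<and> rC p = k + d" by blast
  then obtain k d where kd: "\<And>p. zrank (?C (int p)) {x \<in> carrier (?C (int p)). ?b p x = \<one>\<^bsub>?A (int p - 1)\<^esub>} (k p)"
      "\<And>p. zrank (?A (int p - 1)) (?b (int p) ` carrier (?C (int p))) (d p)"
      "\<And>p. rC p = k p + d p" unfolding choice_iff by blast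
  have "\<exists>l m. zrank (?A p) {x \<in> carrier (?A p). ?i p x = \<one>\<^bsub>?X p\<^esub>} l \<and>
      zrank (?X p) (?i p ` carrier (?A p)) m \<and> rA p = l + m" for p :: nat
    by (rule zrank_split[OF abelian_relative_homology_group abelian_relative_homology_group ib sub rA(1)]) blast
  then have "\<forall>p. \<exists>l m. zrank (?A (int p)) {x \<in> carrier (?A (int p)). ?i p x = \<one>\<^bsub>?X (int p)\<^esub>} l \<and>
      zrank (?X (int p)) (?i (int p) ` carrier (?A (int p))) m \<and> rA p = l + m" by blast
  then obtain l m where lm: "\<And>p. zrank (?A (int p)) {x \<in> carrier (?A (int p)). ?i p x = \<one>\<^bsub>?X (int p)\<^esub>} (l p)"
      "\<And>p. zrank (?X (int p)) (?i (int p) ` carrier (?A (int p))) (m p)"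
      "\<And>p. rA p = l p + m p" unfolding choice_iff by blast
  \<comment> \<open>Exactness at the homology of the subspace: the kernel of the inclusion in degree
    p is the image of the boundary from degree p + 1, which produces the shift.\<close>
  have ld: "l p = d (Suc p)" for p
  proof -
    have "zrank (?A (int p)) {x \<in> carrier (?A (int p)). ?i p x = \<one>\<^bsub>?X (int p)\<^esub>} (d (Suc p))"
      using kd(2)[of "Suc p"] ex2[of "int p"] by (simp add: add.commute)
    then show ?thesis
      using comm_group.zrank_unique[OF abelian_relative_homology_group lm(1)] by auto
  qed
  have rX: "zrank (?X (int p)) (carrier (?X (int p))) (m p + k p)" for p
    using lm(2)[of p] kd(1)[of p] ex1[of "int p"] ex3[of "int p"]
    by (intro zrank_rank_nullity[OF _ _ jb sub]) auto
  \<comment> \<open>The telescoping sum leaves the term in degree 0, which vanishes because the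
    boundary map there lands in degree -1.\<close>
  have "?b 0 ` carrier (?C 0) \<subseteq> carrier (?A (- 1))" using bb[of 0] by (auto simp: hom_def)
  moreover have "trivial_group (?A (- 1))" by simp
  ultimately have "d 0 = 0"
    using kd(2)[of 0] comm_group.zrank_subset[of "?A (-1)" "carrier (?A (-1))" 0 "?b 0 ` carrier (?C 0)"]
      comm_group.zrank_unique[of "?A (-1)" "?b 0 ` carrier (?C 0)" "d 0"] zrank_trivial_group[of "?A (-1)"]
    by auto
  let ?N = "max NA NC"
  have d0: "d p = 0" if "p \<ge> NC" for p using kd(3)[of p] rC(2)[OF that] by simp
  have "a + c = (\<Sum>p<?N. (- 1) ^ p * int (rA p)) + (\<Sum>p<?N. (- 1) ^ p * int (rC p))"
    unfolding rA(3) rC(3) using rA(2) rC(2)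
    by (intro arg_cong2[of _ _ _ _ "(+)"] sum_eventually_zero[symmetric]) auto
  also have "\<dots> = (\<Sum>p<?N. (- 1) ^ p * int (m p + k p)) + (\<Sum>p<?N. (- 1) ^ p * (int (d (Suc p)) + int (d p)))"
    unfolding sum.distrib[symmetric] by (rule sum.cong) (auto simp: lm(3) kd(3) ld algebra_simps)
  also have "(\<Sum>p<?N. (- 1) ^ p * (int (d (Suc p)) + int (d p))) = 0"
    using alternating_telescope[where d="\<lambda>p. int (d p)"] \<open>d 0 = 0\<close> d0[of ?N] by simp
  finally have sum: "a + c = (\<Sum>p<?N. (- 1) ^ p * int (m p + k p))" by simp
  have "m p + k p = 0" if "p \<ge> ?N" for p
    using that rA(2)[of p] rC(2)[of p] lm(3)[of p] kd(3)[of p] by auto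
  then show ?thesis unfolding euler_number_def using rX sum
    by (intro exI[of _ "\<lambda>p. m p + k p"] exI[of _ ?N]) auto
qed

section \<open>Attaching a cell\<close>

definition vnorm :: "nat \<Rightarrow> (nat \<Rightarrow> real) \<Rightarrow> real" where
  "vnorm k v = sqrt (\<Sum>i<k. (v i)\<^sup>2)"

definition disk_space :: "nat \<Rightarrow> (nat \<Rightarrow> real) topology" where
  "disk_space k = subtopology (Euclidean_space k) (closed_disk k)"

lemma vnorm_nonneg [simp]: "0 \<le> vnorm k v"
  by (simp add: vnorm_def sum_nonneg)

lemma vnorm_scale: "vnorm k (\<lambda>i. c * v i) = \<bar>c\<bar> * vnorm k v"
  by (simp add: vnorm_def power_mult_distrib flip: sum_distrib_left)
    (simp add: real_sqrt_mult)

lemma closed_disk_vnorm: "closed_disk k = {v. (\<forall>i\<ge>k. v i = 0) \<and> vnorm k v \<le> 1}"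
  and open_disk_vnorm: "open_disk k = {v. (\<forall>i\<ge>k. v i = 0) \<and> vnorm k v < 1}"
  and bd_sphere_vnorm: "bd_sphere k = {v. (\<forall>i\<ge>k. v i = 0) \<and> vnorm k v = 1}"
  by (auto simp: closed_disk_def open_disk_def bd_sphere_def vnorm_def topspace_Euclidean_space)

lemma closed_disk_split: "closed_disk k = open_disk k \<union> bd_sphere k" "open_disk k \<inter> bd_sphere k = {}"
  by (auto simp: closed_disk_vnorm open_disk_vnorm bd_sphere_vnorm)

lemma topspace_disk_space [simp]: "topspace (disk_space k) = closed_disk k"
  by (auto simp: closed_disk_def disk_space_def)

lemma continuous_map_disk_space: "continuous_map (Euclidean_space k) Y f \<Longrightarrow> continuous_map (disk_space k) Y f"
  by (simp add: disk_space_def continuous_map_from_subtopology)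

lemma continuous_map_into_disk_space:
  "continuous_map X (disk_space k) f \<longleftrightarrow> continuous_map X (Euclidean_space k) f \<and> f \<in> topspace X \<rightarrow> closed_disk k"
  by (simp add: disk_space_def continuous_map_in_subtopology)

lemma continuous_map_coordinate: "continuous_map (Euclidean_space k) euclideanreal (\<lambda>v. v i)"
  unfolding Euclidean_space_def by (intro continuous_intros) auto

lemma continuous_map_vnorm: "continuous_map (Euclidean_space k) euclideanreal (vnorm k)"
  unfolding vnorm_def [abs_def]
  by (intro continuous_intros continuous_map_coordinate) auto

lemma Hausdorff_disk_space: "Hausdorff_space (disk_space k)"
  by (simp add: disk_space_def Hausdorff_Euclidean_space Hausdorff_space_subtopology)

lemma compact_disk_space: "compact_space (disk_space k)"
proof -
  let ?B = "\<lambda>i. if i < k then {-1..1::real} else {0}"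
  have "compactin (powertop_real UNIV) (PiE UNIV ?B)"
    by (subst compactin_PiE) auto
  moreover have "PiE UNIV ?B \<subseteq> {x. \<forall>i\<ge>k. x i = 0}"
    by (auto simp: PiE_iff) (metis leD singletonD)
  ultimately have comp: "compactin (Euclidean_space k) (PiE UNIV ?B)"
    unfolding Euclidean_space_def by (simp add: compactin_subtopology)
  have sub: "closed_disk k \<subseteq> PiE UNIV ?B"
  proof
    fix v assume v: "v \<in> closed_disk k"
    have "\<bar>v i\<bar> \<le> 1" if "i < k" for i
    proof -
      have "(v i)\<^sup>2 \<le> (\<Sum>i<k. (v i)\<^sup>2)" using that by (intro member_le_sum) auto
      then have "(v i)\<^sup>2 \<le> 1" using v by (simp add: closed_disk_def)
      then show ?thesis by (simp add: abs_square_le_1)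
    qed
    then show "v \<in> PiE UNIV ?B" using v
      by (auto simp: closed_disk_vnorm abs_le_iff minus_le_iff)
  qed
  have cl: "closedin (Euclidean_space k) (closed_disk k)"
  proof -
    have "closedin (Euclidean_space k) {v \<in> topspace (Euclidean_space k). vnorm k v \<in> {..1}}"
      by (rule closedin_continuous_map_preimage[OF continuous_map_vnorm]) auto
    moreover have "{v \<in> topspace (Euclidean_space k). vnorm k v \<in> {..1}} = closed_disk k"
      by (auto simp: closed_disk_vnorm topspace_Euclidean_space)
    ultimately show ?thesis by simp
  qed
  have "compactin (Euclidean_space k) (closed_disk k)"
    by (rule closed_compactin[OF comp sub cl])
  then show ?thesis by (simp add: disk_space_def compact_space_subtopology)
qed

lemma closedin_disk_sublevel:
  "closedin (disk_space k) {v \<in> closed_disk k. vnorm k v \<le> c}"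
  "closedin (disk_space k) {v \<in> closed_disk k. c \<le> vnorm k v}"
proof -
  have c: "continuous_map (disk_space k) euclideanreal (vnorm k)"
    by (rule continuous_map_disk_space[OF continuous_map_vnorm])
  show "closedin (disk_space k) {v \<in> closed_disk k. vnorm k v \<le> c}"
    using closedin_continuous_map_preimage[OF c, of "{..c}"] by (simp only: topspace_disk_space atMost_iff closed_atMost closed_closedin[symmetric] simp_thms)
  show "closedin (disk_space k) {v \<in> closed_disk k. c \<le> vnorm k v}"
    using closedin_continuous_map_preimage[OF c, of "{c..}"] by (simp only: topspace_disk_space atLeast_iff closed_atLeast closed_closedin[symmetric] simp_thms)
qed

lemma bd_sphere_closedin: "closedin (disk_space k) (bd_sphere k)"
proof -
  have "bd_sphere k = {v \<in> closed_disk k. 1 \<le> vnorm k v}"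
    by (auto simp: closed_disk_vnorm bd_sphere_vnorm)
  then show ?thesis using closedin_disk_sublevel(2)[of k 1] by simp
qed

text \<open>Scaling by \<open>1 + t\<close> with the radius cut off at 1. At time 1 every point of
  the disk of radius at least 1/2 has reached the sphere, while points of the sphere never move: the
  stretch pushes a collar to the boundary and fits together with the identity outside a
  cell.\<close>

definition radial_stretch :: "nat \<Rightarrow> real \<Rightarrow> (nat \<Rightarrow> real) \<Rightarrow> nat \<Rightarrow> real" where
  "radial_stretch k t v = (\<lambda>i. ((1 + t) / max 1 ((1 + t) * vnorm k v)) * v i)"

lemma vnorm_radial_stretch:
  "0 \<le> t \<Longrightarrow> vnorm k (radial_stretch k t v) = (1 + t) * vnorm k v / max 1 ((1 + t) * vnorm k v)"
  unfolding radial_stretch_def vnorm_scale by (simp add: abs_of_nonneg)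

lemma radial_stretch_disk:
  assumes "0 \<le> t" "v \<in> closed_disk k" shows "radial_stretch k t v \<in> closed_disk k"
  using assms by (auto simp: closed_disk_vnorm vnorm_radial_stretch) (auto simp: radial_stretch_def)

lemma radial_stretch_0: "v \<in> closed_disk k \<Longrightarrow> radial_stretch k 0 v = v"
  by (auto simp: closed_disk_vnorm radial_stretch_def max_def)

lemma radial_stretch_bd: "0 \<le> t \<Longrightarrow> v \<in> bd_sphere k \<Longrightarrow> radial_stretch k t v = v"
  by (auto simp: bd_sphere_vnorm radial_stretch_def max_def)

lemma radial_stretch_collar:
  assumes "0 \<le> t" "v \<in> closed_disk k" "1/2 \<le> vnorm k v"
  shows "1/2 \<le> vnorm k (radial_stretch k t v)"
proof -
  have "vnorm k v \<le> 1" using assms by (simp add: closed_disk_vnorm)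
  then have "vnorm k v \<le> (1 + t) * vnorm k v" using assms by (simp add: mult_le_cancel_right1)
  then have "1/2 \<le> (1 + t) * vnorm k v" using assms by linarith
  then show ?thesis using assms by (simp add: vnorm_radial_stretch max_def field_simps)
qed

lemma radial_stretch_1:
  assumes "v \<in> closed_disk k" "1/2 \<le> vnorm k v"
  shows "radial_stretch k 1 v \<in> bd_sphere k"
proof -
  have "vnorm k (radial_stretch k 1 v) = 1"
    using assms by (simp add: vnorm_radial_stretch max_def)
  moreover have "radial_stretch k 1 v \<in> closed_disk k" using assms radial_stretch_disk by simp
  ultimately show ?thesis by (simp add: closed_disk_vnorm bd_sphere_vnorm)
qed

lemma continuous_map_radial_stretch:
  "continuous_map (prod_topology (top_of_set {0..1::real}) (disk_space k)) (disk_space k)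
     (\<lambda>(t, v). radial_stretch k t v)"
proof -
  let ?P = "prod_topology (top_of_set {0..1::real}) (disk_space k)"
  have f: "continuous_map ?P euclideanreal fst"
    using continuous_map_fst continuous_map_into_fulltopology by blast
  have n: "continuous_map ?P euclideanreal (\<lambda>x. vnorm k (snd x))"
    using continuous_map_compose[OF continuous_map_snd continuous_map_disk_space[OF continuous_map_vnorm]]
    by (simp add: o_def)
  have c: "continuous_map ?P euclideanreal (\<lambda>x. snd x i)" for i
    using continuous_map_compose[OF continuous_map_snd continuous_map_disk_space[OF continuous_map_coordinate]]
    by (simp add: o_def)
  have "continuous_map ?P (Euclidean_space k)
     (\<lambda>x i. if i < k then ((1 + fst x) / max 1 ((1 + fst x) * vnorm k (snd x))) * snd x i else 0)"
    unfolding continuous_map_componentwise_Euclidean_space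
    by (intro allI impI continuous_intros f n c) (auto simp: max_def)
  then have "continuous_map ?P (Euclidean_space k) (\<lambda>(t, v). radial_stretch k t v)"
    by (rule continuous_map_eq) (auto simp: radial_stretch_def closed_disk_vnorm fun_eq_iff)
  then show ?thesis
    by (auto simp: continuous_map_into_disk_space intro!: radial_stretch_disk)
qed

text \<open>The right side mentions only the disk. Stretching the cell radially deforms
  \<open>C\<close>, which is \<open>D\<close> together with a collar, into \<open>D\<close>, so the
  pair may be enlarged to that of \<open>M\<close> and \<open>C\<close>; then \<open>D\<close> can
  be excised, and what remains is a homeomorphic image of the open disk.\<close>

lemma relative_homology_attach_aux:
  assumes M: "Hausdorff_space M" and top: "topspace M = D \<union> f ` closed_disk k"
    and D: "closedin M D" and f: "continuous_map (disk_space k) M f"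
    and bd: "f ` bd_sphere k \<subseteq> D" and inj: "inj_on f (open_disk k)"
    and disj: "f ` open_disk k \<inter> D = {}"
  shows "relative_homology_group p M D \<cong>
         relative_homology_group p (subtopology (disk_space k) (open_disk k))
            {v \<in> open_disk k. 1/2 \<le> vnorm k v}"
proof -
  define C where "C = D \<union> f ` {v \<in> closed_disk k. 1/2 \<le> vnorm k v}"
  \<comment> \<open>On the open cell the stretch is transported by \<open>f\<close>; elsewhere
    \<open>F\<close> is the identity. The two agree on the image of the sphere, where the stretch
    does nothing.\<close>
  define F where "F = (\<lambda>(t, x). if x \<in> f ` open_disk k
      then f (radial_stretch k t (inv_into (open_disk k) f x)) else x)"
  have oc: "open_disk k \<subseteq> closed_disk k" "bd_sphere k \<subseteq> closed_disk k"
    using closed_disk_split by auto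
  have FD: "F (t, x) = x" if "x \<in> D" for t x using that disj by (auto simp: F_def)
  have Ff: "F (t, f v) = f (radial_stretch k t v)" if "v \<in> closed_disk k" "0 \<le> t" for t v
  proof (cases "v \<in> open_disk k")
    case True
    then show ?thesis by (simp add: F_def inj)
  next
    case False
    then have "v \<in> bd_sphere k" using that closed_disk_split by auto
    then show ?thesis using FD bd that by (auto simp: radial_stretch_bd)
  qed
  have F0: "F (0, x) = x" for x
    using oc by (auto simp: F_def inj radial_stretch_0)
  have fc: "f v \<in> topspace M" if "v \<in> closed_disk k" for v using that top by auto
  have Ftop: "F (t, x) \<in> topspace M" if "0 \<le> t" "x \<in> topspace M" for t x
    using that top FD Ff fc radial_stretch_disk by auto
  let ?I = "top_of_set {0..1::real}"
  have compI: "compact_space ?I" by (simp add: compact_space_subtopology)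
  have contF: "continuous_map (prod_topology ?I M) M F"
    unfolding continuous_map_closedin
  proof (intro conjI ballI allI impI)
    show "F \<in> topspace (prod_topology ?I M) \<rightarrow> topspace M" using Ftop by auto
  next
    fix Z assume Z: "closedin M Z"
    let ?f' = "\<lambda>(t::real, v). (t, f v)"
    let ?Q = "{y \<in> topspace (prod_topology ?I (disk_space k)). (f \<circ> (\<lambda>(t, v). radial_stretch k t v)) y \<in> Z}"
    \<comment> \<open>Continuity is tested on closed sets: the preimage consists of a closed part
      over \<open>D\<close> and the image of a compact set, which is closed because the product is
      Hausdorff.\<close>
    have eq: "{x \<in> topspace (prod_topology ?I M). F x \<in> Z} = {0..1} \<times> (D \<inter> Z) \<union> ?f' ` ?Q"
    proof (rule subset_antisym; rule subsetI)
      fix x assume x: "x \<in> {x \<in> topspace (prod_topology ?I M). F x \<in> Z}"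
      obtain t y where ty: "x = (t, y)" by (cases x)
      show "x \<in> {0..1} \<times> (D \<inter> Z) \<union> ?f' ` ?Q"
      proof (cases "y \<in> D")
        case True
        then show ?thesis using x ty FD by auto
      next
        case False
        then obtain v where "v \<in> closed_disk k" "y = f v" using x ty top by auto
        then show ?thesis using x ty Ff by (auto intro!: image_eqI[of _ _ "(t, v)"])
      qed
    next
      fix x assume "x \<in> {0..1} \<times> (D \<inter> Z) \<union> ?f' ` ?Q"
      then show "x \<in> {x \<in> topspace (prod_topology ?I M). F x \<in> Z}"
        using top FD Ff by auto
    qed
    have "closedin (prod_topology ?I M) ({0..1} \<times> (D \<inter> Z))"
      using D Z by (simp add: closedin_prod_Times_iff closedin_Int)
    moreover have "closedin (prod_topology ?I M) (?f' ` ?Q)"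
    proof -
      have cl: "closedin (prod_topology ?I (disk_space k)) ?Q"
        by (rule closedin_continuous_map_preimage[OF continuous_map_compose[OF continuous_map_radial_stretch f] Z])
      have "compact_space (prod_topology ?I (disk_space k))"
        by (simp add: compact_space_prod_topology compI compact_disk_space)
      then have comp: "compactin (prod_topology ?I (disk_space k)) ?Q"
        using cl by (rule closedin_compact_space)
      have "continuous_map (prod_topology ?I (disk_space k)) (prod_topology ?I M) ?f'"
        using f by (simp add: continuous_map_prod_top)
      then have "compactin (prod_topology ?I M) (?f' ` ?Q)" by (rule image_compactin[OF comp])
      moreover have "Hausdorff_space (prod_topology ?I M)"
        using M by (simp add: Hausdorff_space_prod_topology Hausdorff_space_subtopology)
      ultimately show ?thesis by (simp add: compactin_imp_closedin)
    qed
    ultimately show "closedin (prod_topology ?I M) {x \<in> topspace (prod_topology ?I M). F x \<in> Z}"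
      unfolding eq by (rule closedin_Un)
  qed
  have FC: "F (t, x) \<in> C" if "x \<in> C" "0 \<le> t" for t x
    using that FD Ff radial_stretch_collar radial_stretch_disk by (auto simp: C_def)
  have F1C: "F (1, x) \<in> D" if "x \<in> C" for x
    using that FD Ff radial_stretch_1 bd by (auto simp: C_def)
  have DC: "D \<subseteq> C" by (auto simp: C_def)
  define r where "r = (\<lambda>x. F (1, x))"
  have hom: "homotopic_with P M M r id" if "\<And>t. 0 \<le> t \<Longrightarrow> P (\<lambda>x. F (t, x))" for P
  proof -
    have "\<forall>t\<in>{0..1}. P (\<lambda>x. F (t, x))" using that by simp
    then have "homotopic_with P M M id r"
      unfolding homotopic_with_def using contF F0 by (intro exI[of _ F]) (simp add: r_def)
    then show ?thesis by (rule homotopic_with_symD)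
  qed
  have contr: "continuous_map M M r"
    using hom[of "\<lambda>_. True"] homotopic_with_imp_continuous_maps by blast
  have 1: "relative_homology_group p M D \<cong> relative_homology_group p M C"
  proof (rule homotopy_equivalent_space_imp_isomorphic_relative_homology_groups)
    show "continuous_map M M id" "continuous_map M M r" "id \<in> D \<rightarrow> C" "r \<in> C \<rightarrow> D"
      using contr DC F1C by (auto simp: r_def)
    show "homotopic_with (\<lambda>h. h \<in> D \<rightarrow> D) M M (r \<circ> id) id"
      using hom[of "\<lambda>h. h \<in> D \<rightarrow> D"] FD by auto
    show "homotopic_with (\<lambda>k. k \<in> C \<rightarrow> C) M M (id \<circ> r) id"
      using hom[of "\<lambda>h. h \<in> C \<rightarrow> C"] FC by auto
  qed
  have clf: "closed_map (disk_space k) M f"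
    by (rule continuous_imp_closed_map[OF f compact_disk_space M])
  \<comment> \<open>Excision asks for the closure of \<open>D\<close> to lie in the interior of
    \<open>C\<close>. The complement of the image of the ball of radius 1/2 is an open set between
    them.\<close>
  have intC: "D \<subseteq> M interior_of C"
  proof -
    let ?H = "f ` {v \<in> closed_disk k. vnorm k v \<le> 1/2}"
    have "closedin M ?H" using clf closedin_disk_sublevel(1)[of k "1/2"] unfolding closed_map_def by blast
    then have "openin M (topspace M - ?H)" by auto
    moreover have "topspace M - ?H \<subseteq> C"
    proof
      fix y assume y: "y \<in> topspace M - ?H"
      show "y \<in> C"
      proof (cases "y \<in> D")
        case False
        then obtain v where v: "v \<in> closed_disk k" "y = f v" using y top by auto
        then have "\<not> vnorm k v \<le> 1/2" using y by blast
        then show ?thesis using v unfolding C_def by auto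
      qed (simp add: C_def)
    qed
    ultimately have "topspace M - ?H \<subseteq> M interior_of C" by (simp add: interior_of_maximal)
    moreover have "{v \<in> closed_disk k. vnorm k v \<le> 1/2} \<subseteq> open_disk k"
      by (auto simp: closed_disk_vnorm open_disk_vnorm)
    then have "D \<subseteq> topspace M - ?H" using disj top by blast
    ultimately show ?thesis by blast
  qed
  have Csub: "C \<subseteq> topspace M" using top by (auto simp: C_def)
  have "relative_homology_group p (subtopology M (topspace M - D)) (C - D) \<cong>
        relative_homology_group p (subtopology M (topspace M)) C"
    using homology_excision_axiom[of M D C "topspace M" p] intC Csub closure_of_closedin[OF D]
    by (auto simp: is_iso_def)
  then have 2: "relative_homology_group p M C \<cong> relative_homology_group p (subtopology M (topspace M - D)) (C - D)"
    by (simp add: group.iso_sym)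
  \<comment> \<open>The open disk is the full preimage of the complement of \<open>D\<close>; this
    is what allows the closed map \<open>f\<close> to be restricted to a closed map.\<close>
  have pre: "{v \<in> topspace (disk_space k). f v \<in> topspace M - D} = open_disk k"
    using closed_disk_split bd disj top by auto
  have im: "f ` open_disk k = topspace M - D"
    using closed_disk_split bd disj top by auto
  have homeo: "homeomorphic_map (subtopology (disk_space k) (open_disk k)) (subtopology M (topspace M - D)) f"
  proof (rule bijective_closed_imp_homeomorphic_map)
    show "closed_map (subtopology (disk_space k) (open_disk k)) (subtopology M (topspace M - D)) f"
      by (rule closed_map_restriction[OF clf pre])
    show "continuous_map (subtopology (disk_space k) (open_disk k)) (subtopology M (topspace M - D)) f"
      using f im oc by (auto simp: continuous_map_in_subtopology continuous_map_from_subtopology)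
    show "f ` topspace (subtopology (disk_space k) (open_disk k)) = topspace (subtopology M (topspace M - D))"
      using im oc by (auto simp: Int_absorb1)
    show "inj_on f (topspace (subtopology (disk_space k) (open_disk k)))"
      using inj by (auto simp: inj_on_def)
  qed
  have fC: "f ` {v \<in> open_disk k. 1/2 \<le> vnorm k v} = C - D"
  proof -
    have "f ` {v \<in> open_disk k. 1/2 \<le> vnorm k v} \<subseteq> C - D" using disj oc by (auto simp: C_def)
    moreover have "f v \<in> f ` {v \<in> open_disk k. 1/2 \<le> vnorm k v}"
      if "v \<in> closed_disk k" "1/2 \<le> vnorm k v" "f v \<notin> D" for v
      using that closed_disk_split bd by auto
    ultimately show ?thesis by (auto simp: C_def)
  qed
  have "{v \<in> open_disk k. 1/2 \<le> vnorm k v} \<subseteq> topspace (subtopology (disk_space k) (open_disk k))"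
    using oc by auto
  then have "relative_homology_group p (subtopology (disk_space k) (open_disk k))
      {v \<in> open_disk k. 1/2 \<le> vnorm k v} \<cong> relative_homology_group p (subtopology M (topspace M - D)) (C - D)"
    by (rule is_isoI[OF homeomorphic_map_relative_homology_iso[OF homeo _ fC]])
  then have 3: "relative_homology_group p (subtopology M (topspace M - D)) (C - D) \<cong>
      relative_homology_group p (subtopology (disk_space k) (open_disk k)) {v \<in> open_disk k. 1/2 \<le> vnorm k v}"
    by (simp add: group.iso_sym)
  from iso_trans[OF iso_trans[OF 1 2] 3] show ?thesis .
qed

text \<open>The disk itself arises from its sphere by attaching a cell along the identity, so the
  previous computation applies to both pairs and gives the same group.\<close>

lemma relative_homology_attach:
  assumes M: "Hausdorff_space M" and top: "topspace M = D \<union> f ` closed_disk k"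
    and D: "closedin M D" and f: "continuous_map (disk_space k) M f"
    and bd: "f ` bd_sphere k \<subseteq> D" and inj: "inj_on f (open_disk k)"
    and disj: "f ` open_disk k \<inter> D = {}"
  shows "relative_homology_group p (disk_space k) (bd_sphere k) \<cong> relative_homology_group p M D"
proof -
  have 1: "relative_homology_group p M D \<cong>
         relative_homology_group p (subtopology (disk_space k) (open_disk k))
            {v \<in> open_disk k. 1/2 \<le> vnorm k v}"
    by (rule relative_homology_attach_aux[OF M top D f bd inj disj])
  have 2: "relative_homology_group p (disk_space k) (bd_sphere k) \<cong>
         relative_homology_group p (subtopology (disk_space k) (open_disk k))
            {v \<in> open_disk k. 1/2 \<le> vnorm k v}"
    by (rule relative_homology_attach_aux[where f=id])
      (use closed_disk_split[of k] in \<open>auto simp: Hausdorff_disk_space bd_sphere_closedin\<close>)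
  show ?thesis using iso_trans[OF 2 group.iso_sym[OF _ 1]] by simp
qed

section \<open>Homology of a disk relative to its sphere\<close>

lemma contractible_disk_space: "contractible_space (disk_space k)"
proof -
  let ?P = "prod_topology (top_of_set {0..1::real}) (disk_space k)"
  have f: "continuous_map ?P euclideanreal fst"
    using continuous_map_fst continuous_map_into_fulltopology by blast
  have c: "continuous_map ?P euclideanreal (\<lambda>x. snd x i)" for i
    using continuous_map_compose[OF continuous_map_snd continuous_map_disk_space[OF continuous_map_coordinate]]
    by (simp add: o_def)
  have "continuous_map ?P (Euclidean_space k) (\<lambda>x i. if i < k then (1 - fst x) * snd x i else 0)"
    unfolding continuous_map_componentwise_Euclidean_space
    by (intro allI impI continuous_intros f c)
  then have "continuous_map ?P (Euclidean_space k) (\<lambda>x i. (1 - fst x) * snd x i)"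
    by (rule continuous_map_eq) (auto simp: closed_disk_vnorm fun_eq_iff)
  moreover have "(\<lambda>i. (1 - t) * v i) \<in> closed_disk k" if "0 \<le> t" "t \<le> 1" "v \<in> closed_disk k" for t v
    using that by (auto simp: closed_disk_vnorm vnorm_scale mult_le_one)
  ultimately have "continuous_map ?P (disk_space k) (\<lambda>x i. (1 - fst x) * snd x i)"
    by (auto simp: continuous_map_into_disk_space)
  then show ?thesis
    unfolding contractible_space_def homotopic_with_def
    by (intro exI[of _ "\<lambda>_. 0"] exI[of _ "\<lambda>x i. (1 - fst x) * snd x i"]) auto
qed

lemma euler_number_concentrated:
  assumes "zrank (relative_homology_group (int k) X S) (carrier (relative_homology_group (int k) X S)) 1"
    and "\<And>p. p \<noteq> int k \<Longrightarrow> trivial_group (relative_homology_group p X S)"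
  shows "euler_number X S ((- 1) ^ k)"
  unfolding euler_number_def
proof (intro exI conjI allI impI)
  show "zrank (relative_homology_group (int p) X S) (carrier (relative_homology_group (int p) X S))
     (if p = k then 1 else 0)" for p
    using assms(1) zrank_trivial_group[OF assms(2)[of "int p"]] by (cases "p = k") simp_all
  show "(- 1) ^ k = (\<Sum>p<Suc k. (- 1) ^ p * int (if p = k then 1 else 0))" by simp
qed auto

text \<open>In positive dimension the boundary map identifies the relative homology with the reduced
  homology of the sphere, one degree lower. In dimension 0 the sphere is empty and the homology is
  that of a point.\<close>

lemma euler_number_disk: "euler_number (disk_space k) (bd_sphere k) ((- 1) ^ k)"
proof (cases k)
  case 0
  then have bd: "bd_sphere k = {}" by (auto simp: bd_sphere_def)
  have "topspace (disk_space k) = {\<lambda>_. 0}"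
    unfolding topspace_disk_space using 0 by (auto simp: closed_disk_vnorm vnorm_def)
  then have top: "topspace (disk_space 0) = {\<lambda>_. 0}" using 0 by simp
  have "zrank (homology_group 0 (disk_space 0)) (carrier (homology_group 0 (disk_space 0))) 1"
    by (rule zrank_iso[OF abelian_integer_group _ group.iso_sym[OF _ homology_coefficients[OF top]]
        zrank_integer_group]) auto
  then show ?thesis unfolding bd unfolding 0
    using homology_dimension_axiom[OF top] by (intro euler_number_concentrated) simp_all
next
  case (Suc n)
  have sub: "subtopology (disk_space k) (bd_sphere k) = nsphere n"
  proof -
    have "closed_disk k \<inter> bd_sphere k = topspace (Euclidean_space k) \<inter> {x. (\<Sum>i\<le>n. x i ^ 2) = 1}"
      by (auto simp: Suc closed_disk_def bd_sphere_def lessThan_Suc_atMost)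
    then show ?thesis
      unfolding nsphere_def disk_space_def subtopology_subtopology by (metis Suc subtopology_restrict)
  qed
  have "topspace (nsphere n) \<subseteq> bd_sphere k" unfolding sub[symmetric] by simp
  then have "bd_sphere k \<noteq> {}" using in_topspace_nsphere[of n] by blast
  then have iso: "relative_homology_group p (disk_space k) (bd_sphere k) \<cong> reduced_homology_group (p - 1) (nsphere n)" for p
    using isomorphic_group_relative_homology_of_contractible[OF contractible_disk_space, of k "bd_sphere k" p]
      closed_disk_split(1)[of k] by (auto simp: sub Int_absorb1)
  have "relative_homology_group (int k) (disk_space k) (bd_sphere k) \<cong> integer_group"
    using iso_trans[OF iso[of "int k"]] reduced_homology_group_nsphere(1)[of n] Suc by simp
  then have "zrank (relative_homology_group (int k) (disk_space k) (bd_sphere k))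
     (carrier (relative_homology_group (int k) (disk_space k) (bd_sphere k))) 1"
    by (rule zrank_iso[OF abelian_integer_group abelian_relative_homology_group
        group.iso_sym[OF group_relative_homology_group] zrank_integer_group])
  moreover have "trivial_group (relative_homology_group p (disk_space k) (bd_sphere k))" if "p \<noteq> int k" for p
    using isomorphic_group_triviality[OF iso[of p]] reduced_homology_group_nsphere(2)[of "p - 1" n] that Suc
    by (auto simp: group_reduced_homology_group)
  ultimately show ?thesis by (rule euler_number_concentrated)
qed

section \<open>The Euler characteristic of a finite cell complex\<close>

text \<open>All stages are subsets of one ambient space, so no adjunction space has to be formed;
  compactness of the disks will supply the gluing topology once \<open>Z\<close> is Hausdorff.
  Dimensions may come in any order. The base point \<open>z\<close> counts 0, as in reduced
  homology.\<close>

inductive cell_built :: "'a topology \<Rightarrow> 'a \<Rightarrow> 'a set \<Rightarrow> int \<Rightarrow> bool" for Z z where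
  base: "z \<in> topspace Z \<Longrightarrow> cell_built Z z {z} 0"
| cell: "cell_built Z z D c \<Longrightarrow> continuous_map (disk_space k) Z f \<Longrightarrow> f ` bd_sphere k \<subseteq> D \<Longrightarrow>
     inj_on f (open_disk k) \<Longrightarrow> f ` open_disk k \<inter> D = {} \<Longrightarrow>
     cell_built Z z (D \<union> f ` open_disk k) (c + (- 1) ^ k)"

lemma cell_built_compactin: "cell_built Z z D c \<Longrightarrow> compactin Z D \<and> z \<in> D"
proof (induction rule: cell_built.induct)
  case (cell D c k f)
  have "D \<union> f ` open_disk k = D \<union> f ` closed_disk k"
    using cell.hyps closed_disk_split by blast
  moreover have "compactin Z (f ` closed_disk k)"
    using image_compactin[OF _ cell.hyps(2), of "closed_disk k"] compact_disk_space[of k]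
    by (metis compact_space_def topspace_disk_space)
  ultimately show ?case using cell.IH by (auto intro: compactin_Un)
qed auto

text \<open>Each step adds a pair with the homology of a disk relative to its sphere, and the triple
  formed by \<open>{z}\<close>, \<open>D\<close> and the enlarged set turns this into a sum.\<close>

lemma cell_built_euler_number:
  assumes "Hausdorff_space Z" "cell_built Z z D c"
  shows "euler_number (subtopology Z D) {z} c"
  using assms(2)
proof (induction rule: cell_built.induct)
  case base
  have "trivial_group (relative_homology_group p (subtopology Z {z}) {z})" for p
    using base trivial_relative_homology_group_topspace[of p "subtopology Z {z}"] by simp
  then show ?case unfolding euler_number_def
    by (intro exI[of _ "\<lambda>_. 0"]) (auto intro: zrank_trivial_group)
next
  case (cell D c k f)
  let ?M = "subtopology Z (D \<union> f ` open_disk k)"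
  have zD: "compactin Z D" "z \<in> D" using cell_built_compactin[OF cell.hyps(1)] by auto
  have eq: "D \<union> f ` open_disk k = D \<union> f ` closed_disk k"
    using cell.hyps closed_disk_split by blast
  have sub: "D \<union> f ` closed_disk k \<subseteq> topspace Z"
    using zD(1) compactin_subset_topspace continuous_map_image_subset_topspace[OF cell.hyps(2)] by auto
  have "relative_homology_group p (disk_space k) (bd_sphere k) \<cong> relative_homology_group p ?M D" for p
  proof (rule relative_homology_attach)
    show "Hausdorff_space ?M" using assms(1) by (rule Hausdorff_space_subtopology)
    show "topspace ?M = D \<union> f ` closed_disk k" using sub unfolding eq by auto
    show "closedin ?M D"
      using compactin_imp_closedin[OF assms(1) zD(1)] by (auto intro: closedin_subset_topspace)
    show "continuous_map (disk_space k) ?M f"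
      unfolding eq continuous_map_in_subtopology using cell.hyps(2) by auto
  qed (use cell.hyps in auto)
  then have "euler_number ?M D ((- 1) ^ k)" by (rule euler_number_iso[OF _ euler_number_disk])
  moreover have "subtopology ?M D = subtopology Z D"
    by (simp add: subtopology_subtopology Int_absorb1)
  ultimately show ?case using cell.IH zD(2) by (intro euler_number_triple[of "{z}" D]) auto
qed

section \<open>Compact groups\<close>

locale compact_topological_group = group G for G :: "('g, 'b) monoid_scheme" (structure) +
  fixes T :: "'g topology"
  assumes topspace_group: "topspace T = carrier G"
    and Hausdorff_group: "Hausdorff_space T"
    and compact_group: "compact_space T"
    and continuous_mult: "continuous_map (prod_topology T T) T (\<lambda>(g, h). g \<otimes> h)"
    and continuous_inv: "continuous_map T T (\<lambda>g. inv g)"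
begin

lemma continuous_mult_maps:
  assumes "continuous_map X T f" "continuous_map X T g"
  shows "continuous_map X T (\<lambda>x. f x \<otimes> g x)"
  using continuous_map_compose[OF continuous_map_pairedI[OF assms] continuous_mult]
  by (simp add: o_def)

lemma continuous_inv_map: "continuous_map X T f \<Longrightarrow> continuous_map X T (\<lambda>x. inv (f x))"
  using continuous_map_compose[OF _ continuous_inv] by (auto simp: o_def)

lemma continuous_group_const: "a \<in> carrier G \<Longrightarrow> continuous_map X T (\<lambda>_. a)"
  by (simp add: topspace_group)

text \<open>Recurrence: finitely many small open sets cover the compact group, so two powers of
  \<open>g\<close> with exponents m < n lie in the same one, and then the power with exponent n - m
  - 1 is close to the inverse of \<open>g\<close>.\<close>

lemma power_near_inverse:
  assumes g: "g \<in> carrier G" and U: "openin T U" "inv g \<in> U"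
  shows "\<exists>n::nat. g [^] n \<in> U"
proof -
  \<comment> \<open>On the diagonal \<open>?q\<close> is constantly \<open>inv g\<close>, so every
    point has a neighbourhood \<open>N\<close> such that pairs from \<open>N\<close> are sent into
    \<open>U\<close>.\<close>
  let ?q = "\<lambda>x. inv (fst x) \<otimes> snd x \<otimes> inv g"
  have q: "continuous_map (prod_topology T T) T ?q"
    by (intro continuous_mult_maps continuous_inv_map continuous_map_fst continuous_map_snd
        continuous_group_const) (simp add: g)
  let ?W = "{x \<in> topspace (prod_topology T T). ?q x \<in> U}"
  have W: "openin (prod_topology T T) ?W"
    by (rule openin_continuous_map_preimage[OF q U(1)])
  have "\<exists>N. openin T N \<and> y \<in> N \<and> (\<forall>a\<in>N. \<forall>b\<in>N. ?q (a, b) \<in> U)" if y: "y \<in> carrier G" for y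
  proof -
    have "(y, y) \<in> ?W" using y g U by (simp add: topspace_group)
    then obtain A B where AB: "openin T A" "openin T B" "y \<in> A" "y \<in> B" "A \<times> B \<subseteq> ?W"
      using W unfolding openin_prod_topology_alt by meson
    then show ?thesis by (intro exI[of _ "A \<inter> B"]) auto
  qed
  then have "\<forall>y. \<exists>N. y \<in> carrier G \<longrightarrow> openin T N \<and> y \<in> N \<and> (\<forall>a\<in>N. \<forall>b\<in>N. ?q (a, b) \<in> U)"
    by blast
  then obtain N where N: "\<And>y. y \<in> carrier G \<Longrightarrow> openin T (N y) \<and> y \<in> N y \<and> (\<forall>a\<in>N y. \<forall>b\<in>N y. ?q (a, b) \<in> U)"
    unfolding choice_iff by blast
  have "topspace T \<subseteq> \<Union>(N ` carrier G)" using N topspace_group by blast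
  moreover have "\<forall>U\<in>N ` carrier G. openin T U" using N by blast
  ultimately obtain \<F> where F: "finite \<F>" "\<F> \<subseteq> N ` carrier G" "topspace T \<subseteq> \<Union>\<F>"
    using compact_group[unfolded compact_space_alt, rule_format, of "N ` carrier G"] by blast
  have "g [^] n \<in> topspace T" for n :: nat using g topspace_group by simp
  then have "\<forall>n::nat. \<exists>B. B \<in> \<F> \<and> g [^] n \<in> B" using F(3) by blast
  then obtain B where B: "\<And>n::nat. B n \<in> \<F> \<and> g [^] n \<in> B n" unfolding choice_iff by blast
  have "\<not> inj B" using B F(1) by (metis finite_imageD finite_subset image_subsetI infinite_UNIV_nat)
  then obtain m n where mn: "m < n" "B m = B n"
    unfolding inj_on_def by (metis linorder_neqE_nat)
  obtain y where y: "y \<in> carrier G" "B m = N y" using B F(2) by blast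
  have "?q (g [^] m, g [^] n) \<in> U" using N[OF y(1)] B[of m] B[of n] mn y by auto
  moreover have "?q (g [^] m, g [^] n) = g [^] (n - m - 1)"
  proof -
    define k where "k = n - m - 1"
    have "n = m + Suc k" using mn by (simp add: k_def)
    then have "g [^] n = g [^] m \<otimes> (g [^] k \<otimes> g)"
      using nat_pow_mult[OF g, of m "Suc k"] by simp
    moreover have "inv a \<otimes> (a \<otimes> (b \<otimes> g)) \<otimes> inv g = b" if "a \<in> carrier G" "b \<in> carrier G" for a b
      using that g by (simp add: m_assoc[symmetric]) (simp add: m_assoc)
    ultimately show ?thesis using g by (simp add: k_def)
  qed
  ultimately show ?thesis by metis
qed

text \<open>The elements \<open>a\<close> with a^-1 H a contained in H form a closed set that
  contains every power of \<open>g\<close>, hence by recurrence also the inverse of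
  \<open>g\<close>. Thus one inclusion between conjugates of a closed subgroup already is an
  equality.\<close>

lemma conjugate_into_subgroup:
  assumes H: "subgroup H G" "closedin T H" and g: "g \<in> carrier G"
    and sub: "\<And>h. h \<in> H \<Longrightarrow> inv g \<otimes> h \<otimes> g \<in> H" and h: "h \<in> H"
  shows "g \<otimes> h \<otimes> inv g \<in> H"
proof -
  have Hc: "H \<subseteq> carrier G" using H by (simp add: subgroup.subset)
  define C where "C = (\<Inter>h\<in>H. {a \<in> topspace T. inv a \<otimes> h \<otimes> a \<in> H})"
  have "closedin T C" unfolding C_def
  proof (rule closedin_INT)
    show "H \<noteq> {}" using h by auto
    fix k assume "k \<in> H"
    then have "continuous_map T T (\<lambda>a. inv a \<otimes> k \<otimes> a)"
      using Hc by (intro continuous_mult_maps continuous_inv_map continuous_group_const) auto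
    then show "closedin T {a \<in> topspace T. inv a \<otimes> k \<otimes> a \<in> H}"
      using H(2) by (rule closedin_continuous_map_preimage)
  qed
  then have op: "openin T (topspace T - C)" by auto
  have "inv (g [^] n) \<otimes> k \<otimes> g [^] n \<in> H" if "k \<in> H" for n :: nat and k
    using that
  proof (induction n arbitrary: k)
    case 0
    then show ?case using Hc by auto
  next
    case (Suc n)
    have "inv g \<otimes> (inv (g [^] n) \<otimes> k \<otimes> g [^] n) \<otimes> g \<in> H" using sub Suc by blast
    moreover have "k \<in> carrier G" using Suc Hc by auto
    ultimately show ?case using g by (simp add: inv_mult_group m_assoc)
  qed
  then have pow: "g [^] n \<in> C" for n :: nat
    using g by (auto simp: C_def topspace_group)
  have "inv g \<in> C"
  proof (rule ccontr)
    assume "inv g \<notin> C"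
    then have "inv g \<in> topspace T - C" using g by (simp add: topspace_group)
    then show False using power_near_inverse[OF g op] pow by auto
  qed
  then show ?thesis using h g by (auto simp: C_def)
qed

end

lemma compact_lie_group_imp:
  assumes "compact_lie_group G T"
  shows "compact_topological_group G T"
  using assms
  by (auto simp: compact_lie_group_def lie_group_def compact_topological_group_def
      compact_topological_group_axioms_def)

section \<open>The space of free orbits of the fixed point set\<close>

definition fixed_points :: "('g, 'b) monoid_scheme \<Rightarrow> 'g set \<Rightarrow> ('g, 'x) gspace \<Rightarrow> 'x set" where
  "fixed_points G H X = {x \<in> topspace (gtop X). \<forall>h\<in>H. gact X h x = x}"

text \<open>The isotropy group of a point fixed by \<open>H\<close> contains \<open>H\<close>, so
  for such a point other than the base point this says that it is strictly larger.\<close>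

definition collapsed :: "('g, 'b) monoid_scheme \<Rightarrow> 'g set \<Rightarrow> ('g, 'x) gspace \<Rightarrow> 'x \<Rightarrow> bool" where
  "collapsed G H X x \<longleftrightarrow> x = gbase X \<or> (\<exists>g\<in>carrier G - H. gact X g x = x)"

text \<open>An orbit is represented by the set of its points, and \<open>{}\<close>, which is never
  an orbit, is the new base point. Orbits under all of \<open>G\<close> do the work of orbits under
  the normalizer: two uncollapsed points of the fixed set in one orbit differ by an element
  normalizing \<open>H\<close>.\<close>

definition zproj :: "('g, 'b) monoid_scheme \<Rightarrow> 'g set \<Rightarrow> ('g, 'x) gspace \<Rightarrow> 'x \<Rightarrow> 'x set" where
  "zproj G H X x = (if collapsed G H X x then {} else (\<lambda>g. gact X g x) ` carrier G)"

text \<open>The subquotient of \<open>X\<close> that retains exactly the orbits of type \<open>G/H\<close>: each of them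
  becomes one point, while the base point and all points fixed by a group larger than \<open>H\<close> are
  collapsed to the point \<open>{}\<close>.\<close>

definition zspace :: "('g, 'b) monoid_scheme \<Rightarrow> 'g set \<Rightarrow> ('g, 'x) gspace \<Rightarrow> 'x set topology" where
  "zspace G H X = quot_topology (subtopology (gtop X) (fixed_points G H X)) (zproj G H X)"

lemma fixed_points_subset: "fixed_points G H X \<subseteq> topspace (gtop X)"
  by (auto simp: fixed_points_def)

lemma quotient_map_zproj:
  "quotient_map (subtopology (gtop X) (fixed_points G H X)) (zspace G H X) (zproj G H X)"
  unfolding zspace_def by (rule quotient_map_quot_topology)

lemma topspace_zspace: "topspace (zspace G H X) = zproj G H X ` fixed_points G H X"
  unfolding zspace_def topspace_quot_topology using fixed_points_subset[of G H X]
  by (simp add: Int_absorb1)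

section \<open>Actions, orbits and isotropy groups\<close>

context group
begin

lemma gspaceD:
  assumes "pointed_gspace G T X" "x \<in> topspace (gtop X)"
  shows "gact X \<one> x = x"
    "g \<in> carrier G \<Longrightarrow> h \<in> carrier G \<Longrightarrow> gact X (g \<otimes> h) x = gact X g (gact X h x)"
    "g \<in> carrier G \<Longrightarrow> gact X g (gbase X) = gbase X"
  using assms by (auto simp: pointed_gspace_def)

lemma gbase_in: "pointed_gspace G T X \<Longrightarrow> gbase X \<in> topspace (gtop X)"
  by (simp add: pointed_gspace_def)

lemma gact_in:
  assumes "pointed_gspace G T X" "topspace T = carrier G" "x \<in> topspace (gtop X)" "g \<in> carrier G"
  shows "gact X g x \<in> topspace (gtop X)"
proof -
  have "continuous_map (prod_topology T (gtop X)) (gtop X) (\<lambda>(g, x). gact X g x)"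
    using assms by (simp add: pointed_gspace_def)
  then have "(\<lambda>(g, x). gact X g x) (g, x) \<in> topspace (gtop X)"
    by (rule continuous_map_image_subset_topspace[THEN subsetD, OF _ imageI]) (use assms in auto)
  then show ?thesis by simp
qed

end

context compact_topological_group
begin

lemma gact_closed: "pointed_gspace G T X \<Longrightarrow> x \<in> topspace (gtop X) \<Longrightarrow> g \<in> carrier G \<Longrightarrow>
    gact X g x \<in> topspace (gtop X)"
  by (rule gact_in[OF _ topspace_group])

lemma gact_inv:
  assumes "pointed_gspace G T X" "x \<in> topspace (gtop X)" "g \<in> carrier G"
  shows "gact X (inv g) (gact X g x) = x" "gact X g (gact X (inv g) x) = x"
  using gspaceD[OF assms(1,2)] assms(3) by (metis inv_closed l_inv r_inv)+

lemma continuous_gact: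
  assumes "pointed_gspace G T X" "continuous_map Y T a" "continuous_map Y (gtop X) f"
  shows "continuous_map Y (gtop X) (\<lambda>y. gact X (a y) (f y))"
proof -
  have "continuous_map (prod_topology T (gtop X)) (gtop X) (\<lambda>(g, x). gact X g x)"
    using assms by (simp add: pointed_gspace_def)
  from continuous_map_compose[OF continuous_map_pairedI[OF assms(2,3)] this]
  show ?thesis by (simp add: o_def)
qed

lemma collapsed_gbase: "collapsed G H X (gbase X)"
  by (simp add: collapsed_def)

lemma zproj_gbase: "zproj G H X (gbase X) = {}"
  by (simp add: zproj_def collapsed_gbase)

lemma gbase_fixed: "subgroup H G \<Longrightarrow> pointed_gspace G T X \<Longrightarrow> gbase X \<in> fixed_points G H X"
  by (auto simp: fixed_points_def pointed_gspace_def dest: subgroup.mem_carrier)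

lemma empty_in_zspace: "subgroup H G \<Longrightarrow> pointed_gspace G T X \<Longrightarrow> {} \<in> topspace (zspace G H X)"
  unfolding topspace_zspace using gbase_fixed zproj_gbase by (metis imageI)

lemma zproj_empty_iff: "zproj G H X x = {} \<longleftrightarrow> collapsed G H X x"
  by (auto simp: zproj_def)

lemma zproj_eq_orbit:
  assumes X: "pointed_gspace G T X" and "x \<in> topspace (gtop X)" "y \<in> topspace (gtop X)"
    and nb: "\<not> collapsed G H X x"
    and eq: "zproj G H X x = zproj G H X y"
  obtains g where "g \<in> carrier G" "y = gact X g x" "\<not> collapsed G H X y"
proof -
  have nby: "\<not> collapsed G H X y" using nb eq zproj_empty_iff by metis
  then have "gact X \<one> y \<in> zproj G H X y" by (auto simp: zproj_def)
  then have "y \<in> zproj G H X x" using assms gspaceD(1) eq by metis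
  then show ?thesis using nb nby that by (auto simp: zproj_def)
qed

lemma orbit_translate:
  assumes X: "pointed_gspace G T X" and x: "x \<in> topspace (gtop X)" and g: "g \<in> carrier G"
  shows "(\<lambda>h. gact X h (gact X g x)) ` carrier G = (\<lambda>h. gact X h x) ` carrier G"
proof -
  have "gact X h (gact X g x) = gact X (h \<otimes> g) x" if "h \<in> carrier G" for h
    using gspaceD(2)[OF X x] that g by simp
  moreover have "gact X h x = gact X (h \<otimes> inv g) (gact X g x)" if "h \<in> carrier G" for h
    using gspaceD(2)[OF X x, of "h \<otimes> inv g" g] that g by (simp add: m_assoc)
  ultimately show ?thesis using g
    by (intro subset_antisym image_subsetI) (metis imageI m_closed inv_closed)+
qed

lemma collapsed_translate:
  assumes X: "pointed_gspace G T X" and x: "x \<in> topspace (gtop X)" and g: "g \<in> carrier G"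
    and H: "H \<subseteq> carrier G"
    and N: "\<And>h. h \<in> H \<Longrightarrow> inv g \<otimes> h \<otimes> g \<in> H"
    and c: "collapsed G H X x"
  shows "collapsed G H X (gact X g x)"
proof -
  consider "x = gbase X" | k where "k \<in> carrier G" "k \<notin> H" "gact X k x = x"
    using c by (auto simp: collapsed_def)
  then show ?thesis
  proof cases
    case 1
    then show ?thesis using gspaceD(3)[OF X x g] by (simp add: collapsed_def)
  next
    case 2
    let ?k = "g \<otimes> k \<otimes> inv g"
    have "inv g \<otimes> ?k \<otimes> g = k" using g 2 by (simp add: m_assoc[symmetric]) (simp add: m_assoc)
    then have "?k \<notin> H" using N 2 by metis
    moreover have "gact X ?k (gact X g x) = gact X g x"
      using g 2 gspaceD(2)[OF X] gact_closed[OF X] x by (simp add: gact_inv[OF X])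
    ultimately show ?thesis using g 2 unfolding collapsed_def by blast
  qed
qed

lemma zproj_translate:
  assumes X: "pointed_gspace G T X" and x: "x \<in> topspace (gtop X)" and g: "g \<in> carrier G"
    and H: "H \<subseteq> carrier G"
    and N: "\<And>h. h \<in> H \<Longrightarrow> inv g \<otimes> h \<otimes> g \<in> H" and N': "\<And>h. h \<in> H \<Longrightarrow> g \<otimes> h \<otimes> inv g \<in> H"
  shows "zproj G H X (gact X g x) = zproj G H X x"
proof -
  have "collapsed G H X (gact X g x) \<longleftrightarrow> collapsed G H X x"
  proof
    assume "collapsed G H X (gact X g x)"
    then have "collapsed G H X (gact X (inv g) (gact X g x))"
      using g N' by (intro collapsed_translate[OF X gact_closed[OF X x g] _ H]) auto
    then show "collapsed G H X x" using gact_inv[OF X x g] by simp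
  qed (rule collapsed_translate[OF X x g H N])
  then show ?thesis unfolding zproj_def using orbit_translate[OF X x g] by simp
qed

section \<open>Functoriality and homotopy invariance of the subquotient\<close>

lemma equivariant_fixed_points:
  assumes "subgroup H G" "pointed_equivariant G X Y f" "f \<in> topspace (gtop X) \<rightarrow> topspace (gtop Y)"
    "x \<in> fixed_points G H X"
  shows "f x \<in> fixed_points G H Y"
proof -
  have "gact Y h (f x) = f x" if "h \<in> H" for h
  proof -
    have "h \<in> carrier G" using that assms(1) by (meson subgroup.mem_carrier)
    then have "f (gact X h x) = gact Y h (f x)"
      using assms by (auto simp: fixed_points_def pointed_equivariant_def)
    then show ?thesis using assms that by (auto simp: fixed_points_def)
  qed
  then show ?thesis using assms by (auto simp: fixed_points_def)
qed

lemma stabilizer_translate: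
  assumes X: "pointed_gspace G T X" and x: "x \<in> topspace (gtop X)" and g: "g \<in> carrier G" and a: "a \<in> carrier G"
  shows "gact X a (gact X g x) = gact X g x \<longleftrightarrow> gact X (inv g \<otimes> a \<otimes> g) x = x"
proof -
  have "gact X (inv g \<otimes> a \<otimes> g) x = gact X (inv g) (gact X a (gact X g x))"
    using g a gspaceD(2)[OF X] gact_closed[OF X] x by (simp add: m_assoc)
  then show ?thesis using gact_inv[OF X] gact_closed[OF X] x g a by metis
qed

text \<open>The isotropy group of an uncollapsed \<open>x\<close> lies in \<open>H\<close>, and that
  of its translate is the conjugate by \<open>g\<close>. Used for a point and for its translate,
  this shows that \<open>g\<close> normalizes \<open>H\<close>.\<close>

lemma isotropy_conjugate:
  assumes H: "subgroup H G" and X: "pointed_gspace G T X"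
    and x: "x \<in> fixed_points G H X" and g: "g \<in> carrier G" and gx: "gact X g x \<in> fixed_points G H X"
    and nc: "\<not> collapsed G H X x" and h: "h \<in> H"
  shows "inv g \<otimes> h \<otimes> g \<in> H"
proof -
  have hc: "h \<in> carrier G" using H h by (rule subgroup.mem_carrier)
  have "gact X h (gact X g x) = gact X g x" using gx h by (auto simp: fixed_points_def)
  then have "gact X (inv g \<otimes> h \<otimes> g) x = x"
    using stabilizer_translate[OF X _ g hc, of x] x by (simp add: fixed_points_def)
  then show ?thesis using nc g hc by (auto simp: collapsed_def)
qed

text \<open>Makes Z a functor. Equivariant maps enlarge isotropy groups and so preserve collapsed
  points. Two uncollapsed points with the same image differ by an element normalizing
  \<open>H\<close>, and translation by such an element is invisible in Z, even where the images
  under \<open>f\<close> have become collapsed.\<close>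

lemma zproj_equivariant:
  assumes H: "subgroup H G" and X: "pointed_gspace G T X" and Y: "pointed_gspace G T Y"
    and f: "pointed_equivariant G X Y f" and fim: "f \<in> topspace (gtop X) \<rightarrow> topspace (gtop Y)"
    and x: "x \<in> fixed_points G H X" and x': "x' \<in> fixed_points G H X"
    and eq: "zproj G H X x = zproj G H X x'"
  shows "zproj G H Y (f x) = zproj G H Y (f x')"
proof (cases "collapsed G H X x")
  case True
  have "collapsed G H Y (f y)" if "collapsed G H X y" "y \<in> fixed_points G H X" for y
  proof (cases "y = gbase X")
    case False
    then obtain g where g: "g \<in> carrier G" "g \<notin> H" "gact X g y = y"
      using \<open>collapsed G H X y\<close> by (auto simp: collapsed_def)
    have "y \<in> topspace (gtop X)" using that by (auto simp: fixed_points_def)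
    then have "gact Y g (f y) = f y" using f g by (metis pointed_equivariant_def)
    then show ?thesis using g by (auto simp: collapsed_def)
  qed (use f in \<open>auto simp: pointed_equivariant_def collapsed_def\<close>)
  moreover have "collapsed G H X x'" using True eq zproj_empty_iff by metis
  ultimately show ?thesis using True x x' by (simp add: zproj_def)
next
  case False
  have xt: "x \<in> topspace (gtop X)" "x' \<in> topspace (gtop X)" using x x' by (auto simp: fixed_points_def)
  obtain g where g: "g \<in> carrier G" "x' = gact X g x" "\<not> collapsed G H X x'"
    by (rule zproj_eq_orbit[OF X xt False eq])
  have Hc: "H \<subseteq> carrier G" using H by (rule subgroup.subset)
  have N: "inv g \<otimes> h \<otimes> g \<in> H" if "h \<in> H" for h
    using isotropy_conjugate[OF H X x g(1) _ False that] x' g(2) by simp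
  have N': "g \<otimes> h \<otimes> inv g \<in> H" if "h \<in> H" for h
    using isotropy_conjugate[OF H X x' inv_closed[OF g(1)] _ g(3) that] x g(1,2) gact_inv[OF X xt(1) g(1)] by simp
  have "f x' = gact Y g (f x)" using f g xt by (auto simp: pointed_equivariant_def)
  then show ?thesis using zproj_translate[OF Y _ g(1) Hc N N'] fim xt by auto
qed

text \<open>\<open>F\<close> and \<open>F'\<close> may be any maps covering \<open>f\<close> and
  \<open>f'\<close>, so that a composition of two induced maps can be compared with the identity
  directly. The homotopy keeps the base point \<open>{}\<close>, as is needed for maps of
  pairs.\<close>

lemma zhomotopy:
  assumes H: "subgroup H G" and X: "pointed_gspace G T X" and Y: "pointed_gspace G T Y"
    and hom: "homotopic_with (pointed_equivariant G X Y) (gtop X) (gtop Y) f f'"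
    and F: "\<And>x. x \<in> fixed_points G H X \<Longrightarrow> F (zproj G H X x) = zproj G H Y (f x)"
    and F': "\<And>x. x \<in> fixed_points G H X \<Longrightarrow> F' (zproj G H X x) = zproj G H Y (f' x)"
  shows "homotopic_with (\<lambda>h. h \<in> {{}} \<rightarrow> {{}}) (zspace G H X) (zspace G H Y) F F'"
proof -
  let ?I = "top_of_set {0..1::real}"
  let ?FX = "subtopology (gtop X) (fixed_points G H X)"
  let ?FY = "subtopology (gtop Y) (fixed_points G H Y)"
  obtain h where h: "continuous_map (prod_topology ?I (gtop X)) (gtop Y) h"
    "\<And>x. h (0, x) = f x" "\<And>x. h (1, x) = f' x"
    "\<And>t. t \<in> {0..1} \<Longrightarrow> pointed_equivariant G X Y (\<lambda>x. h (t, x))"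
    using hom unfolding homotopic_with_def by blast
  have him: "(\<lambda>x. h (t, x)) \<in> topspace (gtop X) \<rightarrow> topspace (gtop Y)" if "t \<in> {0..1}" for t
    using continuous_map_image_subset_topspace[OF h(1)] that by auto
  have hfix: "h (t, x) \<in> fixed_points G H Y" if "t \<in> {0..1}" "x \<in> fixed_points G H X" for t x
    using equivariant_fixed_points[OF H h(4)[OF that(1)] him[OF that(1)] that(2)] .
  have "prod_topology ?I ?FX = subtopology (prod_topology ?I (gtop X)) (topspace ?I \<times> fixed_points G H X)"
    by (rule prod_topology_subtopology(2))
  then have "continuous_map (prod_topology ?I ?FX) (gtop Y) h"
    using h(1) continuous_map_from_subtopology by metis
  then have "continuous_map (prod_topology ?I ?FX) ?FY h"
    unfolding continuous_map_in_subtopology using hfix by auto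
  then have c: "continuous_map (prod_topology ?I ?FX) (zspace G H Y) (zproj G H Y \<circ> h)"
    using quotient_imp_continuous_map[OF quotient_map_zproj] by (rule continuous_map_compose)
  have lc: "locally_compact_space ?I"
    by (simp add: compact_imp_locally_compact_space compact_space_subtopology)
  \<comment> \<open>The homotopy descends since the product of the compact interval with a quotient
    map is again a quotient map.\<close>
  have q: "quotient_map (prod_topology ?I ?FX) (prod_topology ?I (zspace G H X)) (\<lambda>(t, x). (t, zproj G H X x))"
    using lc by (intro quotient_map_prod_right quotient_map_zproj) (auto intro: Hausdorff_space_subtopology)
  have tFX: "topspace (prod_topology ?I ?FX) = {0..1} \<times> fixed_points G H X"
    using fixed_points_subset[of G H X] by auto
  obtain k where k: "continuous_map (prod_topology ?I (zspace G H X)) (zspace G H Y) k"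
    "\<And>y. y \<in> topspace (prod_topology ?I ?FX) \<Longrightarrow> k ((\<lambda>(t, x). (t, zproj G H X x)) y) = (zproj G H Y \<circ> h) y"
  proof (rule quotient_map_lift_exists[OF q c])
    fix y z assume yz: "y \<in> topspace (prod_topology ?I ?FX)" "z \<in> topspace (prod_topology ?I ?FX)"
      "(\<lambda>(t, x). (t, zproj G H X x)) y = (\<lambda>(t, x). (t, zproj G H X x)) z"
    obtain t x x' where eq: "y = (t, x)" "z = (t, x')" using yz(3) by (cases y; cases z) auto
    then have "t \<in> {0..1}" "x \<in> fixed_points G H X" "x' \<in> fixed_points G H X" using yz tFX by auto
    moreover have "zproj G H X x = zproj G H X x'" using yz(3) eq by simp
    ultimately have "zproj G H Y (h (t, x)) = zproj G H Y (h (t, x'))"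
      using zproj_equivariant[OF H X Y h(4) him] by blast
    then show "(zproj G H Y \<circ> h) y = (zproj G H Y \<circ> h) z" using eq by simp
  qed blast
  have k': "k (t, zproj G H X x) = zproj G H Y (h (t, x))" if "t \<in> {0..1}" "x \<in> fixed_points G H X" for t x
    using k(2)[unfolded tFX, of "(t, x)"] that by simp
  have e: "{} \<in> topspace (zspace G H X)" using empty_in_zspace[OF H X] .
  have "homotopic_with (\<lambda>h. h \<in> {{}} \<rightarrow> {{}}) (zspace G H X) (zspace G H Y) F F'
    \<longleftrightarrow> (\<exists>h. continuous_map (prod_topology ?I (zspace G H X)) (zspace G H Y) h \<and>
        (\<forall>x\<in>topspace (zspace G H X). h (0, x) = F x) \<and> (\<forall>x\<in>topspace (zspace G H X). h (1, x) = F' x) \<and>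
        (\<forall>t\<in>{0..1}. (\<lambda>x. h (t, x)) \<in> {{}} \<rightarrow> {{}}))"
    by (rule homotopic_with) (use e in auto)
  moreover have "k (t, {}) = {}" if "t \<in> {0..1}" for t
    using k'[OF that gbase_fixed[OF H X]] h(4)[OF that] by (simp add: pointed_equivariant_def zproj_gbase)
  moreover have "k (0, z) = F z" "k (1, z) = F' z" if "z \<in> topspace (zspace G H X)" for z
    using that k' h(2,3) F F' unfolding topspace_zspace by force+
  ultimately show ?thesis using k(1) by (auto intro!: exI[of _ k])
qed

lemma zmap_exists:
  assumes H: "subgroup H G" and X: "pointed_gspace G T X" and Y: "pointed_gspace G T Y"
    and f: "pointed_equivariant G X Y f" and c: "continuous_map (gtop X) (gtop Y) f"
  obtains F where "continuous_map (zspace G H X) (zspace G H Y) F"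
    "\<And>x. x \<in> fixed_points G H X \<Longrightarrow> F (zproj G H X x) = zproj G H Y (f x)" "F {} = {}"
proof -
  let ?FX = "subtopology (gtop X) (fixed_points G H X)"
  let ?FY = "subtopology (gtop Y) (fixed_points G H Y)"
  have fim: "f \<in> topspace (gtop X) \<rightarrow> topspace (gtop Y)" using c by (simp add: continuous_map_def)
  have tFX: "topspace ?FX = fixed_points G H X" using fixed_points_subset[of G H X] by auto
  have "continuous_map ?FX ?FY f"
    unfolding continuous_map_in_subtopology
    using c equivariant_fixed_points[OF H f fim] tFX by (auto simp: continuous_map_from_subtopology)
  then have c': "continuous_map ?FX (zspace G H Y) (zproj G H Y \<circ> f)"
    using quotient_imp_continuous_map[OF quotient_map_zproj] by (rule continuous_map_compose)
  obtain F where F: "continuous_map (zspace G H X) (zspace G H Y) F"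
    "\<And>x. x \<in> topspace ?FX \<Longrightarrow> F (zproj G H X x) = (zproj G H Y \<circ> f) x"
  proof (rule quotient_map_lift_exists[OF quotient_map_zproj c'])
    fix x y assume "x \<in> topspace ?FX" "y \<in> topspace ?FX" "zproj G H X x = zproj G H X y"
    then show "(zproj G H Y \<circ> f) x = (zproj G H Y \<circ> f) y"
      using zproj_equivariant[OF H X Y f fim] unfolding tFX o_def by blast
  qed blast
  have "F {} = {}"
    using F(2)[unfolded tFX, OF gbase_fixed[OF H X]] f
    by (simp add: zproj_gbase pointed_equivariant_def)
  then show ?thesis using that[OF F(1)] F(2)[unfolded tFX o_def] by blast
qed

lemma euler_number_zspace_homotopy:
  assumes H: "subgroup H G" and X: "pointed_gspace G T X" and Y: "pointed_gspace G T Y"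
    and he: "G_homotopy_equivalent G X Y" and e: "euler_number (zspace G H X) {{}} c"
  shows "euler_number (zspace G H Y) {{}} c"
proof -
  obtain f k where fk: "continuous_map (gtop X) (gtop Y) f" "pointed_equivariant G X Y f"
    "continuous_map (gtop Y) (gtop X) k" "pointed_equivariant G Y X k"
    "homotopic_with (pointed_equivariant G X X) (gtop X) (gtop X) (k \<circ> f) id"
    "homotopic_with (pointed_equivariant G Y Y) (gtop Y) (gtop Y) (f \<circ> k) id"
    using he unfolding G_homotopy_equivalent_def by blast
  obtain F where F: "continuous_map (zspace G H X) (zspace G H Y) F"
    "\<And>x. x \<in> fixed_points G H X \<Longrightarrow> F (zproj G H X x) = zproj G H Y (f x)" "F {} = {}"
    using zmap_exists[OF H X Y fk(2,1)] by blast
  obtain K where K: "continuous_map (zspace G H Y) (zspace G H X) K"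
    "\<And>x. x \<in> fixed_points G H Y \<Longrightarrow> K (zproj G H Y x) = zproj G H X (k x)" "K {} = {}"
    using zmap_exists[OF H Y X fk(4,3)] by blast
  have fim: "f \<in> topspace (gtop X) \<rightarrow> topspace (gtop Y)" and kim: "k \<in> topspace (gtop Y) \<rightarrow> topspace (gtop X)"
    using fk by (auto simp: continuous_map_def)
  have "relative_homology_group p (zspace G H X) {{}} \<cong> relative_homology_group p (zspace G H Y) {{}}" for p
  proof (rule homotopy_equivalent_space_imp_isomorphic_relative_homology_groups)
    show "homotopic_with (\<lambda>h. h \<in> {{}} \<rightarrow> {{}}) (zspace G H X) (zspace G H X) (K \<circ> F) id"
      by (rule zhomotopy[OF H X X fk(5)])
        (use F(2) K(2) equivariant_fixed_points[OF H fk(2) fim] in simp_all)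
    show "homotopic_with (\<lambda>h. h \<in> {{}} \<rightarrow> {{}}) (zspace G H Y) (zspace G H Y) (F \<circ> K) id"
      by (rule zhomotopy[OF H Y Y fk(6)])
        (use F(2) K(2) equivariant_fixed_points[OF H fk(4) kim] in simp_all)
  qed (use F K in auto)
  then show ?thesis using e by (rule euler_number_iso)
qed

end

section \<open>Building a G-space from cells\<close>

definition conjugate_to :: "('g, 'b) monoid_scheme \<Rightarrow> 'g set \<Rightarrow> 'g set \<Rightarrow> bool" where
  "conjugate_to G H K \<longleftrightarrow> (\<exists>a\<in>carrier G. K = (\<lambda>h. a \<otimes>\<^bsub>G\<^esub> h \<otimes>\<^bsub>G\<^esub> inv\<^bsub>G\<^esub> a) ` H)"

definition cell_weight :: "('g, 'b) monoid_scheme \<Rightarrow> 'g set \<Rightarrow> nat \<Rightarrow> 'g set \<Rightarrow> int" where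
  "cell_weight G H k K = (if conjugate_to G H K then (- 1) ^ k else 0)"

definition sweep :: "('g, 'b) monoid_scheme \<Rightarrow> ('g, 'x) gspace \<Rightarrow> 'x set \<Rightarrow> 'x set" where
  "sweep G X S = (\<lambda>(g, x). gact X g x) ` (carrier G \<times> S)"

text \<open>A \<open>G\<close>-cell \<open>D\<^sup>k \<times> G/K\<close> is recorded by its restriction \<open>f\<close> to \<open>D\<^sup>k\<close> times the coset \<open>K\<close>.\<close>

inductive gcell_built ::
    "('g, 'b) monoid_scheme \<Rightarrow> 'g topology \<Rightarrow> 'g set \<Rightarrow> ('g, 'x) gspace \<Rightarrow> 'x set \<Rightarrow> int \<Rightarrow> bool"
  for G T H X where
  base: "gcell_built G T H X {gbase X} 0"
| cell: "gcell_built G T H X B c \<Longrightarrow> closed_subgroup G T K \<Longrightarrow>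
     continuous_map (disk_space k) (gtop X) f \<Longrightarrow>
     (\<And>v g. v \<in> closed_disk k \<Longrightarrow> g \<in> K \<Longrightarrow> gact X g (f v) = f v) \<Longrightarrow>
     f ` bd_sphere k \<subseteq> B \<Longrightarrow> f ` open_disk k \<inter> B = {} \<Longrightarrow>
     (\<And>v w g. v \<in> open_disk k \<Longrightarrow> w \<in> open_disk k \<Longrightarrow> g \<in> carrier G \<Longrightarrow> gact X g (f v) = f w \<Longrightarrow>
        v = w \<and> g \<in> K) \<Longrightarrow>
     gcell_built G T H X (B \<union> sweep G X (f ` open_disk k)) (c + cell_weight G H k K)"

text \<open>The saturation condition makes \<open>q\<close> a closed map, and the image of a compact
  Hausdorff, hence normal, space under a closed continuous map is Hausdorff.\<close>

lemma Hausdorff_quotient: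
  assumes X: "compact_space X" "Hausdorff_space X" and q: "quotient_map X Y q"
    and sat: "\<And>C. closedin X C \<Longrightarrow> closedin X {x \<in> topspace X. q x \<in> q ` C}"
  shows "Hausdorff_space Y"
proof -
  have "closed_map X Y q"
    unfolding closed_map_def
  proof (intro allI impI)
    fix C assume C: "closedin X C"
    then have "q ` C \<subseteq> topspace Y"
      using closedin_subset quotient_imp_surjective_map[OF q] by blast
    then show "closedin Y (q ` C)" using q sat[OF C] unfolding quotient_map_closedin by blast
  qed
  moreover have "normal_space X"
    using X by (simp add: compact_Hausdorff_or_regular_imp_normal_space)
  ultimately show ?thesis
    using normal_Hausdorff_space_closed_continuous_map_image[of X Y q] X
      quotient_imp_continuous_map[OF q] quotient_imp_surjective_map[OF q] by blast
qed

section \<open>Swept sets and the isotropy groups inside one cell\<close>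

context compact_topological_group
begin

lemma compactin_sweep:
  assumes X: "pointed_gspace G T X" and S: "compactin (gtop X) S" and N: "closedin T N"
  shows "compactin (gtop X) ((\<lambda>(g, x). gact X g x) ` (N \<times> S))"
proof (rule image_compactin)
  have "compactin T N" using N compact_group by (simp add: closedin_compact_space)
  then show "compactin (prod_topology T (gtop X)) (N \<times> S)" using S by (simp add: compactin_Times)
  show "continuous_map (prod_topology T (gtop X)) (gtop X) (\<lambda>(g, x). gact X g x)"
    using X by (simp add: pointed_gspace_def)
qed

lemma compactin_sweep_carrier:
  assumes "pointed_gspace G T X" "compactin (gtop X) S"
  shows "compactin (gtop X) (sweep G X S)"
  using compactin_sweep[OF assms, of "carrier G"] unfolding sweep_def by (simp flip: topspace_group)

lemma compactin_disk_image:
  "continuous_map (disk_space k) Z f \<Longrightarrow> compactin Z (f ` closed_disk k)"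
  using image_compactin[of "disk_space k" "closed_disk k" Z f] compact_disk_space[of k]
  by (metis compact_space_def topspace_disk_space)

text \<open>If one of the two points is uncollapsed, conjugation by \<open>g\<close> or its inverse
  maps \<open>H\<close> into itself, and compactness gives the opposite inclusion. Two collapsed
  points both go to \<open>{}\<close>.\<close>

lemma zproj_translate_fixed:
  assumes H: "closed_subgroup G T H" and X: "pointed_gspace G T X"
    and x: "x \<in> fixed_points G H X" and g: "g \<in> carrier G" and gx: "gact X g x \<in> fixed_points G H X"
  shows "zproj G H X (gact X g x) = zproj G H X x"
proof -
  have Hs: "subgroup H G" "closedin T H" and Hc: "H \<subseteq> carrier G"
    using H by (auto simp: closed_subgroup_def dest: subgroup.subset)
  have *: "zproj G H X (gact X g x) = zproj G H X x"
    if x: "x \<in> fixed_points G H X" and g: "g \<in> carrier G" and gx: "gact X g x \<in> fixed_points G H X"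
      and nb: "\<not> collapsed G H X x" for x g
  proof -
    have xt: "x \<in> topspace (gtop X)" using x by (simp add: fixed_points_def)
    have N: "inv g \<otimes> h \<otimes> g \<in> H" if "h \<in> H" for h
      by (rule isotropy_conjugate[OF Hs(1) X x g gx nb that])
    show ?thesis
      by (rule zproj_translate[OF X xt g Hc N conjugate_into_subgroup[OF Hs g N]])
  qed
  show ?thesis
  proof (cases "collapsed G H X x \<and> collapsed G H X (gact X g x)")
    case True
    then show ?thesis by (simp add: zproj_def)
  next
    case False
    have xt: "x \<in> topspace (gtop X)" using x by (simp add: fixed_points_def)
    show ?thesis
      using *[OF x g gx] *[of "gact X g x" "inv g"] False x gx g gact_inv[OF X xt g] by auto
  qed
qed

lemma gcell_built_compactin:
  assumes X: "pointed_gspace G T X" and "gcell_built G T H X B c"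
  shows "compactin (gtop X) B \<and> gbase X \<in> B \<and> (\<forall>g\<in>carrier G. \<forall>x\<in>B. gact X g x \<in> B)"
  using assms(2)
proof (induction rule: gcell_built.induct)
  case base
  then show ?case using X by (auto simp: pointed_gspace_def)
next
  case (cell B c K k f)
  have ft: "v \<in> closed_disk k \<Longrightarrow> f v \<in> topspace (gtop X)" for v
    using continuous_map_image_subset_topspace[OF cell.hyps(3)] by auto
  have "B \<union> sweep G X (f ` open_disk k) = B \<union> sweep G X (f ` closed_disk k)"
  proof -
    have "sweep G X (f ` closed_disk k) = sweep G X (f ` open_disk k) \<union> sweep G X (f ` bd_sphere k)"
      unfolding closed_disk_split(1)[of k] by (auto simp: sweep_def image_Un)
    moreover have "sweep G X (f ` bd_sphere k) \<subseteq> B"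
      using cell.hyps(5) cell.IH by (auto simp: sweep_def)
    ultimately show ?thesis by blast
  qed
  moreover have "compactin (gtop X) (sweep G X (f ` closed_disk k))"
    by (rule compactin_sweep_carrier[OF X compactin_disk_image[OF cell.hyps(3)]])
  ultimately have "compactin (gtop X) (B \<union> sweep G X (f ` open_disk k))"
    using cell.IH by (simp add: compactin_Un)
  moreover have "gact X g x \<in> sweep G X (f ` open_disk k)"
    if g: "g \<in> carrier G" and x: "x \<in> sweep G X (f ` open_disk k)" for g x
  proof -
    obtain a v where av: "a \<in> carrier G" "v \<in> open_disk k" "x = gact X a (f v)"
      using x by (auto simp: sweep_def)
    have "f v \<in> topspace (gtop X)" using ft av closed_disk_split(1)[of k] by auto
    then have "gact X g x = gact X (g \<otimes> a) (f v)" using av g gspaceD(2)[OF X] by simp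
    then show ?thesis using av g by (auto simp: sweep_def intro!: image_eqI[of _ _ "(g \<otimes> a, f v)"])
  qed
  ultimately show ?case using cell.IH by blast
qed

text \<open>If \<open>K\<close> is a H a^-1, the isotropy group of the translate is the conjugate of
  \<open>H\<close> by \<open>g \<otimes> a\<close>. It contains \<open>H\<close>, so by compactness
  it equals \<open>H\<close>.\<close>

lemma not_collapsed_of_type:
  assumes H: "closed_subgroup G T H" and X: "pointed_gspace G T X" and y: "y \<in> topspace (gtop X)"
    and stab: "\<And>b. b \<in> carrier G \<Longrightarrow> gact X b y = y \<longleftrightarrow> b \<in> K"
    and conj: "conjugate_to G H K" and g: "g \<in> carrier G"
    and fx: "gact X g y \<in> fixed_points G H X" and nb: "gact X g y \<noteq> gbase X"
  shows "\<not> collapsed G H X (gact X g y)"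
proof
  have Hs: "subgroup H G" "closedin T H" and Hc: "H \<subseteq> carrier G"
    using H by (auto simp: closed_subgroup_def dest: subgroup.subset)
  obtain a where a: "a \<in> carrier G" "K = (\<lambda>h. a \<otimes> h \<otimes> inv a) ` H"
    using conj by (auto simp: conjugate_to_def)
  let ?a = "g \<otimes> a"
  have ac: "?a \<in> carrier G" using a g by simp
  have conj: "inv ?a \<otimes> b \<otimes> ?a \<in> H" if b: "b \<in> carrier G" "gact X b (gact X g y) = gact X g y" for b
  proof -
    have "inv g \<otimes> b \<otimes> g \<in> K" using stabilizer_translate[OF X y g b(1)] stab b g by simp
    then obtain h where h: "h \<in> H" "inv g \<otimes> b \<otimes> g = a \<otimes> h \<otimes> inv a" using a(2) by auto
    have "inv ?a \<otimes> b \<otimes> ?a = inv a \<otimes> (inv g \<otimes> b \<otimes> g) \<otimes> a"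
      using a g b by (simp add: inv_mult_group m_assoc)
    also have "\<dots> = h" unfolding h(2) using a h(1) Hc
      by (simp add: m_assoc[symmetric] subset_iff) (simp add: m_assoc)
    finally show ?thesis using h by simp
  qed
  have N: "inv ?a \<otimes> h \<otimes> ?a \<in> H" if "h \<in> H" for h
    using conj[of h] that fx Hc by (auto simp: fixed_points_def)
  assume "collapsed G H X (gact X g y)"
  then obtain b where b: "b \<in> carrier G" "b \<notin> H" "gact X b (gact X g y) = gact X g y"
    using nb by (auto simp: collapsed_def)
  have "?a \<otimes> (inv ?a \<otimes> b \<otimes> ?a) \<otimes> inv ?a \<in> H"
    by (rule conjugate_into_subgroup[OF Hs ac N conj[OF b(1,3)]])
  moreover have "?a \<otimes> (inv ?a \<otimes> b \<otimes> ?a) \<otimes> inv ?a = b"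
    using ac b(1) by (metis (no_types, lifting) inv_closed m_assoc m_closed r_inv l_one r_one)
  ultimately show False using b by simp
qed

text \<open>The conjugate g^-1 H g lies in \<open>K\<close> but is not all of it, so some element of
  g K g^-1 outside \<open>H\<close> fixes the translate. That \<open>K\<close> fixes
  \<open>y\<close> is asked, not that it is the isotropy group, because on the boundary of a cell
  the isotropy group may exceed \<open>K\<close>.\<close>

lemma collapsed_of_larger_type:
  assumes H: "H \<subseteq> carrier G" and X: "pointed_gspace G T X" and y: "y \<in> topspace (gtop X)"
    and K: "K \<subseteq> carrier G" "\<And>k. k \<in> K \<Longrightarrow> gact X k y = y" and g: "g \<in> carrier G"
    and N: "\<And>h. h \<in> H \<Longrightarrow> inv g \<otimes> h \<otimes> g \<in> K" and nconj: "\<not> conjugate_to G H K"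
  shows "gact X g y \<in> fixed_points G H X" "collapsed G H X (gact X g y)"
proof -
  have st: "gact X b (gact X g y) = gact X g y" if "b \<in> carrier G" "inv g \<otimes> b \<otimes> g \<in> K" for b
    unfolding stabilizer_translate[OF X y g that(1)] using K(2)[OF that(2)] .
  show "gact X g y \<in> fixed_points G H X"
    using st N H gact_closed[OF X y g] by (auto simp: fixed_points_def)
  have "\<exists>k\<in>K. g \<otimes> k \<otimes> inv g \<notin> H"
  proof (rule ccontr)
    assume "\<not> ?thesis"
    then have "\<And>k. k \<in> K \<Longrightarrow> g \<otimes> k \<otimes> inv g \<in> H" by blast
    moreover have "k = inv g \<otimes> (g \<otimes> k \<otimes> inv g) \<otimes> inv (inv g)" if "k \<in> K" for k
      using that K(1) g by (simp add: m_assoc[symmetric] subset_iff) (simp add: m_assoc)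
    ultimately have "K \<subseteq> (\<lambda>h. inv g \<otimes> h \<otimes> inv (inv g)) ` H" by blast
    moreover have "(\<lambda>h. inv g \<otimes> h \<otimes> inv (inv g)) ` H \<subseteq> K" using N g by auto
    ultimately have "K = (\<lambda>h. inv g \<otimes> h \<otimes> inv (inv g)) ` H" by blast
    then show False using nconj g inv_closed unfolding conjugate_to_def by blast
  qed
  then obtain k where k: "k \<in> K" "g \<otimes> k \<otimes> inv g \<notin> H" by blast
  have kc: "k \<in> carrier G" using k K(1) by auto
  have "inv g \<otimes> (g \<otimes> k \<otimes> inv g) \<otimes> g = k"
    using g kc by (simp add: m_assoc[symmetric]) (simp add: m_assoc)
  then have "gact X (g \<otimes> k \<otimes> inv g) (gact X g y) = gact X g y" using k(1) g kc by (intro st) auto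
  then show "collapsed G H X (gact X g y)" using k(2) g kc unfolding collapsed_def by blast
qed

text \<open>A closed collapsed set is what makes Z Hausdorff. A cell of type conjugate to
  \<open>H\<close> adds no collapsed point; in any other cell every fixed point is collapsed, and
  these points are swept out by a compact set.\<close>

lemma gcell_built_collapsed_closedin:
  assumes H: "closed_subgroup G T H" and X: "pointed_gspace G T X" and haus: "Hausdorff_space (gtop X)"
    and "gcell_built G T H X B c"
  shows "closedin (gtop X) {x \<in> fixed_points G H X \<inter> B. collapsed G H X x}"
  using assms(4)
proof (induction rule: gcell_built.induct)
  case base
  have "{x \<in> fixed_points G H X \<inter> {gbase X}. collapsed G H X x} = {gbase X}"
    using gbase_fixed[of H X] H X by (auto simp: closed_subgroup_def collapsed_gbase)
  then show ?case
    using haus X by (simp add: closedin_Hausdorff_singleton pointed_gspace_def)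
next
  case (cell B c K k f)
  have Hs: "subgroup H G" "closedin T H" and Hc: "H \<subseteq> carrier G"
    using H by (auto simp: closed_subgroup_def dest: subgroup.subset)
  have Ks: "subgroup K G" "closedin T K" and Kc: "K \<subseteq> carrier G"
    using cell.hyps(2) by (auto simp: closed_subgroup_def dest: subgroup.subset)
  have ft: "v \<in> closed_disk k \<Longrightarrow> f v \<in> topspace (gtop X)" for v
    using continuous_map_image_subset_topspace[OF cell.hyps(3)] by auto
  have oc: "open_disk k \<subseteq> closed_disk k" using closed_disk_split(1)[of k] by auto
  have inv: "compactin (gtop X) B" "\<And>g x. g \<in> carrier G \<Longrightarrow> x \<in> B \<Longrightarrow> gact X g x \<in> B"
    using gcell_built_compactin[OF X cell.hyps(1)] by auto
  have stab: "gact X a (f v) = f v \<longleftrightarrow> a \<in> K" if "v \<in> open_disk k" "a \<in> carrier G" for a v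
    using cell.hyps(4,7) that oc by blast
  define N where "N = {g \<in> carrier G. \<forall>h\<in>H. inv g \<otimes> h \<otimes> g \<in> K}"
  show ?case
  proof (cases "conjugate_to G H K")
    case True
    have "\<not> collapsed G H X x" if fx: "x \<in> fixed_points G H X" and x: "x \<in> sweep G X (f ` open_disk k)"
      and xB: "x \<notin> B" for x
    proof -
      obtain g v where gv: "g \<in> carrier G" "v \<in> open_disk k" "x = gact X g (f v)"
        using x by (auto simp: sweep_def)
      have "f v \<in> topspace (gtop X)" using gv oc ft by auto
      moreover have "x \<noteq> gbase X" using xB gcell_built_compactin[OF X cell.hyps(1)] by auto
      ultimately show ?thesis
        using not_collapsed_of_type[OF H X _ stab[OF gv(2)] True gv(1)] fx unfolding gv(3) by blast
    qed
    then have "{x \<in> fixed_points G H X \<inter> (B \<union> sweep G X (f ` open_disk k)). collapsed G H X x} =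
        {x \<in> fixed_points G H X \<inter> B. collapsed G H X x}" by blast
    then show ?thesis using cell.IH by simp
  next
    case False
    \<comment> \<open>The closed disk gives a compact set; its boundary part lies in
      \<open>B\<close> and consists of collapsed fixed points as well.\<close>
    let ?S = "(\<lambda>(g, x). gact X g x) ` (N \<times> f ` closed_disk k)"
    have col: "x \<in> fixed_points G H X \<and> collapsed G H X x" if xS: "x \<in> ?S" for x
    proof -
      obtain g v where gv: "g \<in> N" "v \<in> closed_disk k" "x = gact X g (f v)" using xS by auto
      then show ?thesis
        using collapsed_of_larger_type[OF Hc X ft[OF gv(2)] Kc cell.hyps(4)[OF gv(2)] _ _ False, of g]
        by (simp add: N_def)
    qed
    have sub: "x \<in> ?S" if fx: "x \<in> fixed_points G H X" and x: "x \<in> sweep G X (f ` open_disk k)" for x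
    proof -
      obtain g v where gv: "g \<in> carrier G" "v \<in> open_disk k" "x = gact X g (f v)"
        using x by (auto simp: sweep_def)
      have fv: "f v \<in> topspace (gtop X)" using gv oc ft by auto
      have "inv g \<otimes> h \<otimes> g \<in> K" if h: "h \<in> H" for h
      proof -
        have hc: "h \<in> carrier G" using h Hc by auto
        have "gact X h x = x" using fx h by (simp add: fixed_points_def)
        then show ?thesis using stabilizer_translate[OF X fv gv(1) hc] stab[OF gv(2)] gv hc by auto
      qed
      then have "g \<in> N" using gv by (simp add: N_def)
      then show ?thesis using gv oc by auto
    qed
    have bd: "?S \<subseteq> B \<union> sweep G X (f ` open_disk k)"
    proof
      fix x assume "x \<in> ?S"
      then obtain g v where gv: "g \<in> carrier G" "v \<in> closed_disk k" "x = gact X g (f v)"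
        by (auto simp: N_def)
      show "x \<in> B \<union> sweep G X (f ` open_disk k)"
      proof (cases "v \<in> open_disk k")
        case False
        then have "f v \<in> B" using gv cell.hyps(5) closed_disk_split(1)[of k] by auto
        then show ?thesis using gv inv by simp
      qed (use gv in \<open>auto simp: sweep_def\<close>)
    qed
    have eq: "{x \<in> fixed_points G H X \<inter> (B \<union> sweep G X (f ` open_disk k)). collapsed G H X x} =
        {x \<in> fixed_points G H X \<inter> B. collapsed G H X x} \<union> ?S"
      using col sub bd by blast
    have "N = topspace T \<inter> (\<Inter>h\<in>H. {g \<in> topspace T. inv g \<otimes> h \<otimes> g \<in> K})"
      using topspace_group by (auto simp: N_def)
    also have "closedin T \<dots>"
    proof (cases "H = {}")
      case False
      have "closedin T {g \<in> topspace T. inv g \<otimes> h \<otimes> g \<in> K}" if "h \<in> H" for h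
        using that Hc Ks(2)
        by (intro closedin_continuous_map_preimage[where Y=T] continuous_mult_maps continuous_inv_map continuous_group_const) auto
      then show ?thesis using False by (intro closedin_Int closedin_topspace closedin_INT) auto
    qed simp
    finally have "closedin T N" .
    then have "compactin (gtop X) ?S"
      using compactin_disk_image[OF cell.hyps(3)] compactin_sweep[OF X] by blast
    then have "closedin (gtop X) ?S" using haus by (simp add: compactin_imp_closedin)
    then show ?thesis unfolding eq using cell.IH by blast
  qed
qed

section \<open>Topology and cells of the subquotient\<close>

lemma closedin_fixed_points:
  assumes H: "subgroup H G" and X: "pointed_gspace G T X" and haus: "Hausdorff_space (gtop X)"
  shows "closedin (gtop X) (fixed_points G H X)"
proof -
  have "fixed_points G H X = (\<Inter>h\<in>H. {x \<in> topspace (gtop X). gact X h x = x})"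
    using subgroup.one_closed[OF H] by (auto simp: fixed_points_def)
  also have "closedin (gtop X) \<dots>"
  proof (rule closedin_INT)
    show "H \<noteq> {}" using subgroup.one_closed[OF H] by auto
    fix h assume "h \<in> H"
    then have "h \<in> carrier G" using H by (meson subgroup.mem_carrier)
    then have "continuous_map (gtop X) (gtop X) (\<lambda>x. gact X h x)"
      by (intro continuous_gact[OF X] continuous_group_const) (auto simp: continuous_map_id[unfolded id_def])
    then show "closedin (gtop X) {x \<in> topspace (gtop X). gact X h x = x}"
      using haus by (intro closedin_continuous_maps_eq) (auto simp: continuous_map_id[unfolded id_def])
  qed
  finally show ?thesis .
qed

lemma Hausdorff_zspace:
  assumes H: "closed_subgroup G T H" and X: "pointed_gspace G T X" and haus: "Hausdorff_space (gtop X)"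
    and b: "gcell_built G T H X (topspace (gtop X)) c"
  shows "Hausdorff_space (zspace G H X)"
proof -
  let ?FX = "subtopology (gtop X) (fixed_points G H X)"
  let ?K = "{x \<in> fixed_points G H X. collapsed G H X x}"
  have Hs: "subgroup H G" using H by (simp add: closed_subgroup_def)
  have comp: "compact_space (gtop X)"
    using gcell_built_compactin[OF X b] by (simp add: compact_space_def)
  have clF: "closedin (gtop X) (fixed_points G H X)" by (rule closedin_fixed_points[OF Hs X haus])
  have tFX: "topspace ?FX = fixed_points G H X" using fixed_points_subset[of G H X] by auto
  have compF: "compact_space ?FX"
    using closedin_compact_space[OF comp clF] by (simp add: compact_space_subtopology)
  have "?K = {x \<in> fixed_points G H X \<inter> topspace (gtop X). collapsed G H X x}"
    using fixed_points_subset[of G H X] by auto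
  then have clK: "closedin (gtop X) ?K"
    using gcell_built_collapsed_closedin[OF H X haus b] by simp
  show ?thesis
  proof (rule Hausdorff_quotient[OF compF Hausdorff_space_subtopology[OF haus] quotient_map_zproj])
    fix C assume C: "closedin ?FX C"
    then have CF: "C \<subseteq> fixed_points G H X" and clC: "closedin (gtop X) C"
      using closedin_subset[OF C] tFX closedin_trans_full[OF C clF] by auto
    let ?SC = "{x \<in> topspace ?FX. zproj G H X x \<in> zproj G H X ` C}"
    \<comment> \<open>A closed set that meets the collapsed part saturates to include all of it;
      otherwise only its own orbits matter.\<close>
    let ?K' = "if C \<inter> ?K = {} then {} else ?K"
    have "?SC = ?K' \<union> (fixed_points G H X \<inter> sweep G X C)"
    proof (rule subset_antisym; rule subsetI)
      fix x assume "x \<in> ?SC"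
      then obtain y where xy: "x \<in> fixed_points G H X" "y \<in> C" "zproj G H X y = zproj G H X x"
        unfolding tFX by auto
      show "x \<in> ?K' \<union> (fixed_points G H X \<inter> sweep G X C)"
      proof (cases "collapsed G H X y")
        case True
        then have "collapsed G H X x" using xy zproj_empty_iff by metis
        then show ?thesis using True xy CF by auto
      next
        case False
        obtain g where "g \<in> carrier G" "x = gact X g y"
          by (rule zproj_eq_orbit[OF X _ _ False xy(3)]) (use xy CF fixed_points_subset[of G H X] in auto)
        then show ?thesis using xy by (auto simp: sweep_def)
      qed
    next
      fix x assume x: "x \<in> ?K' \<union> (fixed_points G H X \<inter> sweep G X C)"
      then consider y where "y \<in> C" "collapsed G H X y" "x \<in> fixed_points G H X" "collapsed G H X x"
        | g y where "g \<in> carrier G" "y \<in> C" "x = gact X g y" "x \<in> fixed_points G H X"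
        by (auto simp: sweep_def split: if_splits)
      then show "x \<in> ?SC"
      proof cases
        case 1
        then show ?thesis unfolding tFX by (auto simp: zproj_def image_iff intro!: bexI[of _ y])
      next
        case 2
        then have "zproj G H X x = zproj G H X y"
          using zproj_translate_fixed[OF H X _ 2(1)] CF by auto
        then show ?thesis using 2 unfolding tFX by auto
      qed
    qed
    moreover have "closedin (gtop X) ?K'" using clK by simp
    moreover have "closedin (gtop X) (sweep G X C)"
      using compactin_sweep_carrier[OF X closedin_compact_space[OF comp clC]] haus
      by (simp add: compactin_imp_closedin)
    ultimately have "closedin (gtop X) ?SC" using clF by (simp add: closedin_Un closedin_Int)
    then show "closedin ?FX ?SC" by (rule closedin_subset_topspace) (use tFX in auto)
  qed
qed

text \<open>A cell of type a H a^-1 is moved by a^-1, so that its disk lies in the fixed set of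
  \<open>H\<close>; modulo the group it is one ordinary cell. In a cell of any other type all fixed
  points are collapsed, and the image in Z does not grow.\<close>

lemma gcell_built_cell_built:
  assumes H: "closed_subgroup G T H" and X: "pointed_gspace G T X"
    and "gcell_built G T H X B c"
  shows "cell_built (zspace G H X) {} (zproj G H X ` (fixed_points G H X \<inter> B)) c"
  using assms(3)
proof (induction rule: gcell_built.induct)
  case base
  have "subgroup H G" using H by (simp add: closed_subgroup_def)
  then have "zproj G H X ` (fixed_points G H X \<inter> {gbase X}) = {{}}" "{} \<in> topspace (zspace G H X)"
    using gbase_fixed[OF _ X] empty_in_zspace[OF _ X] by (auto simp: zproj_gbase)
  then show ?case by (auto intro: cell_built.base)
next
  case (cell B c K k f)
  have Hs: "subgroup H G" "closedin T H" and Hc: "H \<subseteq> carrier G"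
    using H by (auto simp: closed_subgroup_def dest: subgroup.subset)
  have Kc: "K \<subseteq> carrier G"
    using cell.hyps(2) by (auto simp: closed_subgroup_def dest: subgroup.subset)
  have ft: "v \<in> closed_disk k \<Longrightarrow> f v \<in> topspace (gtop X)" for v
    using continuous_map_image_subset_topspace[OF cell.hyps(3)] by auto
  have oc: "open_disk k \<subseteq> closed_disk k" "bd_sphere k \<subseteq> closed_disk k"
    using closed_disk_split(1)[of k] by auto
  have inv: "gbase X \<in> B" "\<And>g x. g \<in> carrier G \<Longrightarrow> x \<in> B \<Longrightarrow> gact X g x \<in> B"
    using gcell_built_compactin[OF X cell.hyps(1)] by auto
  have stab: "gact X a (f v) = f v \<longleftrightarrow> a \<in> K" if "v \<in> open_disk k" "a \<in> carrier G" for a v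
    using cell.hyps(4,7) that oc by blast
  let ?F = "fixed_points G H X"
  show ?case
  proof (cases "conjugate_to G H K")
    case True
    then obtain a where a: "a \<in> carrier G" "K = (\<lambda>h. a \<otimes> h \<otimes> inv a) ` H"
      by (auto simp: conjugate_to_def)
    \<comment> \<open>On the open disk the points of \<open>f\<close> have isotropy group
      \<open>K\<close>, hence those of \<open>f'\<close> have isotropy group
      \<open>H\<close>.\<close>
    define f' where "f' = (\<lambda>v. gact X (inv a) (f v))"
    have f't: "f' v \<in> topspace (gtop X)" if "v \<in> closed_disk k" for v
      unfolding f'_def using gact_closed[OF X ft[OF that]] a by simp
    have ff': "f v = gact X a (f' v)" if "v \<in> closed_disk k" for v
      unfolding f'_def using gact_inv[OF X ft[OF that] a(1)] by simp
    have f'F: "f' v \<in> ?F" if v: "v \<in> closed_disk k" for v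
    proof -
      have "gact X h (f' v) = f' v" if h: "h \<in> H" for h
      proof -
        have "inv (inv a) \<otimes> h \<otimes> inv a \<in> K" using a h by auto
        then show ?thesis
          unfolding f'_def using stabilizer_translate[OF X ft[OF v], of "inv a" h] a h Hc cell.hyps(4)[OF v]
          by auto
      qed
      then show ?thesis using f't[OF v] by (simp add: fixed_points_def)
    qed
    \<comment> \<open>Translates of \<open>f'\<close> are rewritten as translates of
      \<open>f\<close>, for which the injectivity of the cell is stated.\<close>
    have orb: "\<exists>b\<in>carrier G. inv a \<otimes> b \<otimes> a = g \<and> gact X b (f v) = gact X a (gact X g (f' v))"
      if v: "v \<in> closed_disk k" and g: "g \<in> carrier G" for v g
    proof (intro bexI conjI)
      let ?b = "a \<otimes> g \<otimes> inv a"
      show "inv a \<otimes> ?b \<otimes> a = g" using a g by (simp add: m_assoc[symmetric]) (simp add: m_assoc)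
      show "?b \<in> carrier G" using a g by simp
      show "gact X ?b (f v) = gact X a (gact X g (f' v))"
        unfolding f'_def using a g gspaceD(2)[OF X] gact_closed[OF X] ft[OF v] by (simp add: m_assoc)
    qed
    have nb: "\<not> collapsed G H X (f' v)" if v: "v \<in> open_disk k" for v
    proof -
      have vc: "v \<in> closed_disk k" using v oc by auto
      have "f' v \<noteq> gbase X" using ff'[OF vc] inv a cell.hyps(6) v by fastforce
      then show ?thesis
        using not_collapsed_of_type[OF H X ft[OF vc] stab[OF v] True inv_closed[OF a(1)]] f'F[OF vc]
        unfolding f'_def by blast
    qed
    let ?Z = "zproj G H X \<circ> f'"
    have cf': "continuous_map (disk_space k) (gtop X) f'"
      unfolding f'_def using a by (intro continuous_gact[OF X] continuous_group_const cell.hyps(3)) auto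
    then have "continuous_map (disk_space k) (subtopology (gtop X) ?F) f'"
      using f'F by (auto simp: continuous_map_in_subtopology)
    then have cZ: "continuous_map (disk_space k) (zspace G H X) ?Z"
      using quotient_imp_continuous_map[OF quotient_map_zproj] by (rule continuous_map_compose)
    have "cell_built (zspace G H X) {} (zproj G H X ` (?F \<inter> B) \<union> ?Z ` open_disk k) (c + (- 1) ^ k)"
    proof (rule cell_built.cell[OF cell.IH cZ])
      show "?Z ` bd_sphere k \<subseteq> zproj G H X ` (?F \<inter> B)"
      proof
        fix z assume "z \<in> ?Z ` bd_sphere k"
        then obtain v where v: "v \<in> bd_sphere k" "z = zproj G H X (f' v)" by auto
        then have "f' v \<in> B" unfolding f'_def using inv a cell.hyps(5) by auto
        then show "z \<in> zproj G H X ` (?F \<inter> B)" using v f'F oc by auto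
      qed
      show "inj_on ?Z (open_disk k)"
      proof (rule inj_onI)
        fix v w assume vw: "v \<in> open_disk k" "w \<in> open_disk k" "?Z v = ?Z w"
        have vc: "v \<in> closed_disk k" "w \<in> closed_disk k" using vw oc by auto
        obtain g where g: "g \<in> carrier G" "f' w = gact X g (f' v)"
          by (rule zproj_eq_orbit[OF X f't[OF vc(1)] f't[OF vc(2)] nb[OF vw(1)]]) (use vw in auto)
        obtain b where b: "b \<in> carrier G" "gact X b (f v) = gact X a (gact X g (f' v))"
          using orb[OF vc(1) g(1)] by blast
        then have "gact X b (f v) = f w" using g ff'[OF vc(2)] by simp
        then show "v = w" using cell.hyps(7) vw b by blast
      qed
      show "?Z ` open_disk k \<inter> zproj G H X ` (?F \<inter> B) = {}"
      proof (rule ccontr)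
        assume "\<not> ?thesis"
        then obtain v y where vy: "v \<in> open_disk k" "y \<in> ?F" "y \<in> B" "zproj G H X (f' v) = zproj G H X y"
          by auto
        have vc: "v \<in> closed_disk k" using vy oc by auto
        have yt: "y \<in> topspace (gtop X)" using vy fixed_points_subset[of G H X] by auto
        obtain g where g: "g \<in> carrier G" "y = gact X g (f' v)"
          by (rule zproj_eq_orbit[OF X f't[OF vc] yt nb[OF vy(1)] vy(4)])
        then have "f' v = gact X (inv g) y" using gact_inv[OF X f't[OF vc]] by simp
        moreover have "gact X (inv g) y \<in> B" using inv(2)[OF inv_closed[OF g(1)] vy(3)] .
        ultimately have "f' v \<in> B" by simp
        then have "f v \<in> B" using ff'[OF vc] inv a by simp
        then show False using cell.hyps(6) vy by auto
      qed
    qed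
    moreover have "zproj G H X ` (?F \<inter> (B \<union> sweep G X (f ` open_disk k))) =
        zproj G H X ` (?F \<inter> B) \<union> ?Z ` open_disk k"
    proof -
      have "zproj G H X x \<in> ?Z ` open_disk k" if x: "x \<in> ?F" "x \<in> sweep G X (f ` open_disk k)" for x
      proof -
        obtain g v where gv: "g \<in> carrier G" "v \<in> open_disk k" "x = gact X g (f v)"
          using x by (auto simp: sweep_def)
        have vc: "v \<in> closed_disk k" using gv oc by auto
        have "x = gact X (g \<otimes> a) (f' v)"
          unfolding gv(3) ff'[OF vc] using gspaceD(2)[OF X f't[OF vc]] gv a by simp
        then have "zproj G H X x = zproj G H X (f' v)"
          using zproj_translate_fixed[OF H X f'F[OF vc], of "g \<otimes> a"] x gv a by simp
        then show ?thesis using gv by auto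
      qed
      moreover have "f' v \<in> ?F \<inter> sweep G X (f ` open_disk k)" if v: "v \<in> open_disk k" for v
        using f'F v oc a unfolding f'_def by (auto simp: sweep_def)
      ultimately show ?thesis by (auto simp: Int_Un_distrib image_Un)
    qed
    ultimately show ?thesis using True by (simp add: cell_weight_def)
  next
    case False
    have "collapsed G H X x" if fx: "x \<in> ?F" and x: "x \<in> sweep G X (f ` open_disk k)" for x
    proof -
      obtain g v where gv: "g \<in> carrier G" "v \<in> open_disk k" "x = gact X g (f v)"
        using x by (auto simp: sweep_def)
      have vc: "v \<in> closed_disk k" using gv oc by auto
      have N: "inv g \<otimes> h \<otimes> g \<in> K" if h: "h \<in> H" for h
      proof -
        have hc: "h \<in> carrier G" using h Hc by auto
        have "gact X h x = x" using fx h by (simp add: fixed_points_def)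
        then show ?thesis using stabilizer_translate[OF X ft[OF vc] gv(1) hc] stab[OF gv(2)] gv hc by auto
      qed
      show ?thesis
        unfolding gv(3) by (rule collapsed_of_larger_type(2)[OF Hc X ft[OF vc] Kc cell.hyps(4)[OF vc] gv(1) N False])
    qed
    then have "zproj G H X ` (?F \<inter> (B \<union> sweep G X (f ` open_disk k))) = zproj G H X ` (?F \<inter> B)"
      using inv(1) gbase_fixed[OF Hs(1) X] zproj_gbase[of H X]
      by (auto simp: zproj_def Int_Un_distrib image_Un image_iff)
    then show ?thesis using cell.IH False by (simp add: cell_weight_def)
  qed
qed

lemma gcell_built_euler_number:
  assumes H: "closed_subgroup G T H" and X: "pointed_gspace G T X" and haus: "Hausdorff_space (gtop X)"
    and b: "gcell_built G T H X (topspace (gtop X)) c"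
  shows "euler_number (zspace G H X) {{}} c"
proof -
  have "fixed_points G H X \<inter> topspace (gtop X) = fixed_points G H X"
    using fixed_points_subset[of G H X] by auto
  then have "cell_built (zspace G H X) {} (topspace (zspace G H X)) c"
    using gcell_built_cell_built[OF H X b] by (simp add: topspace_zspace)
  from cell_built_euler_number[OF Hausdorff_zspace[OF assms] this] show ?thesis by simp
qed

end

section \<open>Cells of G-CW-complexes\<close>

text \<open>The data of \<^const>\<open>attaches_cells\<close> in terms of the maps \<open>f j v = \<Phi> (j, v, K j)\<close>. No condition
  on the topology of \<open>C\<close> is needed: by compactness it is determined.\<close>

definition attaches_orbits ::
    "('g, 'b) monoid_scheme \<Rightarrow> 'g topology \<Rightarrow> ('g, 'x) gspace \<Rightarrow> 'x set \<Rightarrow> 'x set \<Rightarrow> nat \<Rightarrow>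
     nat \<Rightarrow> (nat \<Rightarrow> 'g set) \<Rightarrow> (nat \<Rightarrow> (nat \<Rightarrow> real) \<Rightarrow> 'x) \<Rightarrow> bool" where
  "attaches_orbits G T X B C k m K f \<longleftrightarrow>
     (\<forall>j<m. closed_subgroup G T (K j) \<and> continuous_map (disk_space k) (gtop X) (f j) \<and>
        (\<forall>v\<in>closed_disk k. \<forall>g\<in>K j. gact X g (f j v) = f j v) \<and>
        f j ` bd_sphere k \<subseteq> B \<and> f j ` open_disk k \<inter> B = {}) \<and>
     (\<forall>i<m. \<forall>j<m. \<forall>v\<in>open_disk k. \<forall>w\<in>open_disk k. \<forall>g\<in>carrier G.
        gact X g (f i v) = f j w \<longrightarrow> i = j \<and> v = w \<and> g \<in> K i) \<and>
     C = B \<union> (\<Union>j<m. sweep G X (f j ` open_disk k))"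

lemma attaches_orbitsD:
  assumes "attaches_orbits G T X B C k m K f" "j < m"
  shows "closed_subgroup G T (K j)" "continuous_map (disk_space k) (gtop X) (f j)"
    "v \<in> closed_disk k \<Longrightarrow> g \<in> K j \<Longrightarrow> gact X g (f j v) = f j v"
    "f j ` bd_sphere k \<subseteq> B" "f j ` open_disk k \<inter> B = {}"
    "i < m \<Longrightarrow> v \<in> open_disk k \<Longrightarrow> w \<in> open_disk k \<Longrightarrow> g \<in> carrier G \<Longrightarrow> gact X g (f i v) = f j w \<Longrightarrow>
       i = j \<and> v = w \<and> g \<in> K i"
proof -
  have 1: "closed_subgroup G T (K j) \<and> continuous_map (disk_space k) (gtop X) (f j) \<and>
      (\<forall>v\<in>closed_disk k. \<forall>g\<in>K j. gact X g (f j v) = f j v) \<and>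
      f j ` bd_sphere k \<subseteq> B \<and> f j ` open_disk k \<inter> B = {}"
    using assms(1)[unfolded attaches_orbits_def, THEN conjunct1] assms(2) by simp
  show "closed_subgroup G T (K j)" "continuous_map (disk_space k) (gtop X) (f j)"
    "v \<in> closed_disk k \<Longrightarrow> g \<in> K j \<Longrightarrow> gact X g (f j v) = f j v"
    "f j ` bd_sphere k \<subseteq> B" "f j ` open_disk k \<inter> B = {}"
    using 1 by auto
  show "i < m \<Longrightarrow> v \<in> open_disk k \<Longrightarrow> w \<in> open_disk k \<Longrightarrow> g \<in> carrier G \<Longrightarrow> gact X g (f i v) = f j w \<Longrightarrow>
       i = j \<and> v = w \<and> g \<in> K i"
    using assms unfolding attaches_orbits_def by simp
qed

lemma continuous_map_from_sum_topology:
  assumes "\<And>i. i \<in> I \<Longrightarrow> continuous_map (X i) Y (\<lambda>x. f (i, x))"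
  shows "continuous_map (sum_topology X I) Y f"
  unfolding continuous_map_def
proof (intro conjI allI impI)
  show "f \<in> topspace (sum_topology X I) \<rightarrow> topspace Y"
  proof
    fix x assume "x \<in> topspace (sum_topology X I)"
    then obtain i y where "x = (i, y)" "i \<in> I" "y \<in> topspace (X i)" by auto
    then show "f x \<in> topspace Y" using continuous_map_image_subset_topspace[OF assms[of i]] by auto
  qed
  fix U assume U: "openin Y U"
  have "openin (X i) {x. (i, x) \<in> {x \<in> topspace (sum_topology X I). f x \<in> U}}" if "i \<in> I" for i
    using openin_continuous_map_preimage[OF assms[OF that] U] that by simp
  then show "openin (sum_topology X I) {x \<in> topspace (sum_topology X I). f x \<in> U}"
    unfolding openin_sum_topology by auto
qed

lemma compact_space_sum_topology:
  assumes "finite I" "\<And>i. i \<in> I \<Longrightarrow> compact_space (X i)"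
  shows "compact_space (sum_topology X I)"
proof -
  have "compactin (sum_topology X I) ((\<lambda>x. (i, x)) ` topspace (X i))" if "i \<in> I" for i
    using assms(2)[OF that] continuous_map_component_injection[OF that]
    by (intro image_compactin[of "X i"]) (auto simp: compact_space_def)
  then have "compactin (sum_topology X I) (\<Union>i\<in>I. (\<lambda>x. (i, x)) ` topspace (X i))"
    using assms(1) by (intro compactin_Union) auto
  moreover have "(\<Union>i\<in>I. (\<lambda>x. (i, x)) ` topspace (X i)) = topspace (sum_topology X I)" by auto
  ultimately show ?thesis by (simp add: compact_space_def)
qed

text \<open>The radius from the origin to \<open>v\<close> lies in the open disk except possibly for
  its end. A closed subcomplex that contains an open cell will therefore contain the closed
  one.\<close>

lemma closed_disk_closure:
  assumes Z: "closedin (disk_space k) Z" "open_disk k \<subseteq> Z"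
  shows "closed_disk k \<subseteq> Z"
proof
  fix v assume v: "v \<in> closed_disk k"
  let ?I = "top_of_set {0..1::real}"
  have sub: "(\<lambda>i. t * v i) \<in> closed_disk k" if "t \<in> {0..1}" for t
    using v that by (auto simp: closed_disk_vnorm vnorm_scale mult_le_one)
  have "continuous_map ?I (Euclidean_space k) (\<lambda>t i. if i < k then t * v i else 0)"
    unfolding continuous_map_componentwise_Euclidean_space
    by (intro allI impI) (auto intro!: continuous_intros)
  then have "continuous_map ?I (Euclidean_space k) (\<lambda>t i. t * v i)"
    by (rule continuous_map_eq) (use v in \<open>auto simp: closed_disk_vnorm fun_eq_iff\<close>)
  then have "continuous_map ?I (disk_space k) (\<lambda>t i. t * v i)"
    using sub by (auto simp: continuous_map_into_disk_space)
  from closedin_continuous_map_preimage[OF this Z(1)]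
  have "closedin ?I {t \<in> {0..1}. (\<lambda>i. t * v i) \<in> Z}" by simp
  then have cl: "closed {t \<in> {0..1}. (\<lambda>i. t * v i) \<in> Z}"
    by (metis (no_types, lifting) closedin_closed_eq closed_real_atLeastAtMost)
  have "(\<lambda>i. t * v i) \<in> Z" if "t \<in> {0..<1}" for t
  proof -
    have "vnorm k (\<lambda>i. t * v i) < 1"
      using v that unfolding vnorm_scale closed_disk_vnorm
      by (cases "t = 0") (auto intro: le_less_trans[OF mult_left_le])
    then show ?thesis using v Z(2) by (auto simp: open_disk_vnorm closed_disk_vnorm)
  qed
  then have "{0..<1} \<subseteq> {t \<in> {0..1}. (\<lambda>i. t * v i) \<in> Z}" by auto
  then have "closure {0..<1} \<subseteq> {t \<in> {0..1}. (\<lambda>i. t * v i) \<in> Z}" by (rule closure_minimal[OF _ cl])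
  moreover have "(1::real) \<in> closure {0..<1}" by simp
  ultimately have "1 \<in> {t \<in> {0..1}. (\<lambda>i. t * v i) \<in> Z}" by blast
  then show "v \<in> Z" by simp
qed

section \<open>Characteristic maps on D^k x G/K and their restrictions to D^k\<close>

context compact_topological_group
begin

lemma coset_self: "K \<subseteq> carrier G \<Longrightarrow> \<one> <# K = K"
  by (rule lcos_mult_one)

lemma coset_translate: "K \<subseteq> carrier G \<Longrightarrow> g \<in> carrier G \<Longrightarrow> a \<in> carrier G \<Longrightarrow> g <# (a <# K) = (g \<otimes> a) <# K"
  by (rule lcos_m_assoc)

lemma coset_eq_iff:
  assumes K: "subgroup K G" and "a \<in> carrier G" "b \<in> carrier G"
  shows "a <# K = b <# K \<longleftrightarrow> inv b \<otimes> a \<in> K"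
proof
  assume eq: "a <# K = b <# K"
  have "a \<otimes> \<one> \<in> a <# K" using subgroup.one_closed[OF K] by (auto simp: l_coset_def)
  then obtain k where k: "k \<in> K" "a = b \<otimes> k" using assms eq by (auto simp: l_coset_def)
  then have "inv b \<otimes> a = k" using assms subgroup.mem_carrier[OF K] by (simp add: m_assoc[symmetric])
  then show "inv b \<otimes> a \<in> K" using k by simp
next
  assume k: "inv b \<otimes> a \<in> K"
  have "a = b \<otimes> (inv b \<otimes> a)" using assms by (simp add: m_assoc[symmetric])
  then have "a \<in> b <# K" using k unfolding l_coset_def by blast
  then show "a <# K = b <# K" using l_repr_independence[OF _ assms(3) K] by simp
qed

lemma topspace_coset_space: "topspace (coset_space G T K) = (\<lambda>a. a <# K) ` carrier G"
  by (simp add: coset_space_def topspace_quot_topology topspace_group)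

lemma cell_space_eq:
  "cell_space G T k m K = sum_topology (\<lambda>j. prod_topology (disk_space k) (coset_space G T (K j))) {..<m}"
  by (simp add: cell_space_def disk_space_def)

lemma topspace_cell_space:
  "topspace (cell_space G T k m K) = {(j, v, D). j < m \<and> v \<in> closed_disk k \<and> D \<in> (\<lambda>a. a <# K j) ` carrier G}"
  by (auto simp: cell_space_eq topspace_coset_space)

lemma compact_cell_space: "compact_space (cell_space G T k m K)"
proof -
  have "compact_space (coset_space G T L)" for L
  proof -
    have "quotient_map T (coset_space G T L) (\<lambda>a. a <# L)"
      unfolding coset_space_def by (rule quotient_map_quot_topology)
    then show ?thesis
      using compact_group image_compactin[of T "topspace T" "coset_space G T L"]
      by (metis compact_space_def quotient_imp_continuous_map quotient_imp_surjective_map)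
  qed
  then show ?thesis unfolding cell_space_eq
    by (intro compact_space_sum_topology) (auto simp: compact_space_prod_topology compact_disk_space)
qed

text \<open>Equivariance recovers \<open>\<Phi>\<close> from its restriction to the trivial coset,
  and injectivity of \<open>\<Phi>\<close> on the interiors becomes the statement that a translate
  of an open cell returns to the cells only by elements of its type.\<close>

lemma attaches_cells_orbits:
  assumes a: "attaches_cells G T X B C k m K \<Phi>" and BC: "B \<subseteq> C" "C \<subseteq> topspace (gtop X)"
    and X: "pointed_gspace G T X"
  shows "attaches_orbits G T X B C k m K (\<lambda>j v. \<Phi> (j, v, K j))"
    and "j < m \<Longrightarrow> \<Phi> ` ({j} \<times> open_disk k \<times> topspace (coset_space G T (K j))) =
           sweep G X ((\<lambda>v. \<Phi> (j, v, K j)) ` open_disk k)"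
proof -
  let ?f = "\<lambda>j v. \<Phi> (j, v, K j)"
  let ?CS = "cell_space G T k m K"
  have oc: "open_disk k \<subseteq> closed_disk k" "bd_sphere k \<subseteq> closed_disk k"
    using closed_disk_split(1)[of k] by auto
  have K: "closed_subgroup G T (K j)" if "j < m" for j using a that by (simp add: attaches_cells_def)
  have Ks: "subgroup (K j) G" and Kc: "K j \<subseteq> carrier G" if "j < m" for j
    using K[OF that] by (auto simp: closed_subgroup_def dest: subgroup.subset)
  have Kin: "K j \<in> (\<lambda>a. a <# K j) ` carrier G" if "j < m" for j
    using coset_self[OF Kc[OF that]] by (metis imageI one_closed)
  have Phic: "continuous_map ?CS (subtopology (gtop X) C) \<Phi>" using a by (simp add: attaches_cells_def)
  have eqv: "\<Phi> (j, v, g <# K j) = gact X g (?f j v)" if "g \<in> carrier G" "j < m" "v \<in> closed_disk k" for g j v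
  proof -
    have "\<forall>(j, v, D)\<in>topspace ?CS. \<Phi> (j, v, g <# D) = gact X g (\<Phi> (j, v, D))"
      using a that(1) by (simp add: attaches_cells_def)
    moreover have "(j, v, K j) \<in> topspace ?CS" using that Kin by (auto simp: topspace_cell_space)
    ultimately show ?thesis by auto
  qed
  have bd: "\<Phi> (j, v, D) \<in> B" if "(j, v, D) \<in> topspace ?CS" "v \<in> bd_sphere k" for j v D
    using a that unfolding attaches_cells_def by blast
  have hom: "homeomorphic_map (subtopology ?CS {(j, v, D). v \<in> open_disk k}) (subtopology (gtop X) (C - B)) \<Phi>"
    using a by (simp add: attaches_cells_def)
  let ?O = "{(j, v, D). j < m \<and> v \<in> open_disk k \<and> D \<in> (\<lambda>a. a <# K j) ` carrier G}"
  have tO: "topspace (subtopology ?CS {(j, v, D). v \<in> open_disk k}) = ?O"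
    using oc by (auto simp: topspace_cell_space)
  have inj: "inj_on \<Phi> ?O" using homeomorphic_imp_injective_map[OF hom] unfolding tO .
  have im: "\<Phi> ` ?O = C - B" using homeomorphic_imp_surjective_map[OF hom] BC unfolding tO by auto
  have sw: "\<Phi> ` ({j} \<times> open_disk k \<times> topspace (coset_space G T (K j))) = sweep G X (?f j ` open_disk k)"
    if "j < m" for j
  proof (rule subset_antisym; rule subsetI)
    fix x assume "x \<in> \<Phi> ` ({j} \<times> open_disk k \<times> topspace (coset_space G T (K j)))"
    then obtain v g where "v \<in> open_disk k" "g \<in> carrier G" "x = \<Phi> (j, v, g <# K j)"
      by (auto simp: topspace_coset_space)
    then show "x \<in> sweep G X (?f j ` open_disk k)"
      using eqv[of g j v] that oc by (auto simp: sweep_def intro!: image_eqI[of _ _ "(g, ?f j v)"])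
  next
    fix x assume "x \<in> sweep G X (?f j ` open_disk k)"
    then obtain v g where vg: "v \<in> open_disk k" "g \<in> carrier G" "x = gact X g (?f j v)"
      by (auto simp: sweep_def)
    then have "x = \<Phi> (j, v, g <# K j)" using eqv[of g j v] that oc by auto
    then show "x \<in> \<Phi> ` ({j} \<times> open_disk k \<times> topspace (coset_space G T (K j)))"
      using vg by (auto simp: topspace_coset_space)
  qed
  show "j < m \<Longrightarrow> \<Phi> ` ({j} \<times> open_disk k \<times> topspace (coset_space G T (K j))) =
           sweep G X (?f j ` open_disk k)" by (rule sw)
  have "?O = (\<Union>j<m. {j} \<times> open_disk k \<times> topspace (coset_space G T (K j)))"
    by (auto simp: topspace_coset_space)
  then have "C - B = (\<Union>j<m. sweep G X (?f j ` open_disk k))"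
    using im sw by (simp add: image_UN)
  then have C: "C = B \<union> (\<Union>j<m. sweep G X (?f j ` open_disk k))" using BC by blast
  have cont: "continuous_map (disk_space k) (gtop X) (?f j)" if "j < m" for j
  proof -
    have "K j \<in> topspace (coset_space G T (K j))" using Kin[OF that] by (simp add: topspace_coset_space)
    then have "continuous_map (disk_space k) (prod_topology (disk_space k) (coset_space G T (K j))) (\<lambda>v. (v, K j))"
      by (intro continuous_map_pairedI) (auto simp: continuous_map_id[unfolded id_def])
    moreover have "continuous_map (prod_topology (disk_space k) (coset_space G T (K j))) ?CS (\<lambda>x. (j, x))"
      unfolding cell_space_eq using that by (intro continuous_map_component_injection) auto
    ultimately have "continuous_map (disk_space k) ?CS (\<lambda>v. (j, v, K j))"
      using continuous_map_compose by (fastforce simp: o_def)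
    from continuous_map_compose[OF this Phic] show ?thesis
      by (simp add: o_def continuous_map_in_subtopology)
  qed
  show "attaches_orbits G T X B C k m K ?f"
    unfolding attaches_orbits_def
  proof (intro conjI allI ballI impI C)
    fix j assume j: "j < m"
    show "closed_subgroup G T (K j)" by (rule K[OF j])
    show "continuous_map (disk_space k) (gtop X) (?f j)" by (rule cont[OF j])
    show "?f j ` bd_sphere k \<subseteq> B" using bd Kin[OF j] j oc by (auto simp: topspace_cell_space)
    show "?f j ` open_disk k \<inter> B = {}" using im Kin[OF j] j by blast
    fix v g assume v: "v \<in> closed_disk k" and g: "g \<in> K j"
    have "g <# K j = \<one> <# K j" using coset_eq_iff[OF Ks[OF j], of g \<one>] g Kc[OF j] by auto
    then show "gact X g (?f j v) = ?f j v"
      using eqv[of g j v] v g j Kc[OF j] coset_self[OF Kc[OF j]] by auto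
  next
    fix i j v w g assume h: "i < m" "j < m" "v \<in> open_disk k" "w \<in> open_disk k" "g \<in> carrier G"
      "gact X g (?f i v) = ?f j w"
    then have "\<Phi> (i, v, g <# K i) = \<Phi> (j, w, K j)" using eqv oc by auto
    then have "(i, v, g <# K i) = (j, w, K j)" using inj h Kin by (intro inj_onD[OF inj]) auto
    then have ij: "i = j" "v = w" "g <# K i = K i" by auto
    then have "g <# K i = \<one> <# K i" using coset_self[OF Kc[OF h(1)]] by simp
    then have "g \<in> K i" using coset_eq_iff[OF Ks[OF h(1)], of g \<one>] h(5) by simp
    then show "i = j" "v = w" "g \<in> K i" using ij by auto
  qed
qed

text \<open>The converse reconstruction. Continuity is tested on D^k x G, which a quotient map sends
  onto D^k x G/K; the homeomorphism on the interiors comes from compactness, since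
  \<open>\<Phi>\<close> is a closed map into a Hausdorff space.\<close>

lemma attaches_cells_exists:
  assumes a: "attaches_orbits G T X B C k m K f" and X: "pointed_gspace G T X"
    and haus: "Hausdorff_space (gtop X)" and C: "C \<subseteq> topspace (gtop X)"
    and B: "\<And>g x. g \<in> carrier G \<Longrightarrow> x \<in> B \<Longrightarrow> gact X g x \<in> B"
  shows "\<exists>\<Phi>. attaches_cells G T X B C k m K \<Phi>"
proof -
  note aD = attaches_orbitsD[OF a]
  \<comment> \<open>A coset acts through some representative; which one does not matter, because
    \<open>K j\<close> fixes \<open>f j v\<close>.\<close>
  define \<Phi> where "\<Phi> = (\<lambda>(j, v, D). gact X (SOME a. a \<in> carrier G \<and> D = a <# K j) (f j v))"
  let ?CS = "cell_space G T k m K"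
  have oc: "open_disk k \<subseteq> closed_disk k" "bd_sphere k \<subseteq> closed_disk k"
    using closed_disk_split(1)[of k] by auto
  have Ks: "subgroup (K j) G" and Kc: "K j \<subseteq> carrier G" if "j < m" for j
    using aD(1)[OF that] by (auto simp: closed_subgroup_def dest: subgroup.subset)
  have ft: "f j v \<in> topspace (gtop X)" if "j < m" "v \<in> closed_disk k" for j v
    using continuous_map_image_subset_topspace[OF aD(2)[OF that(1)]] that by auto
  have Phi: "\<Phi> (j, v, b <# K j) = gact X b (f j v)" if j: "j < m" and v: "v \<in> closed_disk k" and b: "b \<in> carrier G" for j v b
  proof -
    define c where "c = (SOME a. a \<in> carrier G \<and> b <# K j = a <# K j)"
    have "c \<in> carrier G \<and> b <# K j = c <# K j"
      unfolding c_def by (rule someI[of _ b]) (use b in simp)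
    then have c: "c \<in> carrier G" "inv b \<otimes> c \<in> K j" using coset_eq_iff[OF Ks[OF j], of c b] b by auto
    have "gact X c (f j v) = gact X b (gact X (inv b \<otimes> c) (f j v))"
      using gspaceD(2)[OF X ft[OF j v], of b "inv b \<otimes> c"] b c by (simp add: m_assoc[symmetric])
    also have "gact X (inv b \<otimes> c) (f j v) = f j v" by (rule aD(3)[OF j v c(2)])
    finally show ?thesis by (simp add: \<Phi>_def c_def)
  qed
  have cells: "sweep G X (f j ` open_disk k) \<subseteq> C" if "j < m" for j
    using a that unfolding attaches_orbits_def by blast
  have BC: "B \<subseteq> C" using a unfolding attaches_orbits_def by blast
  have PhiB: "gact X g (f j v) \<in> B" if "j < m" "v \<in> bd_sphere k" "g \<in> carrier G" for j v g
    using aD(4)[OF that(1)] B that by auto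
  have PhinB: "gact X g (f j v) \<in> C - B" if j: "j < m" and v: "v \<in> open_disk k" and g: "g \<in> carrier G" for j v g
  proof
    show "gact X g (f j v) \<in> C"
      using cells[OF j] v g by (auto simp: sweep_def image_subset_iff)
    show "gact X g (f j v) \<notin> B"
    proof
      assume "gact X g (f j v) \<in> B"
      then have "gact X (inv g) (gact X g (f j v)) \<in> B" using B g by simp
      moreover have "v \<in> closed_disk k" using v oc by auto
      ultimately have "f j v \<in> B" using gact_inv(1)[OF X ft[OF j] g] by simp
      then show False using v aD(5)[OF j] by auto
    qed
  qed
  have PhiC: "gact X g (f j v) \<in> C" if "j < m" "v \<in> closed_disk k" "g \<in> carrier G" for j v g
    using PhiB PhinB BC that closed_disk_split(1)[of k] by blast
  have contX: "continuous_map ?CS (gtop X) \<Phi>"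
    unfolding cell_space_eq
  proof (rule continuous_map_from_sum_topology)
    fix j assume "j \<in> {..<m}"
    then have j: "j < m" by simp
    have "quotient_map T (coset_space G T (K j)) (\<lambda>a. a <# K j)"
      unfolding coset_space_def by (rule quotient_map_quot_topology)
    then have q: "quotient_map (prod_topology (disk_space k) T) (prod_topology (disk_space k) (coset_space G T (K j)))
        (\<lambda>(v, a). (v, a <# K j))"
      by (intro quotient_map_prod_right)
        (auto simp: compact_imp_locally_compact_space compact_disk_space Hausdorff_disk_space)
    have "continuous_map (prod_topology (disk_space k) T) (gtop X) (\<lambda>x. gact X (snd x) (f j (fst x)))"
      using continuous_map_compose[OF continuous_map_fst aD(2)[OF j]]
      by (intro continuous_gact[OF X] continuous_map_snd) (auto simp: o_def)
    then have "continuous_map (prod_topology (disk_space k) T) (gtop X) ((\<lambda>x. \<Phi> (j, x)) \<circ> (\<lambda>(v, a). (v, a <# K j)))"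
      by (rule continuous_map_eq) (auto simp: Phi[OF j] topspace_group)
    then show "continuous_map (prod_topology (disk_space k) (coset_space G T (K j))) (gtop X) (\<lambda>x. \<Phi> (j, x))"
      by (rule continuous_compose_quotient_map[OF q])
  qed
  have PC: "\<Phi> x \<in> C" if "x \<in> topspace ?CS" for x
    using that PhiC by (auto simp: topspace_cell_space Phi)
  then have cont: "continuous_map ?CS (subtopology (gtop X) C) \<Phi>"
    using contX by (auto simp: continuous_map_in_subtopology)
  let ?O = "{(j, v, D). v \<in> open_disk k}"
  \<comment> \<open>Boundary spheres go into \<open>B\<close> and open cells avoid it, so the
    interiors are a full preimage; closed maps restrict to full preimages.\<close>
  have pre: "{x \<in> topspace ?CS. \<Phi> x \<in> C - B} = topspace ?CS \<inter> ?O"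
  proof (rule subset_antisym; rule subsetI)
    fix x assume "x \<in> {x \<in> topspace ?CS. \<Phi> x \<in> C - B}"
    then obtain j v g where x: "x = (j, v, g <# K j)" "j < m" "v \<in> closed_disk k" "g \<in> carrier G"
      "\<Phi> x \<notin> B" "x \<in> topspace ?CS" by (auto simp: topspace_cell_space)
    then have "v \<notin> bd_sphere k" using PhiB Phi by auto
    then show "x \<in> topspace ?CS \<inter> ?O" using x closed_disk_split(1)[of k] by auto
  next
    fix x assume "x \<in> topspace ?CS \<inter> ?O"
    then obtain j v g where x: "x = (j, v, g <# K j)" "j < m" "v \<in> closed_disk k" "g \<in> carrier G"
      "v \<in> open_disk k" "x \<in> topspace ?CS" by (auto simp: topspace_cell_space)
    then show "x \<in> {x \<in> topspace ?CS. \<Phi> x \<in> C - B}" using PhinB[of j v g] Phi[of j v g] by auto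
  qed
  have hom: "homeomorphic_map (subtopology ?CS ?O) (subtopology (gtop X) (C - B)) \<Phi>"
  proof (rule bijective_closed_imp_homeomorphic_map)
    have sub: "subtopology ?CS (topspace ?CS \<inter> ?O) = subtopology ?CS ?O" by (simp add: subtopology_restrict)
    have "closed_map ?CS (gtop X) \<Phi>" by (rule continuous_imp_closed_map[OF contX compact_cell_space haus])
    then show "closed_map (subtopology ?CS ?O) (subtopology (gtop X) (C - B)) \<Phi>"
      using closed_map_restriction[OF _ pre] sub by metis
    show "continuous_map (subtopology ?CS ?O) (subtopology (gtop X) (C - B)) \<Phi>"
      using contX pre by (auto simp: continuous_map_in_subtopology continuous_map_from_subtopology)
    show "\<Phi> ` topspace (subtopology ?CS ?O) = topspace (subtopology (gtop X) (C - B))"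
    proof (rule subset_antisym; rule subsetI)
      fix y assume "y \<in> \<Phi> ` topspace (subtopology ?CS ?O)"
      then show "y \<in> topspace (subtopology (gtop X) (C - B))" using pre C by auto
    next
      fix y assume "y \<in> topspace (subtopology (gtop X) (C - B))"
      then have "y \<in> C" "y \<notin> B" by auto
      then obtain j v g where y: "j < m" "v \<in> open_disk k" "g \<in> carrier G" "y = gact X g (f j v)"
        using a unfolding attaches_orbits_def by (auto simp: sweep_def)
      then have "y = \<Phi> (j, v, g <# K j)" using Phi oc by auto
      then show "y \<in> \<Phi> ` topspace (subtopology ?CS ?O)"
        using y oc by (auto simp: topspace_cell_space)
    qed
    show "inj_on \<Phi> (topspace (subtopology ?CS ?O))"
    proof (rule inj_onI)
      fix x y assume xy: "x \<in> topspace (subtopology ?CS ?O)" "y \<in> topspace (subtopology ?CS ?O)" "\<Phi> x = \<Phi> y"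
      obtain i v g where x: "x = (i, v, g <# K i)" "i < m" "v \<in> open_disk k" "g \<in> carrier G"
        using xy(1) by (auto simp: topspace_cell_space)
      obtain j w h where y: "y = (j, w, h <# K j)" "j < m" "w \<in> open_disk k" "h \<in> carrier G"
        using xy(2) by (auto simp: topspace_cell_space)
      have vc: "v \<in> closed_disk k" "w \<in> closed_disk k" using x y oc by auto
      have "gact X g (f i v) = gact X h (f j w)" using xy(3) x y Phi vc by simp
      then have "gact X (inv h \<otimes> g) (f i v) = f j w"
        using gspaceD(2)[OF X ft[OF x(2) vc(1)], of "inv h" g] gact_inv[OF X ft[OF y(2) vc(2)] y(4)] x y by simp
      then have "i = j \<and> v = w \<and> inv h \<otimes> g \<in> K i"
        by (rule aD(6)[OF y(2) x(2) x(3) y(3), rotated]) (use x(4) y(4) in simp)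
      then show "x = y" using x(1) y(1) coset_eq_iff[OF Ks[OF x(2)] x(4) y(4)] by auto
    qed
  qed
  have "attaches_cells G T X B C k m K \<Phi>"
    unfolding attaches_cells_def
  proof (intro conjI ballI allI impI)
    fix j assume "j < m" then show "closed_subgroup G T (K j)" by (rule aD(1))
  next
    fix g x assume g: "g \<in> carrier G" and x: "x \<in> topspace ?CS"
    obtain j v b where xe: "x = (j, v, b <# K j)" "j < m" "v \<in> closed_disk k" "b \<in> carrier G"
      using x by (auto simp: topspace_cell_space)
    have "g <# (b <# K j) = (g \<otimes> b) <# K j" using coset_translate Kc xe g by simp
    then show "case x of (j, v, D) \<Rightarrow> \<Phi> (j, v, g <# D) = gact X g (\<Phi> (j, v, D))"
      using Phi xe g gspaceD(2)[OF X ft[OF xe(2,3)] g xe(4)] by simp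
  next
    fix x assume "x \<in> topspace ?CS"
    then show "case x of (j, v, D) \<Rightarrow> v \<in> bd_sphere k \<longrightarrow> \<Phi> (j, v, D) \<in> B"
      using PhiB Phi oc by (auto simp: topspace_cell_space)
  qed (use cont hom in auto)
  then show ?thesis by blast
qed

text \<open>The cells of one dimension are attached one after the other; injectivity across
  different cells keeps each of them disjoint from its predecessors.\<close>

lemma gcell_built_attach:
  assumes b: "gcell_built G T H X B c" and a: "attaches_orbits G T X B C k m K f"
    and X: "pointed_gspace G T X"
  shows "gcell_built G T H X C (c + (\<Sum>j<m. cell_weight G H k (K j)))"
proof -
  note aD = attaches_orbitsD[OF a]
  have "gcell_built G T H X (B \<union> (\<Union>j<n. sweep G X (f j ` open_disk k)))
      (c + (\<Sum>j<n. cell_weight G H k (K j)))" if "n \<le> m" for n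
    using that
  proof (induction n)
    case 0
    then show ?case using b by simp
  next
    case (Suc n)
    let ?B = "B \<union> (\<Union>j<n. sweep G X (f j ` open_disk k))"
    have n: "n < m" using Suc by simp
    have "gcell_built G T H X (?B \<union> sweep G X (f n ` open_disk k))
        (c + (\<Sum>j<n. cell_weight G H k (K j)) + cell_weight G H k (K n))"
    proof (rule gcell_built.cell)
      show "f n ` open_disk k \<inter> ?B = {}"
      proof -
        have "f n v \<notin> sweep G X (f j ` open_disk k)" if v: "v \<in> open_disk k" and j: "j < n" for j v
        proof
          assume "f n v \<in> sweep G X (f j ` open_disk k)"
          then obtain g w where gw: "g \<in> carrier G" "w \<in> open_disk k" "gact X g (f j w) = f n v"
            by (auto simp: sweep_def)
          then have "j = n" using aD(6)[OF n, of j w v g] j n v by simp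
          then show False using j by simp
        qed
        then show ?thesis using aD(5)[OF n] by auto
      qed
    qed (use Suc n aD(1-4)[OF n] aD(6)[OF n n] in auto)
    moreover have "?B \<union> sweep G X (f n ` open_disk k) = B \<union> (\<Union>j<Suc n. sweep G X (f j ` open_disk k))"
      by (auto simp: less_Suc_eq)
    ultimately show ?case by (simp add: add.assoc)
  qed
  from this[of m] show ?thesis using a unfolding attaches_orbits_def by simp
qed

end

section \<open>Subcomplexes and quotient complexes\<close>

text \<open>The set to which the \<open>k\<close>-cells are attached. Starting with the base point
  lets cells of dimension 0 be treated like all others.\<close>

definition gstage :: "('g, 'x) gspace \<Rightarrow> (nat \<Rightarrow> 'x set) \<Rightarrow> nat \<Rightarrow> 'x set" where
  "gstage X Xs k = (if k = 0 then {gbase X} else Xs (k - 1))"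

definition gcw_orbits ::
    "('g, 'b) monoid_scheme \<Rightarrow> 'g topology \<Rightarrow> ('g, 'x) gspace \<Rightarrow> nat \<Rightarrow> (nat \<Rightarrow> 'x set) \<Rightarrow>
     (nat \<Rightarrow> nat) \<Rightarrow> (nat \<Rightarrow> nat \<Rightarrow> 'g set) \<Rightarrow> (nat \<Rightarrow> nat \<Rightarrow> (nat \<Rightarrow> real) \<Rightarrow> 'x) \<Rightarrow> bool" where
  "gcw_orbits G T X p Xs m K f \<longleftrightarrow>
     pointed_gspace G T X \<and> Hausdorff_space (gtop X) \<and> Xs p = topspace (gtop X) \<and>
     (\<forall>k\<le>p. attaches_orbits G T X (gstage X Xs k) (Xs k) k (m k) (K k) (f k))"

definition gcell :: "('g, 'b) monoid_scheme \<Rightarrow> ('g, 'x) gspace \<Rightarrow>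
    (nat \<Rightarrow> nat \<Rightarrow> (nat \<Rightarrow> real) \<Rightarrow> 'x) \<Rightarrow> nat \<Rightarrow> nat \<Rightarrow> 'x set" where
  "gcell G X f k j = sweep G X (f k j ` open_disk k)"

lemma gcw_structure_mono:
  assumes "gcw_structure G T X p Xs m K \<Phi>" "i \<le> k" "k \<le> p"
  shows "Xs i \<subseteq> Xs k"
  using assms(2,3)
proof (induction k)
  case (Suc k)
  have "Xs k \<subseteq> Xs (Suc k)" using assms(1) Suc.prems by (simp add: gcw_structure_def)
  then show ?case using Suc by (cases "i = Suc k") auto
qed simp

context compact_topological_group
begin

lemma gcw_structure_orbits:
  assumes s: "gcw_structure G T X p Xs m K \<Phi>"
  defines "f \<equiv> \<lambda>k j v. \<Phi> k (j, v, K k j)"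
  shows "gcw_orbits G T X p Xs m K f"
    and "k \<le> p \<Longrightarrow> j < m k \<Longrightarrow>
      \<Phi> k ` ({j} \<times> open_disk k \<times> topspace (coset_space G T (K k j))) = gcell G X f k j"
proof -
  have X: "pointed_gspace G T X" and top: "Xs p = topspace (gtop X)" and haus: "Hausdorff_space (gtop X)"
    using s by (auto simp: gcw_structure_def)
  have sub: "Xs k \<subseteq> topspace (gtop X)" if "k \<le> p" for k
    using gcw_structure_mono[OF s that order_refl] top by simp
  have a: "attaches_cells G T X (gstage X Xs k) (Xs k) k (m k) (K k) (\<Phi> k)" if "k \<le> p" for k
    using s that by (cases k) (auto simp: gcw_structure_def gstage_def)
  have BC: "gstage X Xs k \<subseteq> Xs k" if "k \<le> p" for k
    using s that gcw_structure_mono[OF s _ that, of "k - 1"] by (auto simp: gstage_def gcw_structure_def)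
  show "gcw_orbits G T X p Xs m K f"
    unfolding gcw_orbits_def f_def
    using X top haus attaches_cells_orbits(1)[OF a BC sub X] by simp
  show "k \<le> p \<Longrightarrow> j < m k \<Longrightarrow>
      \<Phi> k ` ({j} \<times> open_disk k \<times> topspace (coset_space G T (K k j))) = gcell G X f k j"
    unfolding gcell_def f_def using attaches_cells_orbits(2)[OF a BC sub X] by blast
qed

lemma gcw_orbits_attaches:
  "gcw_orbits G T X p Xs m K f \<Longrightarrow> k \<le> p \<Longrightarrow>
    attaches_orbits G T X (gstage X Xs k) (Xs k) k (m k) (K k) (f k)"
  by (simp add: gcw_orbits_def)

lemma gcw_orbits_built:
  assumes s: "gcw_orbits G T X p Xs m K f" and "k \<le> p"
  shows "gcell_built G T H X (Xs k) (\<Sum>i\<le>k. \<Sum>j<m i. cell_weight G H i (K i j))"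
  using assms(2)
proof (induction k)
  case 0
  have X: "pointed_gspace G T X" using s by (simp add: gcw_orbits_def)
  have "attaches_orbits G T X {gbase X} (Xs 0) 0 (m 0) (K 0) (f 0)"
    using gcw_orbits_attaches[OF s, of 0] by (simp add: gstage_def)
  from gcell_built_attach[OF gcell_built.base this X] show ?case by simp
next
  case (Suc k)
  have X: "pointed_gspace G T X" using s by (simp add: gcw_orbits_def)
  have "attaches_orbits G T X (Xs k) (Xs (Suc k)) (Suc k) (m (Suc k)) (K (Suc k)) (f (Suc k))"
    using gcw_orbits_attaches[OF s, of "Suc k"] Suc.prems by (simp add: gstage_def)
  from gcell_built_attach[OF Suc.IH this X] Suc.prems show ?case by simp
qed

lemma gcw_orbits_filtration:
  assumes s: "gcw_orbits G T X p Xs m K f" and "k \<le> p"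
  shows "Xs k = {gbase X} \<union> (\<Union>i\<in>{..k}. \<Union>j\<in>{..<m i}. gcell G X f i j)"
  using assms(2)
proof (induction k)
  case 0
  then show ?case using gcw_orbits_attaches[OF s, of 0]
    by (simp add: gstage_def attaches_orbits_def gcell_def)
next
  case (Suc k)
  have "Xs (Suc k) = Xs k \<union> (\<Union>j<m (Suc k). gcell G X f (Suc k) j)"
    using gcw_orbits_attaches[OF s, of "Suc k"] Suc.prems by (simp add: gstage_def attaches_orbits_def gcell_def)
  then show ?case using Suc by (simp add: atMost_Suc Un_ac)
qed

lemma gcw_orbits_stage:
  assumes s: "gcw_orbits G T X p Xs m K f" and "k \<le> p"
  shows "gstage X Xs k = {gbase X} \<union> (\<Union>i\<in>{..<k}. \<Union>j\<in>{..<m i}. gcell G X f i j)"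
proof (cases k)
  case (Suc l)
  then show ?thesis using gcw_orbits_filtration[OF s, of l] assms(2)
    by (simp add: gstage_def lessThan_Suc_atMost)
qed (simp add: gstage_def)

lemma gcw_orbits_stage_invariant:
  assumes s: "gcw_orbits G T X p Xs m K f" and "k \<le> p" and "g \<in> carrier G" "x \<in> gstage X Xs k"
  shows "gact X g x \<in> gstage X Xs k"
proof -
  have X: "pointed_gspace G T X" using s by (simp add: gcw_orbits_def)
  show ?thesis
  proof (cases k)
    case 0
    then show ?thesis using assms X by (auto simp: gstage_def pointed_gspace_def)
  next
    case (Suc l)
    then show ?thesis
      using gcell_built_compactin[OF X gcw_orbits_built[OF s, of l]] assms by (simp add: gstage_def)
  qed
qed

lemma gcw_orbits_subset:
  assumes s: "gcw_orbits G T X p Xs m K f" and "k \<le> p"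
  shows "Xs k \<subseteq> topspace (gtop X)"
proof -
  have "Xs k \<subseteq> Xs p"
    unfolding gcw_orbits_filtration[OF s assms(2)] gcw_orbits_filtration[OF s order_refl] using assms(2) by force
  then show ?thesis using s by (simp add: gcw_orbits_def)
qed

lemma gcw_orbits_in:
  assumes s: "gcw_orbits G T X p Xs m K f" and "k \<le> p" "j < m k" "v \<in> closed_disk k"
  shows "f k j v \<in> topspace (gtop X)"
  using continuous_map_image_subset_topspace[OF attaches_orbitsD(2)[OF gcw_orbits_attaches[OF s assms(2)] assms(3)]]
    assms(4) by auto

lemma gcell_stage_disjoint:
  assumes s: "gcw_orbits G T X p Xs m K f" and k: "k \<le> p" "j < m k"
  shows "gcell G X f k j \<inter> gstage X Xs k = {}"
proof (rule ccontr)
  have X: "pointed_gspace G T X" using s by (simp add: gcw_orbits_def)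
  assume "\<not> ?thesis"
  then obtain g v where gv: "g \<in> carrier G" "v \<in> open_disk k" "gact X g (f k j v) \<in> gstage X Xs k"
    by (auto simp: gcell_def sweep_def)
  have vc: "v \<in> closed_disk k" using gv closed_disk_split(1)[of k] by auto
  have "gact X (inv g) (gact X g (f k j v)) \<in> gstage X Xs k"
    using gcw_orbits_stage_invariant[OF s k(1) _ gv(3)] gv(1) by simp
  then have "f k j v \<in> gstage X Xs k" using gact_inv(1)[OF X gcw_orbits_in[OF s k vc] gv(1)] by simp
  then show False using attaches_orbitsD(5)[OF gcw_orbits_attaches[OF s k(1)] k(2)] gv(2) by auto
qed

text \<open>A cell of lower dimension lies in the stage that the higher cell avoids; in equal
  dimension the attaching data separate the translates.\<close>

lemma gcell_disjoint:
  assumes s: "gcw_orbits G T X p Xs m K f" and k: "k \<le> p" "j < m k" and i: "i \<le> p" "l < m i"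
    and x: "x \<in> gcell G X f k j" "x \<in> gcell G X f i l"
  shows "k = i \<and> j = l"
proof -
  have X: "pointed_gspace G T X" using s by (simp add: gcw_orbits_def)
  have *: "\<not> i < k" if k: "k \<le> p" "j < m k" and i: "i \<le> p" "l < m i"
    and x: "x \<in> gcell G X f k j" "x \<in> gcell G X f i l" for k j i l
  proof
    assume "i < k"
    then have "x \<in> gstage X Xs k" unfolding gcw_orbits_stage[OF s k(1)] using x(2) i(2) by blast
    then show False using gcell_stage_disjoint[OF s k] x(1) by blast
  qed
  have eq: "k = i" using *[OF k i x] *[OF i k x(2,1)] by simp
  obtain g v where gv: "g \<in> carrier G" "v \<in> open_disk k" "x = gact X g (f k j v)"
    using x(1) by (auto simp: gcell_def sweep_def)
  obtain h w where hw: "h \<in> carrier G" "w \<in> open_disk k" "x = gact X h (f k l w)"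
    using x(2) eq by (auto simp: gcell_def sweep_def)
  have vc: "v \<in> closed_disk k" "w \<in> closed_disk k" using gv hw closed_disk_split(1)[of k] by auto
  have l: "l < m k" using i eq by simp
  have "gact X (inv h \<otimes> g) (f k j v) = f k l w"
    using gspaceD(2)[OF X gcw_orbits_in[OF s k vc(1)], of "inv h" g] gact_inv(1)[OF X gcw_orbits_in[OF s k(1) l vc(2)] hw(1)]
      gv hw by simp
  then have "j = l \<and> v = w \<and> inv h \<otimes> g \<in> K k j"
    by (rule attaches_orbitsD(6)[OF gcw_orbits_attaches[OF s k(1)] l k(2) gv(2) hw(2), rotated]) (use gv hw in simp)
  then show ?thesis using eq by simp
qed

text \<open>What the cells do not show directly is that the base point is isolated in
  \<open>Xs 0\<close>: the finitely many orbits of dimension 0 are compact, hence closed, and they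
  miss the base point.\<close>

lemma gcw_structure_exists:
  assumes s: "gcw_orbits G T X p Xs m K f"
  shows "\<exists>\<Phi>. gcw_structure G T X p Xs m K \<Phi>"
proof -
  have X: "pointed_gspace G T X" and haus: "Hausdorff_space (gtop X)" and top: "Xs p = topspace (gtop X)"
    using s by (auto simp: gcw_orbits_def)
  have "\<forall>k. \<exists>\<Phi>. k \<le> p \<longrightarrow> attaches_cells G T X (gstage X Xs k) (Xs k) k (m k) (K k) \<Phi>"
    using attaches_cells_exists[OF gcw_orbits_attaches[OF s] X haus gcw_orbits_subset[OF s]
        gcw_orbits_stage_invariant[OF s]] by blast
  then obtain \<Phi> where \<Phi>: "\<And>k. k \<le> p \<Longrightarrow> attaches_cells G T X (gstage X Xs k) (Xs k) k (m k) (K k) (\<Phi> k)"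
    unfolding choice_iff by blast
  have Xs0: "Xs 0 = {gbase X} \<union> (\<Union>j\<in>{..<m 0}. gcell G X f 0 j)"
    using gcw_orbits_filtration[OF s, of 0] by simp
  have "closedin (gtop X) (gcell G X f 0 j)" if j: "j < m 0" for j
  proof -
    have "open_disk 0 = closed_disk 0" by (auto simp: open_disk_vnorm closed_disk_vnorm vnorm_def)
    then have "compactin (gtop X) (gcell G X f 0 j)"
      unfolding gcell_def
      using compactin_sweep_carrier[OF X compactin_disk_image[OF attaches_orbitsD(2)[OF gcw_orbits_attaches[OF s] j]]]
      by simp
    then show ?thesis using haus by (simp add: compactin_imp_closedin)
  qed
  then have "closedin (gtop X) (\<Union>j\<in>{..<m 0}. gcell G X f 0 j)" by (intro closedin_Union) auto
  then have "openin (gtop X) (topspace (gtop X) - (\<Union>j\<in>{..<m 0}. gcell G X f 0 j))" by auto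
  moreover have "{gbase X} = (topspace (gtop X) - (\<Union>j\<in>{..<m 0}. gcell G X f 0 j)) \<inter> Xs 0"
    unfolding Xs0 using gcell_stage_disjoint[OF s, of 0] gbase_in[OF X] by (auto simp: gstage_def)
  ultimately have iso: "openin (subtopology (gtop X) (Xs 0)) {gbase X}"
    unfolding openin_subtopology by blast
  have mono: "Xs k \<subseteq> Xs (Suc k)" if "k < p" for k
    using gcw_orbits_filtration[OF s, of k] gcw_orbits_filtration[OF s, of "Suc k"] that by (auto simp: atMost_Suc)
  have "gcw_structure G T X p Xs m K \<Phi>"
    unfolding gcw_structure_def
    using X haus iso mono top Xs0 \<Phi>[of 0] \<Phi>[of "Suc k" for k]
    by (auto simp: gstage_def Suc_le_eq)
  then show ?thesis by blast
qed

text \<open>A set \<open>S\<close> of cells of \<open>X\<close> that is carried injectively into \<open>Y\<close> by \<open>r\<close> makes \<open>Y\<close> a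
  G-CW-complex. The map \<open>r\<close> is the identity for a subcomplex, and the projection for a quotient.\<close>

lemma gcw_orbits_transfer:
  assumes s: "gcw_orbits G T X p Xs m K f"
    and S: "S \<subseteq> {(k, j). k \<le> p \<and> j < m k}"
    and Y: "pointed_gspace G T Y" "Hausdorff_space (gtop Y)"
    and rb: "r (gbase X) = gbase Y"
    and rc: "\<And>k j. (k, j) \<in> S \<Longrightarrow> continuous_map (disk_space k) (gtop Y) (\<lambda>v. r (f k j v))"
    and req: "\<And>k j v g. (k, j) \<in> S \<Longrightarrow> v \<in> closed_disk k \<Longrightarrow> g \<in> carrier G \<Longrightarrow>
        r (gact X g (f k j v)) = gact Y g (r (f k j v))"
    and inj: "inj_on r ({gbase X} \<union> (\<Union>(k, j)\<in>S. gcell G X f k j))"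
    and bd: "\<And>k j v. (k, j) \<in> S \<Longrightarrow> v \<in> bd_sphere k \<Longrightarrow>
        r (f k j v) \<in> r ` ({gbase X} \<union> (\<Union>(i, j)\<in>{(i, j) \<in> S. i < k}. gcell G X f i j))"
    and top: "topspace (gtop Y) = r ` ({gbase X} \<union> (\<Union>(k, j)\<in>S. gcell G X f k j))"
  shows "\<exists>Ys m' K' f'. gcw_orbits G T Y p Ys m' K' f' \<and>
     (\<forall>H. (\<Sum>k\<le>p. \<Sum>j<m' k. cell_weight G H k (K' k j)) = (\<Sum>(k, j)\<in>S. cell_weight G H k (K k j)))"
proof -
  let ?U = "{gbase X} \<union> (\<Union>(k, j)\<in>S. gcell G X f k j)"
  \<comment> \<open>A CW structure numbers the cells of each dimension consecutively, so the members
    of \<open>S\<close> of dimension \<open>k\<close> are renumbered by a bijection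
    \<open>\<sigma> k\<close>.\<close>
  define m' where "m' = (\<lambda>k. card (S `` {k}))"
  have fin: "finite (S `` {k})" for k
    by (rule finite_subset[of _ "{..<m k}"]) (use S in auto)
  have "\<forall>k. \<exists>\<sigma>. bij_betw \<sigma> {..<m' k} (S `` {k})"
    unfolding m'_def using ex_bij_betw_nat_finite[OF fin] by (simp add: atLeast0LessThan)
  then obtain \<sigma> where \<sigma>: "\<And>k. bij_betw (\<sigma> k) {..<m' k} (S `` {k})" unfolding choice_iff by blast
  have \<sigma>S: "(k, \<sigma> k n) \<in> S" if "n < m' k" for k n using \<sigma>[of k] that by (auto simp: bij_betw_def)
  have \<sigma>m: "k \<le> p" "\<sigma> k n < m k" if "n < m' k" for k n using \<sigma>S[OF that] S by auto
  have \<sigma>im: "\<exists>n<m' k. \<sigma> k n = j" if "(k, j) \<in> S" for k j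
  proof -
    have "j \<in> \<sigma> k ` {..<m' k}" using \<sigma>[of k] that by (simp add: bij_betw_def)
    then show ?thesis by auto
  qed
  define K' where "K' = (\<lambda>k n. K k (\<sigma> k n))"
  define f' where "f' = (\<lambda>k n v. r (f k (\<sigma> k n) v))"
  \<comment> \<open>The strict bound makes the image of \<open>Us k\<close> the stage to which the
    \<open>k\<close>-cells are attached; the filtration of \<open>Y\<close> therefore uses
    \<open>Us (Suc k)\<close>.\<close>
  define Us where "Us = (\<lambda>k. {gbase X} \<union> (\<Union>(i, j)\<in>{(i, j) \<in> S. i < k}. gcell G X f i j))"
  define Ys where "Ys = (\<lambda>k. r ` Us (Suc k))"
  have UsU: "Us k \<subseteq> ?U" for k by (auto simp: Us_def)
  have stY: "gstage Y Ys k = r ` Us k" for k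
    by (cases k) (auto simp: gstage_def Ys_def Us_def rb)
  have UsX: "Us k \<subseteq> gstage X Xs k" if "k \<le> p" for k
    unfolding gcw_orbits_stage[OF s that] using S by (auto simp: Us_def)
  have sw: "sweep G Y ((\<lambda>v. r (f k j v)) ` open_disk k) = r ` gcell G X f k j" if kj: "(k, j) \<in> S" for k j
  proof -
    have "gact Y g (r (f k j v)) = r (gact X g (f k j v))" if "g \<in> carrier G" "v \<in> open_disk k" for g v
      using req[OF kj _ that(1)] that(2) closed_disk_split(1)[of k] by auto
    then show ?thesis unfolding gcell_def sweep_def by (force simp: image_iff)
  qed
  have cellU: "gact X g (f k j v) \<in> ?U" if "(k, j) \<in> S" "v \<in> open_disk k" "g \<in> carrier G" for k j v g
    using that by (auto simp: gcell_def sweep_def intro!: bexI[of _ "(k, j)"] image_eqI[of _ _ "(g, f k j v)"])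
  have fU: "f k j v \<in> ?U" if kj: "(k, j) \<in> S" and v: "v \<in> open_disk k" for k j v
  proof -
    have X: "pointed_gspace G T X" using s by (simp add: gcw_orbits_def)
    have "f k j v \<in> topspace (gtop X)"
      using gcw_orbits_in[OF s, of k j v] kj S v closed_disk_split(1)[of k] by auto
    then have "gact X \<one> (f k j v) = f k j v" by (rule gspaceD(1)[OF X])
    then show ?thesis using cellU[OF kj v one_closed] by simp
  qed
  have "attaches_orbits G T Y (gstage Y Ys k) (Ys k) k (m' k) (K' k) (f' k)" if k: "k \<le> p" for k
    unfolding attaches_orbits_def
  proof (intro conjI allI impI ballI)
    fix n assume n: "n < m' k"
    note kS = \<sigma>S[OF n]
    note aD = attaches_orbitsD[OF gcw_orbits_attaches[OF s k] \<sigma>m(2)[OF n]]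
    show "closed_subgroup G T (K' k n)" using aD(1) by (simp add: K'_def)
    show "continuous_map (disk_space k) (gtop Y) (f' k n)" using rc[OF kS] by (simp add: f'_def)
    show "f' k n ` bd_sphere k \<subseteq> gstage Y Ys k"
      unfolding stY f'_def Us_def using bd[OF kS] by blast
    show "f' k n ` open_disk k \<inter> gstage Y Ys k = {}"
    proof (rule ccontr)
      assume "\<not> ?thesis"
      then obtain v u where v: "v \<in> open_disk k" "u \<in> Us k" "r (f k (\<sigma> k n) v) = r u"
        unfolding stY f'_def by auto
      then have "f k (\<sigma> k n) v = u"
        using inj_onD[OF inj v(3) fU[OF kS v(1)]] UsU by blast
      then show False using aD(5) v UsX[OF k] by auto
    qed
    fix v g assume v: "v \<in> closed_disk k" and g: "g \<in> K' k n"
    have "g \<in> carrier G" using aD(1) g by (auto simp: K'_def closed_subgroup_def dest: subgroup.mem_carrier)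
    then have "gact Y g (r (f k (\<sigma> k n) v)) = r (gact X g (f k (\<sigma> k n) v))" using req[OF kS v] by simp
    also have "gact X g (f k (\<sigma> k n) v) = f k (\<sigma> k n) v" using aD(3)[OF v] g by (simp add: K'_def)
    finally show "gact Y g (f' k n v) = f' k n v" unfolding f'_def .
  next
    fix n l v w g assume h: "n < m' k" "l < m' k" "v \<in> open_disk k" "w \<in> open_disk k" "g \<in> carrier G"
      "gact Y g (f' k n v) = f' k l w"
    have vc: "v \<in> closed_disk k" using h closed_disk_split(1)[of k] by auto
    have "r (gact X g (f k (\<sigma> k n) v)) = r (f k (\<sigma> k l) w)"
      using h(6) req[OF \<sigma>S[OF h(1)] vc h(5)] by (simp add: f'_def)
    then have "gact X g (f k (\<sigma> k n) v) = f k (\<sigma> k l) w"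
      using inj_onD[OF inj] cellU[OF \<sigma>S[OF h(1)] h(3,5)] fU[OF \<sigma>S[OF h(2)] h(4)] by blast
    then have *: "\<sigma> k n = \<sigma> k l \<and> v = w \<and> g \<in> K k (\<sigma> k n)"
      using attaches_orbitsD(6)[OF gcw_orbits_attaches[OF s k] \<sigma>m(2)[OF h(2)] \<sigma>m(2)[OF h(1)] h(3,4,5)] by blast
    have "inj_on (\<sigma> k) {..<m' k}" using \<sigma>[of k] by (simp add: bij_betw_def)
    then show "n = l" using * h(1,2) by (auto dest: inj_onD)
    show "v = w" "g \<in> K' k n" using * by (auto simp: K'_def)
  next
    have "Us (Suc k) = Us k \<union> (\<Union>n\<in>{..<m' k}. gcell G X f k (\<sigma> k n))"
    proof (rule subset_antisym; rule subsetI)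
      fix x assume "x \<in> Us (Suc k)"
      then show "x \<in> Us k \<union> (\<Union>n\<in>{..<m' k}. gcell G X f k (\<sigma> k n))"
        using \<sigma>im[of k] by (fastforce simp: Us_def less_Suc_eq)
    next
      fix x assume "x \<in> Us k \<union> (\<Union>n\<in>{..<m' k}. gcell G X f k (\<sigma> k n))"
      then show "x \<in> Us (Suc k)" using \<sigma>S[of _ k] by (fastforce simp: Us_def less_Suc_eq)
    qed
    then show "Ys k = gstage Y Ys k \<union> (\<Union>n<m' k. sweep G Y (f' k n ` open_disk k))"
      unfolding stY f'_def using sw[OF \<sigma>S] by (simp add: Ys_def image_Un image_UN)
  qed
  moreover have "Ys p = topspace (gtop Y)"
  proof -
    have "{(i, j) \<in> S. i < Suc p} = S" using S by (auto simp: less_Suc_eq_le)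
    then show ?thesis unfolding Ys_def Us_def top by simp
  qed
  ultimately have 1: "gcw_orbits G T Y p Ys m' K' f'" using Y by (simp add: gcw_orbits_def)
  have "(\<Sum>k\<le>p. \<Sum>j<m' k. cell_weight G H k (K' k j)) = (\<Sum>(k, j)\<in>S. cell_weight G H k (K k j))" for H
  proof -
    have "(\<Sum>j<m' k. cell_weight G H k (K' k j)) = (\<Sum>j\<in>S``{k}. cell_weight G H k (K k j))" for k
      unfolding K'_def by (rule sum.reindex_bij_betw[OF \<sigma>])
    then have "(\<Sum>k\<le>p. \<Sum>j<m' k. cell_weight G H k (K' k j)) = (\<Sum>k\<le>p. \<Sum>j\<in>S``{k}. cell_weight G H k (K k j))"
      by simp
    also have "\<dots> = (\<Sum>(k, j)\<in>(SIGMA k:{..p}. S``{k}). cell_weight G H k (K k j))"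
      by (rule sum.Sigma) (auto simp: fin)
    also have "(SIGMA k:{..p}. S``{k}) = S" using S by auto
    finally show ?thesis .
  qed
  with 1 show ?thesis by blast
qed

section \<open>Subspaces and collapses as G-spaces\<close>

lemma pointed_gspace_gsubspace:
  assumes X: "pointed_gspace G T X" and A: "gbase X \<in> A"
    and inv: "\<And>g x. g \<in> carrier G \<Longrightarrow> x \<in> A \<Longrightarrow> gact X g x \<in> A"
  shows "pointed_gspace G T (gsubspace X A)"
proof -
  have "continuous_map (prod_topology T (gtop X)) (gtop X) (\<lambda>(g, x). gact X g x)"
    using X by (simp add: pointed_gspace_def)
  then have "continuous_map (prod_topology T (subtopology (gtop X) A)) (gtop X) (\<lambda>(g, x). gact X g x)"
    unfolding prod_topology_subtopology by (rule continuous_map_from_subtopology)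
  then have "continuous_map (prod_topology T (subtopology (gtop X) A)) (subtopology (gtop X) A) (\<lambda>(g, x). gact X g x)"
    using inv topspace_group by (auto simp: continuous_map_in_subtopology)
  then show ?thesis using X A by (auto simp: pointed_gspace_def gsubspace_def)
qed

lemma pointed_gspace_gcollapse:
  assumes X: "pointed_gspace G T X" and A: "gbase X \<in> A"
    and inv: "\<And>g x. g \<in> carrier G \<Longrightarrow> x \<in> A \<Longrightarrow> gact X g x \<in> A"
  shows "pointed_gspace G T (gcollapse X A)"
proof -
  let ?q = "\<lambda>x. if x \<in> A then gbase X else x"
  let ?Y = "quot_topology (gtop X) ?q"
  have q: "quotient_map (gtop X) ?Y ?q" by (rule quotient_map_quot_topology)
  have lc: "locally_compact_space T" using compact_group by (rule compact_imp_locally_compact_space)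
  \<comment> \<open>The action descends because the product of the compact Hausdorff group with the
    collapsing map is a quotient map.\<close>
  have q2: "quotient_map (prod_topology T (gtop X)) (prod_topology T ?Y) (\<lambda>(g, x). (g, ?q x))"
    using lc Hausdorff_group q by (intro quotient_map_prod_right) auto
  have bq: "gact X g (gbase X) = gbase X" if "g \<in> carrier G" for g
    using X that by (simp add: pointed_gspace_def)
  have qg: "?q (gact X g x) = gact X g (?q x)" if g: "g \<in> carrier G" and x: "x \<in> topspace (gtop X)" for g x
  proof (cases "x \<in> A")
    case False
    have "gact X g x \<notin> A"
    proof
      assume "gact X g x \<in> A"
      then have "gact X (inv g) (gact X g x) \<in> A" using inv[of "inv g" "gact X g x"] g by simp
      then show False using False gact_inv(1)[OF X x g] by simp
    qed
    then show ?thesis using False by simp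
  qed (use inv g bq in auto)
  have "continuous_map (prod_topology T (gtop X)) (gtop X) (\<lambda>(g, x). gact X g x)"
    using X by (simp add: pointed_gspace_def)
  then have "continuous_map (prod_topology T (gtop X)) ?Y (?q \<circ> (\<lambda>(g, x). gact X g x))"
    using quotient_imp_continuous_map[OF q] by (rule continuous_map_compose)
  then have "continuous_map (prod_topology T (gtop X)) ?Y ((\<lambda>(g, x). gact X g x) \<circ> (\<lambda>(g, x). (g, ?q x)))"
  proof (rule continuous_map_eq)
    fix z assume "z \<in> topspace (prod_topology T (gtop X))"
    then obtain g x where z: "z = (g, x)" "g \<in> carrier G" "x \<in> topspace (gtop X)"
      by (auto simp: topspace_group)
    show "(?q \<circ> (\<lambda>(g, x). gact X g x)) z = ((\<lambda>(g, x). gact X g x) \<circ> (\<lambda>(g, x). (g, ?q x))) z"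
      using qg[OF z(2,3)] z(1) by (simp only: o_def prod.case)
  qed
  then have "continuous_map (prod_topology T ?Y) ?Y (\<lambda>(g, x). gact X g x)"
    by (rule continuous_compose_quotient_map[OF q2])
  moreover have "gbase X \<in> topspace ?Y"
    unfolding topspace_quot_topology using X A by (auto simp: pointed_gspace_def image_iff intro!: bexI[of _ "gbase X"])
  moreover have "topspace ?Y \<subseteq> topspace (gtop X)"
    unfolding topspace_quot_topology using X by (auto simp: pointed_gspace_def)
  ultimately show ?thesis using X by (auto simp: pointed_gspace_def gcollapse_def subset_iff)
qed

lemma Hausdorff_gcollapse:
  assumes "compact_space (gtop X)" "Hausdorff_space (gtop X)" "closedin (gtop X) A" "gbase X \<in> A"
  shows "Hausdorff_space (gtop (gcollapse X A))"
proof -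
  let ?q = "\<lambda>x. if x \<in> A then gbase X else x"
  have "Hausdorff_space (quot_topology (gtop X) ?q)"
  proof (rule Hausdorff_quotient[OF assms(1,2) quotient_map_quot_topology])
    fix C assume C: "closedin (gtop X) C"
    then have "C \<subseteq> topspace (gtop X)" by (rule closedin_subset)
    then have "{x \<in> topspace (gtop X). ?q x \<in> ?q ` C} = C \<union> (if C \<inter> A = {} then {} else A)"
      using closedin_subset[OF assms(3)] assms(4) by (auto simp: image_iff split: if_splits)
    then show "closedin (gtop X) {x \<in> topspace (gtop X). ?q x \<in> ?q ` C}"
      using C assms(3) by auto
  qed
  then show ?thesis by (simp add: gcollapse_def)
qed

lemma gcw_orbits_euler_number:
  assumes "closed_subgroup G T H" "gcw_orbits G T X p Xs m K f"
  shows "euler_number (zspace G H X) {{}} (\<Sum>i\<le>p. \<Sum>j<m i. cell_weight G H i (K i j))"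
proof -
  have "pointed_gspace G T X" "Hausdorff_space (gtop X)" "Xs p = topspace (gtop X)"
    using assms(2) by (auto simp: gcw_orbits_def)
  then show ?thesis
    using gcell_built_euler_number[OF assms(1)] gcw_orbits_built[OF assms(2) order_refl, of H] by simp
qed

text \<open>The cells of \<open>X\<close> are those of \<open>A\<close> together with those of X/A,
  so the weighted counts add. That \<open>A\<close> and X/A are complexes is recorded as well, since
  it places the relations in the free group on types of complexes.\<close>

lemma subcomplex_euler_number:
  assumes H: "closed_subgroup G T H" and A: "pointed_gcw_subcomplex G T X A"
  obtains a b where "pointed_gcw_complex G T X"
    "pointed_gcw_complex G T (gsubspace X A)" "pointed_gcw_complex G T (gcollapse X A)"
    "euler_number (zspace G H (gsubspace X A)) {{}} a"
    "euler_number (zspace G H (gcollapse X A)) {{}} b"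
    "euler_number (zspace G H X) {{}} (a + b)"
proof -
  obtain p Xs m K \<Phi> S where s0: "gcw_structure G T X p Xs m K \<Phi>" and clA: "closedin (gtop X) A"
    and S: "S \<subseteq> {(k, j). k \<le> p \<and> j < m k}"
    and A0: "A = insert (gbase X)
                 (\<Union>(k, j)\<in>S. \<Phi> k ` ({j} \<times> open_disk k \<times> topspace (coset_space G T (K k j))))"
    using A unfolding pointed_gcw_subcomplex_def by blast
  define f where "f = (\<lambda>k j v. \<Phi> k (j, v, K k j))"
  have s: "gcw_orbits G T X p Xs m K f" using gcw_structure_orbits(1)[OF s0] by (simp add: f_def)
  have X: "pointed_gspace G T X" and haus: "Hausdorff_space (gtop X)" and top: "Xs p = topspace (gtop X)"
    using s by (auto simp: gcw_orbits_def)
  have comp: "compact_space (gtop X)"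
    using gcell_built_compactin[OF X gcw_orbits_built[OF s order_refl]] top by (simp add: compact_space_def)
  let ?N = "{(k, j). k \<le> p \<and> j < m k}"
  have AS: "A = {gbase X} \<union> (\<Union>(k, j)\<in>S. gcell G X f k j)"
  proof -
    have "(\<Union>(k, j)\<in>S. \<Phi> k ` ({j} \<times> open_disk k \<times> topspace (coset_space G T (K k j)))) =
        (\<Union>(k, j)\<in>S. gcell G X f k j)"
    proof (rule SUP_cong[OF refl])
      fix x assume "x \<in> S"
      then show "(case x of (k, j) \<Rightarrow> \<Phi> k ` ({j} \<times> open_disk k \<times> topspace (coset_space G T (K k j)))) =
          (case x of (k, j) \<Rightarrow> gcell G X f k j)"
        using gcw_structure_orbits(2)[OF s0, of "fst x" "snd x", folded f_def] S by (cases x) auto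
    qed
    then show ?thesis using A0 by simp
  qed
  have fin: "finite ?N"
  proof -
    have "?N = (SIGMA k:{..p}. {..<m k})" by auto
    then show ?thesis by simp
  qed
  have topN: "topspace (gtop X) = {gbase X} \<union> (\<Union>(k, j)\<in>?N. gcell G X f k j)"
    unfolding top[symmetric] gcw_orbits_filtration[OF s order_refl] by fastforce
  have notbase: "gbase X \<notin> gcell G X f k j" if "(k, j) \<in> ?N" for k j
    using gcell_stage_disjoint[OF s, of k j] that gcw_orbits_stage[OF s, of k] by auto
  \<comment> \<open>Open cells are pairwise disjoint, so a cell that meets \<open>A\<close> is one
    of the cells making up \<open>A\<close>.\<close>
  have cellA: "(k, j) \<in> S" if x: "x \<in> gcell G X f k j" "(k, j) \<in> ?N" "x \<in> A" for x k j
  proof -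
    have "x \<noteq> gbase X" using notbase[OF x(2)] x(1) by auto
    then obtain i l where il: "(i, l) \<in> S" "x \<in> gcell G X f i l"
      using x(3) unfolding AS by auto
    then have "k = i \<and> j = l" using gcell_disjoint[OF s, of k j i l x] x S by auto
    then show ?thesis using il by simp
  qed
  have inv: "gact X g x \<in> A" if g: "g \<in> carrier G" and x: "x \<in> A" for g x
  proof (cases "x = gbase X")
    case False
    then obtain k j a v where k: "(k, j) \<in> S" "a \<in> carrier G" "v \<in> open_disk k" "x = gact X a (f k j v)"
      using x unfolding AS by (auto simp: gcell_def sweep_def)
    have "f k j v \<in> topspace (gtop X)"
      using gcw_orbits_in[OF s, of k j v] k S closed_disk_split(1)[of k] by auto
    then have "gact X g x = gact X (g \<otimes> a) (f k j v)" using gspaceD(2)[OF X] g k by simp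
    then have "gact X g x \<in> gcell G X f k j"
      using k g by (auto simp: gcell_def sweep_def intro!: image_eqI[of _ _ "(g \<otimes> a, f k j v)"])
    then show ?thesis using k unfolding AS by blast
  qed (use X g in \<open>auto simp: AS pointed_gspace_def\<close>)
  have bA: "gbase X \<in> A" by (simp add: AS)
  have Asub: "A \<subseteq> topspace (gtop X)" using clA by (rule closedin_subset)
  have bdst: "f k j v \<in> {gbase X} \<union> (\<Union>(i, j)\<in>{(i, j) \<in> ?N. i < k}. gcell G X f i j)"
    if "(k, j) \<in> ?N" "v \<in> bd_sphere k" for k j v
  proof -
    have "f k j v \<in> gstage X Xs k"
      using attaches_orbitsD(4)[OF gcw_orbits_attaches[OF s]] that by blast
    then show ?thesis unfolding gcw_orbits_stage[OF s, of k] using that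
      by (subst (asm) gcw_orbits_stage[OF s]) fastforce+
  qed
  have contf: "continuous_map (disk_space k) (gtop X) (f k j)" if "(k, j) \<in> ?N" for k j
    using attaches_orbitsD(2)[OF gcw_orbits_attaches[OF s]] that by blast
  have inX: "f k j v \<in> topspace (gtop X)" if "(k, j) \<in> ?N" "v \<in> closed_disk k" for k j v
    using gcw_orbits_in[OF s] that by blast
  have openA: "f k j v \<in> gcell G X f k j" if "(k, j) \<in> ?N" "v \<in> open_disk k" for k j v
  proof -
    have "gact X \<one> (f k j v) = f k j v"
      by (rule gspaceD(1)[OF X inX]) (use that closed_disk_split(1)[of k] in auto)
    then show ?thesis using that by (auto simp: gcell_def sweep_def intro!: image_eqI[of _ _ "(\<one>, f k j v)"])
  qed
  \<comment> \<open>\<open>A\<close> is closed and contains the open cell, hence also its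
    boundary.\<close>
  have fA: "f k j v \<in> A" if kj: "(k, j) \<in> S" and v: "v \<in> closed_disk k" for k j v
  proof -
    have kN: "(k, j) \<in> ?N" using kj S by auto
    have "closedin (disk_space k) {v \<in> topspace (disk_space k). f k j v \<in> A}"
      by (rule closedin_continuous_map_preimage[OF contf[OF kN] clA])
    moreover have "open_disk k \<subseteq> {v \<in> topspace (disk_space k). f k j v \<in> A}"
      using openA[OF kN] kj closed_disk_split(1)[of k] unfolding AS by auto
    ultimately have "closed_disk k \<subseteq> {v \<in> topspace (disk_space k). f k j v \<in> A}"
      by (rule closed_disk_closure)
    then show ?thesis using v by auto
  qed
  have "\<exists>Ys m' K' f'. gcw_orbits G T (gsubspace X A) p Ys m' K' f' \<and>
     (\<forall>H. (\<Sum>k\<le>p. \<Sum>j<m' k. cell_weight G H k (K' k j)) = (\<Sum>(k, j)\<in>S. cell_weight G H k (K k j)))"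
  proof (rule gcw_orbits_transfer[where r="\<lambda>x. x", OF s S])
    show "pointed_gspace G T (gsubspace X A)" by (rule pointed_gspace_gsubspace[OF X bA inv])
    show "Hausdorff_space (gtop (gsubspace X A))"
      using haus by (simp add: gsubspace_def Hausdorff_space_subtopology)
    show "continuous_map (disk_space k) (gtop (gsubspace X A)) (\<lambda>v. f k j v)" if "(k, j) \<in> S" for k j
      using contf[of k j] fA[of k j] that S by (auto simp: gsubspace_def continuous_map_in_subtopology)
    \<comment> \<open>The boundary lies in the base point and lower cells of \<open>X\<close> and at
      the same time in \<open>A\<close>; a lower cell that it meets thus belongs to
      \<open>S\<close>.\<close>
    show "f k j v \<in> (\<lambda>x. x) ` ({gbase X} \<union> (\<Union>(i, j)\<in>{(i, j) \<in> S. i < k}. gcell G X f i j))"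
      if kj: "(k, j) \<in> S" and v: "v \<in> bd_sphere k" for k j v
    proof -
      have kN: "(k, j) \<in> ?N" using kj S by auto
      have "f k j v \<in> A" using fA[OF kj] v closed_disk_split(1)[of k] by auto
      then show ?thesis using bdst[OF kN v] cellA by fastforce
    qed
    show "topspace (gtop (gsubspace X A)) = (\<lambda>x. x) ` ({gbase X} \<union> (\<Union>(k, j)\<in>S. gcell G X f k j))"
      using Asub AS by (auto simp: gsubspace_def)
  qed (auto simp: gsubspace_def)
  then obtain YA mA KA fA' where YA: "gcw_orbits G T (gsubspace X A) p YA mA KA fA'"
    "\<And>H. (\<Sum>k\<le>p. \<Sum>j<mA k. cell_weight G H k (KA k j)) = (\<Sum>(k, j)\<in>S. cell_weight G H k (K k j))" by blast
  let ?q = "\<lambda>x. if x \<in> A then gbase X else x"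
  have qmap: "quotient_map (gtop X) (gtop (gcollapse X A)) ?q"
    unfolding gcollapse_def by (simp add: quotient_map_quot_topology)
  have cellnA: "x \<notin> A" if "x \<in> gcell G X f k j" "(k, j) \<in> ?N - S" for x k j
    using cellA[OF that(1)] that(2) by blast
  have "\<exists>Ys m' K' f'. gcw_orbits G T (gcollapse X A) p Ys m' K' f' \<and>
     (\<forall>H. (\<Sum>k\<le>p. \<Sum>j<m' k. cell_weight G H k (K' k j)) = (\<Sum>(k, j)\<in>?N - S. cell_weight G H k (K k j)))"
  \<comment> \<open>Cells outside \<open>S\<close> avoid \<open>A\<close>, so the collapsing map is
    injective on them, and boundary points inside \<open>A\<close> go to the base point.\<close>
  proof (rule gcw_orbits_transfer[where r="?q", OF s])
    show "?N - S \<subseteq> ?N" by auto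
    show Y: "pointed_gspace G T (gcollapse X A)" by (rule pointed_gspace_gcollapse[OF X bA inv])
    show "Hausdorff_space (gtop (gcollapse X A))" by (rule Hausdorff_gcollapse[OF comp haus clA bA])
    show "?q (gbase X) = gbase (gcollapse X A)" by (simp add: gcollapse_def)
    show "continuous_map (disk_space k) (gtop (gcollapse X A)) (\<lambda>v. ?q (f k j v))" if "(k, j) \<in> ?N - S" for k j
      using continuous_map_compose[OF contf quotient_imp_continuous_map[OF qmap], of k j] that by (simp add: o_def)
    show "?q (gact X g (f k j v)) = gact (gcollapse X A) g (?q (f k j v))"
      if kj: "(k, j) \<in> ?N - S" and v: "v \<in> closed_disk k" and g: "g \<in> carrier G" for k j v g
    proof (cases "f k j v \<in> A")
      case True
      then show ?thesis using inv[OF g] X g by (simp add: gcollapse_def pointed_gspace_def)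
    next
      case False
      have "gact X (inv g) (gact X g (f k j v)) = f k j v" using gact_inv(1)[OF X inX g] kj v by blast
      then have "gact X g (f k j v) \<notin> A" using False inv[OF inv_closed[OF g]] by metis
      then show ?thesis using False by (simp add: gcollapse_def)
    qed
    show "inj_on ?q ({gbase X} \<union> (\<Union>(k, j)\<in>?N - S. gcell G X f k j))"
      using cellnA bA by (auto simp: inj_on_def)
    show "?q (f k j v) \<in> ?q ` ({gbase X} \<union> (\<Union>(i, j)\<in>{(i, j) \<in> ?N - S. i < k}. gcell G X f i j))"
      if kj: "(k, j) \<in> ?N - S" and v: "v \<in> bd_sphere k" for k j v
    proof (cases "f k j v \<in> A")
      case True
      then show ?thesis using bA by (auto intro!: image_eqI[of _ _ "gbase X"])
    next
      case False
      have kN: "(k, j) \<in> ?N" using kj by auto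
      obtain i l where il: "(i, l) \<in> ?N" "i < k" "f k j v \<in> gcell G X f i l"
        using bdst[OF kN v] False bA by auto
      then have "(i, l) \<in> ?N - S" using False unfolding AS by auto
      then show ?thesis using il by (intro imageI) auto
    qed
    show "topspace (gtop (gcollapse X A)) = ?q ` ({gbase X} \<union> (\<Union>(k, j)\<in>?N - S. gcell G X f k j))"
    proof -
      have "topspace (gtop (gcollapse X A)) = ?q ` topspace (gtop X)"
        by (simp add: gcollapse_def topspace_quot_topology)
      also have "\<dots> = ?q ` (A \<union> ({gbase X} \<union> (\<Union>(k, j)\<in>?N - S. gcell G X f k j)))"
        unfolding topN by (rule arg_cong[of _ _ "image ?q"]) (use S in \<open>auto simp: AS\<close>)
      also have "\<dots> = ?q ` ({gbase X} \<union> (\<Union>(k, j)\<in>?N - S. gcell G X f k j))"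
        using bA by (auto simp: image_Un)
      finally show ?thesis .
    qed
  qed
  then obtain YC mC KC fC where YC: "gcw_orbits G T (gcollapse X A) p YC mC KC fC"
    "\<And>H. (\<Sum>k\<le>p. \<Sum>j<mC k. cell_weight G H k (KC k j)) = (\<Sum>(k, j)\<in>?N - S. cell_weight G H k (K k j))" by blast
  let ?w = "\<lambda>(k, j). cell_weight G H k (K k j)"
  have "(\<Sum>i\<le>p. \<Sum>j<m i. cell_weight G H i (K i j)) = sum ?w (SIGMA k:{..p}. {..<m k})"
    by (rule sum.Sigma) auto
  also have "(SIGMA k:{..p}. {..<m k}) = ?N" by auto
  also have "sum ?w ?N = sum ?w S + sum ?w (?N - S)"
    using sum.subset_diff[OF S fin, of ?w] by (simp add: add.commute)
  finally have tot: "(\<Sum>i\<le>p. \<Sum>j<m i. cell_weight G H i (K i j)) = sum ?w S + sum ?w (?N - S)" .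
  show ?thesis
  proof (rule that)
    show "pointed_gcw_complex G T X" using s0 unfolding pointed_gcw_complex_def by blast
    show "pointed_gcw_complex G T (gsubspace X A)" "pointed_gcw_complex G T (gcollapse X A)"
      using gcw_structure_exists[OF YA(1)] gcw_structure_exists[OF YC(1)] unfolding pointed_gcw_complex_def by blast+
    show "euler_number (zspace G H (gsubspace X A)) {{}} (sum ?w S)"
      using gcw_orbits_euler_number[OF H YA(1)] unfolding YA(2) .
    show "euler_number (zspace G H (gcollapse X A)) {{}} (sum ?w (?N - S))"
      using gcw_orbits_euler_number[OF H YC(1)] unfolding YC(2) .
    show "euler_number (zspace G H X) {{}} (sum ?w S + sum ?w (?N - S))"
      using gcw_orbits_euler_number[OF H s] unfolding tot .
  qed
qed

end

section \<open>Spheres of representations\<close>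

text \<open>For a linear subspace \<open>U\<close> of \<open>W\<close> this is the sphere of
  \<open>U\<close>, realized inside that of \<open>W\<close> so that it has the topology in which
  the fixed set of an induced sphere presents it.\<close>

definition fixed_sphere :: "'w::euclidean_space set \<Rightarrow> 'w set \<Rightarrow> 'w option topology" where
  "fixed_sphere W U = subtopology (Alexandroff_compactification (top_of_set W)) (insert None (Some ` U))"

lemma Hausdorff_Alexandroff_subspace:
  fixes W :: "'w::euclidean_space set"
  assumes "subspace W"
  shows "Hausdorff_space (Alexandroff_compactification (top_of_set W))"
proof -
  have "locally_compact_space (top_of_set W)"
    unfolding locally_compact_space_def
  proof
    fix x assume "x \<in> topspace (top_of_set W)"
    then have x: "x \<in> W" by simp
    show "\<exists>U K. openin (top_of_set W) U \<and> compactin (top_of_set W) K \<and> x \<in> U \<and> U \<subseteq> K"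
    proof (intro exI conjI)
      show "openin (top_of_set W) (W \<inter> ball x 1)" by auto
      show "compactin (top_of_set W) (W \<inter> cball x 1)"
        using closed_subspace[OF assms] by (auto simp: compactin_subtopology closed_Int_compact)
      show "x \<in> W \<inter> ball x 1" "W \<inter> ball x 1 \<subseteq> W \<inter> cball x 1" using x by auto
    qed
  qed
  then show ?thesis
    by (simp add: Hausdorff_space_Alexandroff_compactification Hausdorff_space_subtopology)
qed

text \<open>Coordinates in an orthonormal basis of \<open>U\<close>. Outside of \<open>U\<close> the
  map \<open>\<psi>\<close> gives the coordinates of the orthogonal projection, so it is continuous
  on the whole space.\<close>

lemma subspace_coordinates:
  fixes U :: "'w::euclidean_space set"
  assumes "subspace U"
  obtains \<phi> :: "(nat \<Rightarrow> real) \<Rightarrow> 'w" and \<psi> :: "'w \<Rightarrow> nat \<Rightarrow> real"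
  where "\<And>v. \<phi> v \<in> U" "\<And>x. x \<in> U \<Longrightarrow> \<phi> (\<psi> x) = x"
    "\<And>v. v \<in> topspace (Euclidean_space (dim U)) \<Longrightarrow> \<psi> (\<phi> v) = v"
    "continuous_map (Euclidean_space (dim U)) euclidean \<phi>"
    "continuous_map euclidean (Euclidean_space (dim U)) \<psi>"
proof -
  obtain B where B: "B \<subseteq> U" "pairwise orthogonal B" "\<And>x. x \<in> B \<Longrightarrow> norm x = 1" "independent B"
    "card B = dim U" "span B = U"
    using orthonormal_basis_subspace[OF assms] by metis
  have fin: "finite B" using B(4) by (rule independent_imp_finite)
  obtain b where b: "bij_betw b {..<dim U} B"
    using ex_bij_betw_nat_finite[OF fin] B(5) by (auto simp: atLeast0LessThan)
  have bB: "b i \<in> B" if "i < dim U" for i using b that by (auto simp: bij_betw_def)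
  have bb: "b i \<bullet> b j = (if i = j then 1 else 0)" if "i < dim U" "j < dim U" for i j
  proof (cases "i = j")
    case True
    then show ?thesis using B(3)[OF bB[OF that(1)]] by (simp add: norm_eq_1)
  next
    case False
    then have "b i \<noteq> b j" using b that by (auto simp: bij_betw_def inj_on_def)
    then show ?thesis using B(2) bB that False by (auto simp: pairwise_def orthogonal_def)
  qed
  define \<phi> where "\<phi> = (\<lambda>v::nat\<Rightarrow>real. \<Sum>i<dim U. v i *\<^sub>R b i)"
  define \<psi> where "\<psi> = (\<lambda>(x::'w) i. if i < dim U then x \<bullet> b i else 0)"
  have \<phi>U: "\<phi> v \<in> U" for v
    unfolding \<phi>_def using assms B(1) bB by (intro subspace_sum subspace_scale) auto
  have inner: "\<phi> v \<bullet> b j = v j" if j: "j < dim U" for v j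
  proof -
    have "\<phi> v \<bullet> b j = (\<Sum>i<dim U. v i * (if i = j then 1 else 0))"
      unfolding \<phi>_def inner_sum_left using bb[OF _ j] by (intro sum.cong) auto
    also have "\<dots> = (\<Sum>i<dim U. if i = j then v i else 0)" by (rule sum.cong) auto
    also have "\<dots> = v j" using j by simp
    finally show ?thesis .
  qed
  show ?thesis
  proof (rule that)
    show "\<phi> v \<in> U" for v by (rule \<phi>U)
    show "\<psi> (\<phi> v) = v" if "v \<in> topspace (Euclidean_space (dim U))" for v
      using that inner by (auto simp: \<psi>_def fun_eq_iff topspace_Euclidean_space)
    show "\<phi> (\<psi> x) = x" if x: "x \<in> U" for x
    proof -
      let ?y = "\<phi> (\<psi> x) - x"
      have o: "orthogonal ?y y" if yB: "y \<in> B" for y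
      proof -
        obtain j where "j < dim U" "y = b j" using yB b by (auto simp: bij_betw_def)
        then show ?thesis using inner[of j "\<psi> x"] by (simp add: orthogonal_def inner_diff_left \<psi>_def)
      qed
      have sp: "?y \<in> span B" unfolding B(6) using \<phi>U x assms by (simp add: subspace_diff)
      have "orthogonal ?y ?y" by (rule orthogonal_to_span[OF sp o])
      then show ?thesis by (simp add: orthogonal_self)
    qed
    show "continuous_map (Euclidean_space (dim U)) euclidean \<phi>"
      unfolding continuous_map_Euclidean_space_iff \<phi>_def
      by (intro continuous_intros continuous_on_product_coordinates[THEN continuous_on_subset]) auto
    show "continuous_map euclidean (Euclidean_space (dim U)) \<psi>"
      unfolding \<psi>_def continuous_map_componentwise_Euclidean_space
      by (auto intro!: continuous_intros)
  qed
qed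

text \<open>One cell suffices: its open disk is blown up to all of \<open>U\<close>, and its
  boundary goes to the point at infinity.\<close>

lemma cell_built_fixed_sphere:
  fixes U W :: "'w::euclidean_space set"
  assumes U: "subspace U" and W: "subspace W" and UW: "U \<subseteq> W"
  shows "cell_built (fixed_sphere W U) None (topspace (fixed_sphere W U)) ((- 1) ^ dim U)"
proof -
  let ?n = "dim U"
  let ?E = "Euclidean_space ?n"
  let ?A = "fixed_sphere W U"
  have topA: "topspace ?A = insert None (Some ` U)" using UW by (auto simp: fixed_sphere_def)
  obtain \<phi> \<psi> where \<phi>: "\<And>v. \<phi> v \<in> U" "\<And>x. x \<in> U \<Longrightarrow> \<phi> (\<psi> x) = x"
    "\<And>v. v \<in> topspace ?E \<Longrightarrow> \<psi> (\<phi> v) = v"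
    "continuous_map ?E euclidean \<phi>" "continuous_map euclidean ?E \<psi>"
    using subspace_coordinates[OF U] by blast
  have \<psi>E: "\<psi> x \<in> topspace ?E" for x using continuous_map_image_subset_topspace[OF \<phi>(5)] by auto
  \<comment> \<open>Radii change by r / (1 - r), with inverse r / (1 + r).\<close>
  define s where "s = (\<lambda>v::nat\<Rightarrow>real. (\<lambda>i. (1 / (1 - vnorm ?n v)) * v i))"
  define t where "t = (\<lambda>v::nat\<Rightarrow>real. (\<lambda>i. (1 / (1 + vnorm ?n v)) * v i))"
  have pos: "0 < 1 + vnorm ?n v" for v using vnorm_nonneg[of ?n v] by linarith
  have nt: "vnorm ?n (t v) = vnorm ?n v / (1 + vnorm ?n v)" for v
    unfolding t_def vnorm_scale using pos[of v] by simp
  have topen: "t v \<in> open_disk ?n" if "v \<in> topspace ?E" for v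
  proof -
    have "vnorm ?n (t v) < 1" unfolding nt using pos[of v] by (simp add: divide_simps)
    then show ?thesis using that by (auto simp: open_disk_vnorm topspace_Euclidean_space t_def)
  qed
  have st: "s (t v) = v" for v
    unfolding s_def nt using pos[of v] by (auto simp: t_def fun_eq_iff field_simps)
  have ts: "t (s v) = v" if "v \<in> open_disk ?n" for v
  proof -
    have l: "vnorm ?n v < 1" using that by (simp add: open_disk_vnorm)
    have "vnorm ?n (s v) = vnorm ?n v / (1 - vnorm ?n v)" unfolding s_def vnorm_scale using l by simp
    then show ?thesis unfolding t_def using l by (auto simp: s_def fun_eq_iff field_simps)
  qed
  have sE: "s v \<in> topspace ?E" if "v \<in> open_disk ?n" for v
    using that by (auto simp: s_def open_disk_vnorm topspace_Euclidean_space)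
  define f where "f = (\<lambda>v. if v \<in> open_disk ?n then Some (\<phi> (s v)) else None)"
  have oc: "open_disk ?n \<subseteq> closed_disk ?n" using closed_disk_split(1)[of ?n] by auto
  have opo: "openin (disk_space ?n) (open_disk ?n)"
  proof -
    have "open_disk ?n = topspace (disk_space ?n) - bd_sphere ?n"
      using closed_disk_split[of ?n] by auto
    then show ?thesis using openin_diff[OF openin_topspace bd_sphere_closedin] by metis
  qed
  have contt: "continuous_map ?E (disk_space ?n) t"
  proof -
    have "continuous_map ?E ?E (\<lambda>v i. if i < ?n then (1 / (1 + vnorm ?n v)) * v i else 0)"
      unfolding continuous_map_componentwise_Euclidean_space
      by (intro allI impI continuous_intros continuous_map_vnorm continuous_map_coordinate) (use pos in \<open>metis less_irrefl\<close>)
    then have "continuous_map ?E ?E t"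
      by (rule continuous_map_eq) (auto simp: t_def topspace_Euclidean_space fun_eq_iff)
    then show ?thesis using topen oc by (auto simp: continuous_map_into_disk_space)
  qed
  have conts: "continuous_map (subtopology (disk_space ?n) (open_disk ?n)) ?E s"
  proof -
    let ?D = "subtopology (disk_space ?n) (open_disk ?n)"
    have c: "continuous_map ?D euclideanreal (vnorm ?n)" "continuous_map ?D euclideanreal (\<lambda>v. v i)" for i
      by (intro continuous_map_from_subtopology continuous_map_disk_space continuous_map_vnorm continuous_map_coordinate)+
    have "continuous_map ?D ?E (\<lambda>v i. if i < ?n then (1 / (1 - vnorm ?n v)) * v i else 0)"
      unfolding continuous_map_componentwise_Euclidean_space
      by (intro allI impI continuous_intros c) (auto simp: open_disk_vnorm)
    then show ?thesis
      by (rule continuous_map_eq) (auto simp: s_def open_disk_vnorm fun_eq_iff)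
  qed
  have contf: "continuous_map (disk_space ?n) (Alexandroff_compactification (top_of_set W)) f"
    unfolding continuous_map_def
  proof (intro conjI allI impI)
    show "f \<in> topspace (disk_space ?n) \<rightarrow> topspace (Alexandroff_compactification (top_of_set W))"
      using subsetD[OF UW \<phi>(1)] by (auto simp: f_def)
    fix V assume V: "openin (Alexandroff_compactification (top_of_set W)) V"
    have cW: "continuous_map (subtopology (disk_space ?n) (open_disk ?n)) (top_of_set W) (\<phi> \<circ> s)"
    proof -
      have "continuous_map (subtopology (disk_space ?n) (open_disk ?n)) euclidean (\<phi> \<circ> s)"
        by (rule continuous_map_compose[OF conts \<phi>(4)])
      then show ?thesis using \<phi>(1) UW by (auto simp: continuous_map_in_subtopology)
    qed
    from V consider R where "openin (top_of_set W) R" "V = Some ` R"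
      | C where "compactin (top_of_set W) C" "closedin (top_of_set W) C" "V = insert None (Some ` (W - C))"
      unfolding openin_Alexandroff_compactification by auto
    then show "openin (disk_space ?n) {x \<in> topspace (disk_space ?n). f x \<in> V}"
    proof cases
      case 1
      have "{x \<in> topspace (disk_space ?n). f x \<in> V} =
          {x \<in> topspace (subtopology (disk_space ?n) (open_disk ?n)). (\<phi> \<circ> s) x \<in> R}"
        using oc 1 by (auto simp: f_def split: if_splits)
      moreover have "openin (subtopology (disk_space ?n) (open_disk ?n)) \<dots>"
        by (rule openin_continuous_map_preimage[OF cW 1(1)])
      ultimately show ?thesis using openin_trans_full[OF _ opo] by metis
    next
      case 2
      \<comment> \<open>A neighbourhood of infinity omits a compact set \<open>C\<close>; the part
        of \<open>C\<close> in \<open>U\<close> corresponds to the compact subset \<open>?R\<close>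
        of the open disk, whose complement is the preimage.\<close>
      let ?R = "(t \<circ> \<psi>) ` (C \<inter> U)"
      have "{x \<in> topspace (disk_space ?n). f x \<in> V} = topspace (disk_space ?n) - ?R"
      proof -
        have "x \<in> ?R \<longleftrightarrow> x \<in> open_disk ?n \<and> \<phi> (s x) \<in> C" for x
        proof
          assume "x \<in> ?R"
          then obtain y where "y \<in> C" "y \<in> U" "x = t (\<psi> y)" by auto
          then show "x \<in> open_disk ?n \<and> \<phi> (s x) \<in> C" using topen[OF \<psi>E] st \<phi>(2) by simp
        next
          assume x: "x \<in> open_disk ?n \<and> \<phi> (s x) \<in> C"
          then have "x = (t \<circ> \<psi>) (\<phi> (s x))" using \<phi>(3)[OF sE] ts by simp
          then show "x \<in> ?R" using x \<phi>(1) by blast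
        qed
        moreover have "f x \<in> V \<longleftrightarrow> \<not> (x \<in> open_disk ?n \<and> \<phi> (s x) \<in> C)" for x
          unfolding 2(3) f_def using \<phi>(1) UW by auto
        ultimately show ?thesis by blast
      qed
      moreover have "closedin (disk_space ?n) ?R"
      proof -
        have "compact C" using 2 by (simp add: compactin_subtopology)
        then have "compactin euclidean (C \<inter> U)"
          using closed_subspace[OF U] by (simp add: compact_Int_closed)
        then have "compactin (disk_space ?n) ?R"
          using continuous_map_compose[OF \<phi>(5) contt] by (rule image_compactin)
        then show ?thesis by (simp add: compactin_imp_closedin Hausdorff_disk_space)
      qed
      ultimately show ?thesis using openin_diff[OF openin_topspace] by metis
    qed
  qed
  then have contA: "continuous_map (disk_space ?n) ?A f"
    using \<phi>(1) by (auto simp: fixed_sphere_def continuous_map_in_subtopology f_def)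
  have "cell_built ?A None ({None} \<union> f ` open_disk ?n) (0 + (- 1) ^ ?n)"
  proof (rule cell_built.cell[OF cell_built.base contA])
    show "None \<in> topspace ?A" by (simp add: topA)
    show "f ` bd_sphere ?n \<subseteq> {None}" using closed_disk_split(2)[of ?n] by (auto simp: f_def)
    show "inj_on f (open_disk ?n)"
    proof (rule inj_onI)
      fix v w assume vw: "v \<in> open_disk ?n" "w \<in> open_disk ?n" "f v = f w"
      then have "\<phi> (s v) = \<phi> (s w)" by (simp add: f_def)
      then have "s v = s w" using \<phi>(3)[OF sE] vw by metis
      then show "v = w" using ts vw by metis
    qed
    show "f ` open_disk ?n \<inter> {None} = {}" by (auto simp: f_def)
  qed
  moreover have "{None} \<union> f ` open_disk ?n = topspace ?A"
  proof -
    have "Some x \<in> f ` open_disk ?n" if "x \<in> U" for x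
      using topen[OF \<psi>E, of x] st \<phi>(2)[OF that] by (intro image_eqI[of _ _ "t (\<psi> x)"]) (auto simp: f_def)
    then show ?thesis using \<phi>(1) by (auto simp: topA f_def)
  qed
  ultimately show ?thesis by simp
qed

lemma euler_number_fixed_sphere:
  fixes U W :: "'w::euclidean_space set"
  assumes U: "subspace U" and W: "subspace W" and UW: "U \<subseteq> W"
  shows "euler_number (fixed_sphere W U) {None} ((- 1) ^ dim U)"
proof -
  have "Hausdorff_space (fixed_sphere W U)"
    unfolding fixed_sphere_def by (rule Hausdorff_space_subtopology[OF Hausdorff_Alexandroff_subspace[OF W]])
  from cell_built_euler_number[OF this cell_built_fixed_sphere[OF assms]] show ?thesis by simp
qed

section \<open>Induced spaces of representation spheres\<close>

definition linear_representation ::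
    "('g, 'b) monoid_scheme \<Rightarrow> 'g set \<Rightarrow> 'w::euclidean_space set \<Rightarrow> ('g \<Rightarrow> 'w \<Rightarrow> 'w) \<Rightarrow> bool" where
  "linear_representation G H W \<rho> \<longleftrightarrow>
     subspace W \<and> (\<forall>h\<in>H. \<forall>x\<in>W. \<rho> h x \<in> W) \<and>
     (\<forall>h\<in>H. \<forall>x\<in>W. \<forall>y\<in>W. \<rho> h (x + y) = \<rho> h x + \<rho> h y) \<and>
     (\<forall>h\<in>H. \<forall>c. \<forall>x\<in>W. \<rho> h (c *\<^sub>R x) = c *\<^sub>R \<rho> h x) \<and>
     (\<forall>x\<in>W. \<rho> \<one>\<^bsub>G\<^esub> x = x) \<and>
     (\<forall>g\<in>H. \<forall>h\<in>H. \<forall>x\<in>W. \<rho> (g \<otimes>\<^bsub>G\<^esub> h) x = \<rho> g (\<rho> h x))"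

lemma orthogonal_imp_linear_representation:
  "orthogonal_representation G T H W \<rho> \<Longrightarrow> linear_representation G H W \<rho>"
  by (simp add: orthogonal_representation_def linear_representation_def)

lemma linear_representation_sum:
  assumes "linear_representation G H W \<rho>" "linear_representation G H V \<sigma>"
  shows "linear_representation G H (W \<times> V) (direct_sum_action \<rho> \<sigma>)"
  using assms unfolding linear_representation_def direct_sum_action_def
  by (auto simp: subspace_Times)

lemma subspace_fixed_vectors:
  assumes "linear_representation G H W \<rho>" "H \<noteq> {}"
  shows "subspace (fixed_vectors H W \<rho>)"
proof -
  have W: "subspace W" using assms by (simp add: linear_representation_def)
  have add: "\<rho> h (x + y) = \<rho> h x + \<rho> h y" and sc: "\<rho> h (c *\<^sub>R x) = c *\<^sub>R \<rho> h x"
    if "h \<in> H" "x \<in> W" "y \<in> W" for h x y c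
    using assms that by (auto simp: linear_representation_def)
  have "\<rho> h 0 = 0" if "h \<in> H" for h
    using sc[OF that subspace_0[OF W] subspace_0[OF W], of 0] by simp
  then show ?thesis
    using W add sc by (auto simp: fixed_vectors_def subspace_def)
qed

lemma fixed_vectors_sum:
  "fixed_vectors H (W \<times> V) (direct_sum_action \<rho> \<sigma>) = fixed_vectors H W \<rho> \<times> fixed_vectors H V \<sigma>"
  by (auto simp: fixed_vectors_def direct_sum_action_def)

section \<open>Adding an isolated base point\<close>

lemma topspace_plus_topology: "topspace (plus_topology Y) = insert None (Some ` topspace Y)"
proof
  have "openin (plus_topology Y) (insert None (Some ` topspace Y))"
    by (simp add: openin_plus_topology inj_image_mem_iff Collect_mem_eq)
  then show "insert None (Some ` topspace Y) \<subseteq> topspace (plus_topology Y)" by (rule openin_subset)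
  show "topspace (plus_topology Y) \<subseteq> insert None (Some ` topspace Y)"
    using openin_plus_topology[of Y "topspace (plus_topology Y)"] by simp
qed

lemma openin_plus_None: "openin (plus_topology Y) {None}"
  by (simp add: openin_plus_topology)

lemma openin_plus_Some: "openin Y U \<Longrightarrow> openin (plus_topology Y) (Some ` U)"
  using openin_subset[of Y U] by (auto simp: openin_plus_topology inj_image_mem_iff)

lemma continuous_map_plus_Some: "continuous_map Y (plus_topology Y) Some"
  unfolding continuous_map_def
proof (intro conjI allI impI)
  show "Some \<in> topspace Y \<rightarrow> topspace (plus_topology Y)" by (simp add: topspace_plus_topology)
  fix U assume U: "openin (plus_topology Y) U"
  then have "openin Y {y. Some y \<in> U}" by (simp add: openin_plus_topology)
  moreover have "{x \<in> topspace Y. Some x \<in> U} = {y. Some y \<in> U}"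
    using U by (auto simp: openin_plus_topology)
  ultimately show "openin Y {x \<in> topspace Y. Some x \<in> U}" by simp
qed

text \<open>The product of Y^+ with Z is the disjoint union of the two open pieces Z and Y x Z,
  which can be tested separately.\<close>

lemma continuous_map_from_plus_prod:
  assumes N: "continuous_map Z X (\<lambda>z. f (None, z))"
    and S: "continuous_map (prod_topology Y Z) X (\<lambda>(y, z). f (Some y, z))"
  shows "continuous_map (prod_topology (plus_topology Y) Z) X f"
  unfolding continuous_map_def
proof (intro conjI allI impI)
  show "f \<in> topspace (prod_topology (plus_topology Y) Z) \<rightarrow> topspace X"
    using continuous_map_image_subset_topspace[OF N] continuous_map_image_subset_topspace[OF S]
    by (auto simp: topspace_plus_topology image_subset_iff)
  fix U assume U: "openin X U"
  let ?P = "{x \<in> topspace (prod_topology (plus_topology Y) Z). f x \<in> U}"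
  have oN: "openin Z {z \<in> topspace Z. f (None, z) \<in> U}" by (rule openin_continuous_map_preimage[OF N U])
  have oS: "openin (prod_topology Y Z) {x \<in> topspace (prod_topology Y Z). (\<lambda>(y, z). f (Some y, z)) x \<in> U}"
    by (rule openin_continuous_map_preimage[OF S U])
  show "openin (prod_topology (plus_topology Y) Z) ?P"
    unfolding openin_prod_topology_alt
  proof (intro allI impI)
    fix a z assume az: "(a, z) \<in> ?P"
    show "\<exists>A B. openin (plus_topology Y) A \<and> openin Z B \<and> a \<in> A \<and> z \<in> B \<and> A \<times> B \<subseteq> ?P"
    proof (cases a)
      case None
      then show ?thesis using az oN
        by (intro exI[of _ "{None}"] exI[of _ "{z \<in> topspace Z. f (None, z) \<in> U}"])
          (auto simp: openin_plus_None topspace_plus_topology)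
    next
      case (Some y)
      then have "(y, z) \<in> {x \<in> topspace (prod_topology Y Z). (\<lambda>(y, z). f (Some y, z)) x \<in> U}"
        using az by (auto simp: topspace_plus_topology)
      then obtain A B where "openin Y A" "openin Z B" "y \<in> A" "z \<in> B"
        "A \<times> B \<subseteq> {x \<in> topspace (prod_topology Y Z). (\<lambda>(y, z). f (Some y, z)) x \<in> U}"
        using oS[unfolded openin_prod_topology_alt, rule_format, of y z] by meson
      then show ?thesis using Some
        by (intro exI[of _ "Some ` A"] exI[of _ B]) (auto simp: openin_plus_Some topspace_plus_topology)
    qed
  qed
qed

locale induced_sphere = compact_topological_group G T
  for G :: "('g, 'b) monoid_scheme" (structure) and T :: "'g topology" +
  fixes H :: "'g set" and W :: "'w::euclidean_space set" and \<rho> :: "'g \<Rightarrow> 'w \<Rightarrow> 'w"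
  assumes closed_subgroup_H: "closed_subgroup G T H"
    and representation: "linear_representation G H W \<rho>"
begin

abbreviation "X \<equiv> induced_gspace G T H (rep_sphere W \<rho>)"
abbreviation "P \<equiv> prod_topology (plus_topology T) (Alexandroff_compactification (top_of_set W))"
abbreviation "base \<equiv> {(None, None)} :: ('g option \<times> 'w option) set"

definition orb :: "'g \<Rightarrow> 'w \<Rightarrow> ('g option \<times> 'w option) set" where
  "orb g w = (\<lambda>h. (Some (g \<otimes> inv h), Some (\<rho> h w))) ` H"

text \<open>Smash product and orbit space in one step: a composite of quotient maps is a quotient
  map, so maps out of the induced space can be defined on G^+ x S^W directly.\<close>

definition proj :: "'g option \<times> 'w option \<Rightarrow> ('g option \<times> 'w option) set" where
  "proj = H_orbit G H (rep_sphere W \<rho>) \<circ> (\<lambda>(a, x). if a = None \<or> x = None then (None, None) else (a, x))"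

lemma subgroup_H: "subgroup H G" and closedin_H: "closedin T H"
  using closed_subgroup_H by (auto simp: closed_subgroup_def)

lemma H_carrier: "h \<in> H \<Longrightarrow> h \<in> carrier G"
  using subgroup_H by (rule subgroup.mem_carrier)

lemma one_H: "\<one> \<in> H" and inv_H: "h \<in> H \<Longrightarrow> inv h \<in> H" and mult_H: "h \<in> H \<Longrightarrow> k \<in> H \<Longrightarrow> h \<otimes> k \<in> H"
  using subgroup_H by (auto simp: subgroup_def)

lemma rho:
  "h \<in> H \<Longrightarrow> x \<in> W \<Longrightarrow> \<rho> h x \<in> W" "x \<in> W \<Longrightarrow> \<rho> \<one> x = x"
  "g \<in> H \<Longrightarrow> h \<in> H \<Longrightarrow> x \<in> W \<Longrightarrow> \<rho> (g \<otimes> h) x = \<rho> g (\<rho> h x)"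
  using representation by (auto simp: linear_representation_def)

lemma base_orbit: "H_orbit G H (rep_sphere W \<rho>) (None, None) = base"
  using one_H by (auto simp: H_orbit_def rep_sphere_def)

lemma proj_simps [simp]:
  "proj (None, x) = base" "proj (a, None) = base" "proj (Some g, Some w) = orb g w"
proof -
  show "proj (None, x) = base" "proj (a, None) = base" by (simp_all add: proj_def base_orbit)
  show "proj (Some g, Some w) = orb g w"
    by (simp add: proj_def orb_def H_orbit_def rep_sphere_def)
qed

lemma quotient_map_proj: "quotient_map P (gtop X) proj"
proof -
  let ?r = "\<lambda>(a, x). if a = None \<or> x = None then (None, None) else (a :: 'g option, x :: 'w option)"
  have eq: "gtop X = quot_topology (quot_topology P ?r) (H_orbit G H (rep_sphere W \<rho>))"
    by (simp add: induced_gspace_def smash_topology_def rep_sphere_def)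
  show ?thesis
    unfolding proj_def eq by (rule quotient_map_compose[OF quotient_map_quot_topology quotient_map_quot_topology])
qed

lemma topspace_P: "topspace P = insert None (Some ` carrier G) \<times> insert None (Some ` W)"
  by (simp add: topspace_plus_topology topspace_group)

lemma topspace_X: "topspace (gtop X) = insert base {orb g w | g w. g \<in> carrier G \<and> w \<in> W}"
proof -
  have "topspace (gtop X) = proj ` topspace P"
    using quotient_imp_surjective_map[OF quotient_map_proj] by simp
  also have "\<dots> = insert base {orb g w | g w. g \<in> carrier G \<and> w \<in> W}"
  proof (rule subset_antisym; rule subsetI)
    fix y assume "y \<in> proj ` topspace P"
    then obtain a x where "(a, x) \<in> topspace P" "y = proj (a, x)" by auto
    then show "y \<in> insert base {orb g w | g w. g \<in> carrier G \<and> w \<in> W}"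
      unfolding topspace_P by (cases a; cases x) auto
  next
    fix y assume "y \<in> insert base {orb g w | g w. g \<in> carrier G \<and> w \<in> W}"
    then consider "y = proj (None, None)" | g w where "g \<in> carrier G" "w \<in> W" "y = proj (Some g, Some w)"
      by auto
    then show "y \<in> proj ` topspace P"
    proof cases
      case 1
      moreover have "(None, None) \<in> topspace P" unfolding topspace_P by simp
      ultimately show ?thesis by blast
    next
      case 2
      moreover have "(Some g, Some w) \<in> topspace P" unfolding topspace_P using 2 by simp
      ultimately show ?thesis by blast
    qed
  qed
  finally show ?thesis .
qed

lemma gbase_X: "gbase X = base"
proof -
  have "gbase X = H_orbit G H (rep_sphere W \<rho>) (None, gbase (rep_sphere W \<rho>))"
    by (simp add: induced_gspace_def)
  then show ?thesis using base_orbit by (simp add: rep_sphere_def)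
qed

lemma gact_base: "gact X g base = base"
  by (simp add: induced_gspace_def)

lemma gact_orb:
  assumes "g \<in> carrier G" "k \<in> carrier G"
  shows "gact X k (orb g w) = orb (k \<otimes> g) w"
proof -
  have "k \<otimes> (g \<otimes> inv h) = k \<otimes> g \<otimes> inv h" if "h \<in> H" for h
    using assms H_carrier[OF that] by (simp add: m_assoc)
  then show ?thesis by (auto simp: induced_gspace_def orb_def image_image)
qed

lemma orb_neq_base: "orb g w \<noteq> base"
  using one_H by (auto simp: orb_def)

lemma orb_eqD:
  assumes "orb g w = orb g' w'" "g' \<in> carrier G" "w' \<in> W"
  shows "\<exists>h\<in>H. g' = g \<otimes> inv h \<and> w' = \<rho> h w"
proof -
  have "(Some (g' \<otimes> inv \<one>), Some (\<rho> \<one> w')) \<in> orb g' w'" using one_H unfolding orb_def by blast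
  then have "(Some g', Some w') \<in> orb g w" using assms rho(2) by simp
  then show ?thesis by (auto simp: orb_def)
qed

lemma orb_shift:
  assumes "g \<in> carrier G" "w \<in> W" "h \<in> H"
  shows "orb (g \<otimes> inv h) (\<rho> h w) = orb g w"
proof -
  have sub: "orb (g \<otimes> inv h) (\<rho> h w) \<subseteq> orb g w" if "g \<in> carrier G" "w \<in> W" "h \<in> H" for g w h
  proof
    fix z assume "z \<in> orb (g \<otimes> inv h) (\<rho> h w)"
    then obtain k where k: "k \<in> H" "z = (Some (g \<otimes> inv h \<otimes> inv k), Some (\<rho> k (\<rho> h w)))"
      by (auto simp: orb_def)
    have "g \<otimes> inv h \<otimes> inv k = g \<otimes> inv (k \<otimes> h)"
      using that k H_carrier by (simp add: inv_mult_group m_assoc)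
    then have "z = (Some (g \<otimes> inv (k \<otimes> h)), Some (\<rho> (k \<otimes> h) w))" using k that rho(3) by simp
    then show "z \<in> orb g w" using mult_H[OF k(1) that(3)] unfolding orb_def by blast
  qed
  have "g \<otimes> inv h \<otimes> inv (inv h) = g" using assms H_carrier by (simp add: m_assoc)
  moreover have "\<rho> (inv h) (\<rho> h w) = w" using assms inv_H rho H_carrier by (metis l_inv)
  ultimately have "orb g w \<subseteq> orb (g \<otimes> inv h) (\<rho> h w)"
    using sub[of "g \<otimes> inv h" "\<rho> h w" "inv h"] assms inv_H rho(1) H_carrier by simp
  with sub[OF assms] show ?thesis by blast
qed

text \<open>The action is continuous before passing to classes, and it descends because the product
  of \<open>T\<close> with \<open>proj\<close> is a quotient map.\<close>

lemma pointed_gspace_X: "pointed_gspace G T X"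
proof -
  let ?m = "\<lambda>(g, z). (map_option (\<lambda>b. g \<otimes> b) (fst z), snd z :: 'w option)"
  let ?S = "Alexandroff_compactification (top_of_set W)"
  have lc: "locally_compact_space T" using compact_group by (rule compact_imp_locally_compact_space)
  have q2: "quotient_map (prod_topology T P) (prod_topology T (gtop X)) (\<lambda>(g, z). (g, proj z))"
    using lc Hausdorff_group quotient_map_proj by (intro quotient_map_prod_right) auto
  have "continuous_map (prod_topology (plus_topology T) T) (plus_topology T) (\<lambda>(a, g). map_option (\<lambda>b. g \<otimes> b) a)"
  proof (rule continuous_map_from_plus_prod)
    show "continuous_map T (plus_topology T) (\<lambda>z. (\<lambda>(a, g). map_option (\<lambda>b. g \<otimes> b) a) (None, z))"
      by (simp add: topspace_plus_topology)
    have "continuous_map (prod_topology T T) T (\<lambda>x. snd x \<otimes> fst x)"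
      by (intro continuous_mult_maps continuous_map_fst continuous_map_snd)
    from continuous_map_compose[OF this continuous_map_plus_Some]
    show "continuous_map (prod_topology T T) (plus_topology T)
        (\<lambda>(y, z). (\<lambda>(a, g). map_option (\<lambda>b. g \<otimes> b) a) (Some y, z))"
      by (simp add: o_def case_prod_unfold)
  qed
  then have c1: "continuous_map (prod_topology T P) (plus_topology T) (\<lambda>x. map_option (\<lambda>b. fst x \<otimes> b) (fst (snd x)))"
    using continuous_map_compose[of "prod_topology T P" "prod_topology (plus_topology T) T" "\<lambda>x. (fst (snd x), fst x)"]
      continuous_map_compose[OF continuous_map_snd continuous_map_fst, of T "plus_topology T" ?S] continuous_map_fst
    by (fastforce simp: o_def intro: continuous_map_pairedI)
  have c2: "continuous_map (prod_topology T P) ?S (\<lambda>x. snd (snd x))"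
    using continuous_map_compose[OF continuous_map_snd continuous_map_snd, of T "plus_topology T" ?S] by (simp add: o_def)
  have "continuous_map (prod_topology T P) P ?m"
    using continuous_map_pairedI[OF c1 c2] by (simp add: case_prod_unfold)
  then have "continuous_map (prod_topology T P) (gtop X) (proj \<circ> ?m)"
    using quotient_imp_continuous_map[OF quotient_map_proj] by (rule continuous_map_compose)
  then have "continuous_map (prod_topology T P) (gtop X) ((\<lambda>(g, x). gact X g x) \<circ> (\<lambda>(g, z). (g, proj z)))"
  proof (rule continuous_map_eq)
    fix y assume "y \<in> topspace (prod_topology T P)"
    then obtain g a x where y: "y = (g, a, x)" "g \<in> carrier G" "(a, x) \<in> topspace P"
      unfolding topspace_prod_topology[of T P] by (auto simp: topspace_group)
    show "(proj \<circ> ?m) y = ((\<lambda>(g, x). gact X g x) \<circ> (\<lambda>(g, z). (g, proj z))) y"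
      using y unfolding topspace_P by (cases a; cases x) (auto simp: gact_base gact_orb)
  qed
  then have cont: "continuous_map (prod_topology T (gtop X)) (gtop X) (\<lambda>(g, x). gact X g x)"
    by (rule continuous_compose_quotient_map[OF q2])
  show ?thesis
    unfolding pointed_gspace_def topspace_X gbase_X
    using cont by (auto simp: gact_base gact_orb m_assoc)
qed

text \<open>An element \<open>h\<close> fixes the class of (g, w) iff g^-1 h g lies in the isotropy
  group of \<open>w\<close> in \<open>H\<close>. If this holds for all \<open>h\<close> in
  \<open>H\<close>, compactness forces g^-1 H g to be all of \<open>H\<close>, so that
  \<open>w\<close> is fixed by the whole group.\<close>

lemma orb_fixed_iff:
  assumes g: "g \<in> carrier G" and w: "w \<in> W"
  shows "orb g w \<in> fixed_points G H X \<longleftrightarrow>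
     (\<forall>h\<in>H. inv g \<otimes> h \<otimes> g \<in> H) \<and> w \<in> fixed_vectors H W \<rho>"
proof
  assume fx: "orb g w \<in> fixed_points G H X"
  have *: "\<exists>k\<in>H. inv g \<otimes> h \<otimes> g = inv k \<and> \<rho> k w = w" if h: "h \<in> H" for h
  proof -
    have hc: "h \<in> carrier G" using h by (rule H_carrier)
    have "orb g w = orb (h \<otimes> g) w" using fx h gact_orb[OF g hc] by (auto simp: fixed_points_def)
    then obtain k where k: "k \<in> H" "h \<otimes> g = g \<otimes> inv k" "w = \<rho> k w"
      using orb_eqD[of g w "h \<otimes> g" w] g hc w by auto
    have "inv g \<otimes> h \<otimes> g = inv g \<otimes> (h \<otimes> g)" using g hc by (simp add: m_assoc)
    also have "\<dots> = inv k" unfolding k(2) using g H_carrier[OF k(1)] by (simp add: m_assoc[symmetric])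
    finally show ?thesis using k by auto
  qed
  then have N: "\<And>h. h \<in> H \<Longrightarrow> inv g \<otimes> h \<otimes> g \<in> H" using inv_H by metis
  have "\<rho> k w = w" if k: "k \<in> H" for k
  proof -
    have kc: "k \<in> carrier G" using k by (rule H_carrier)
    \<comment> \<open>The preimage of \<open>inv k\<close> under the conjugation h -> g^-1 h g;
      compactness puts it into \<open>H\<close>.\<close>
    let ?h = "g \<otimes> inv k \<otimes> inv g"
    have "?h \<in> H" by (rule conjugate_into_subgroup[OF subgroup_H closedin_H g N inv_H[OF k]])
    then obtain l where l: "l \<in> H" "inv g \<otimes> ?h \<otimes> g = inv l" "\<rho> l w = w" using * by blast
    have "inv g \<otimes> ?h \<otimes> g = inv k" using g kc by (simp add: m_assoc[symmetric]) (simp add: m_assoc)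
    then have "inv k = inv l" using l by simp
    then have "k = l" using kc H_carrier[OF l(1)] by (metis inv_inv)
    then show ?thesis using l by simp
  qed
  then show "(\<forall>h\<in>H. inv g \<otimes> h \<otimes> g \<in> H) \<and> w \<in> fixed_vectors H W \<rho>"
    using N w by (simp add: fixed_vectors_def)
next
  assume N: "(\<forall>h\<in>H. inv g \<otimes> h \<otimes> g \<in> H) \<and> w \<in> fixed_vectors H W \<rho>"
  have "orb (h \<otimes> g) w = orb g w" if h: "h \<in> H" for h
  proof -
    have hc: "h \<in> carrier G" using h by (rule H_carrier)
    let ?k = "inv (inv g \<otimes> h \<otimes> g)"
    have k: "?k \<in> H" using N h inv_H by blast
    have "g \<otimes> inv ?k = h \<otimes> g" using g hc by (simp add: m_assoc[symmetric])
    moreover have "\<rho> ?k w = w" using N k by (auto simp: fixed_vectors_def)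
    ultimately show ?thesis using orb_shift[OF g w k] by simp
  qed
  then show "orb g w \<in> fixed_points G H X"
    using g w gact_orb H_carrier topspace_X by (auto simp: fixed_points_def)
qed

lemma base_fixed: "base \<in> fixed_points G H X"
  using gbase_fixed[OF subgroup_H pointed_gspace_X] gbase_X by simp

text \<open>The isotropy group of the class of (g, w) lies in g H g^-1, which is \<open>H\<close>
  because the class is fixed by \<open>H\<close>.\<close>

lemma orb_not_collapsed:
  assumes "g \<in> carrier G" "w \<in> W" "orb g w \<in> fixed_points G H X"
  shows "\<not> collapsed G H X (orb g w)"
proof
  assume "collapsed G H X (orb g w)"
  then obtain k where k: "k \<in> carrier G" "k \<notin> H" "orb (k \<otimes> g) w = orb g w"
    using orb_neq_base gbase_X gact_orb[OF assms(1)] by (auto simp: collapsed_def)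
  then obtain h where h: "h \<in> H" "k \<otimes> g = g \<otimes> inv h"
    using orb_eqD[of g w "k \<otimes> g" w] assms by auto
  have N: "\<And>h. h \<in> H \<Longrightarrow> inv g \<otimes> h \<otimes> g \<in> H" using orb_fixed_iff assms by blast
  have "k = g \<otimes> inv h \<otimes> inv g" using h(2) assms(1) k(1)
    by (metis inv_closed m_assoc m_closed r_inv r_one)
  then show False
    using conjugate_into_subgroup[OF subgroup_H closedin_H assms(1) N inv_H[OF h(1)]] k(2) by simp
qed

text \<open>Fixed classes with the same image are translates of each other, so their vectors differ
  by some \<open>h\<close> in \<open>H\<close>, which acts trivially on fixed vectors.\<close>

lemma zproj_orb_eqD:
  assumes "g \<in> carrier G" "w \<in> W" "orb g w \<in> fixed_points G H X"
    and "g' \<in> carrier G" "w' \<in> W" "orb g' w' \<in> fixed_points G H X"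
    and eq: "zproj G H X (orb g w) = zproj G H X (orb g' w')"
  shows "w = w'"
proof -
  have t: "orb g w \<in> topspace (gtop X)" "orb g' w' \<in> topspace (gtop X)"
    using assms by (auto simp: fixed_points_def)
  obtain k where k: "k \<in> carrier G" "orb g' w' = gact X k (orb g w)"
    by (rule zproj_eq_orbit[OF pointed_gspace_X t orb_not_collapsed[OF assms(1-3)] eq])
  then have "orb (k \<otimes> g) w = orb g' w'" using gact_orb assms by simp
  then obtain h where "h \<in> H" "w' = \<rho> h w" using orb_eqD assms by blast
  moreover have "w \<in> fixed_vectors H W \<rho>" using orb_fixed_iff assms by blast
  ultimately show ?thesis by (auto simp: fixed_vectors_def)
qed

lemma zproj_base: "zproj G H X base = {}"
  using zproj_gbase[of H X] gbase_X by simp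

text \<open>The fixed set is studied upstairs: over this full preimage, once it is known to be
  closed, \<open>proj\<close> restricts to a quotient map onto the fixed set.\<close>

definition Fset :: "('g option \<times> 'w option) set" where
  "Fset = {p \<in> topspace P. proj p \<in> fixed_points G H X}"

lemma Fset_cases:
  assumes "p \<in> Fset"
  obtains (wedge) a x where "p = (a, x)" "a = None \<or> x = None" "proj p = base"
  | (orbit) g w where "p = (Some g, Some w)" "g \<in> carrier G" "w \<in> W" "w \<in> fixed_vectors H W \<rho>"
      "orb g w \<in> fixed_points G H X" "proj p = orb g w"
proof -
  obtain a x where p: "p = (a, x)" by (cases p)
  show ?thesis
  proof (cases "a = None \<or> x = None")
    case True
    then show ?thesis using wedge[OF p] p by auto
  next
    case False
    then obtain g w where "a = Some g" "x = Some w" by auto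
    then show ?thesis
      using orbit[of g w] p assms orb_fixed_iff[of g w] unfolding Fset_def topspace_P by auto
  qed
qed

text \<open>Upstairs the fixed set is explicit: the two axes, which go to the base point, and the
  product of the normalizer of \<open>H\<close> with the sphere of fixed vectors.\<close>

lemma closedin_Fset: "closedin P Fset"
proof -
  let ?S = "Alexandroff_compactification (top_of_set W)"
  define N where "N = {g \<in> topspace T. \<forall>h\<in>H. inv g \<otimes> h \<otimes> g \<in> H}"
  let ?V = "insert None (Some ` fixed_vectors H W \<rho>) :: 'w option set"
  have "N = (\<Inter>h\<in>H. {g \<in> topspace T. inv g \<otimes> h \<otimes> g \<in> H})" using one_H by (auto simp: N_def)
  also have "closedin T \<dots>"
  proof (rule closedin_INT)
    show "H \<noteq> {}" using one_H by auto
    fix h assume "h \<in> H"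
    then show "closedin T {g \<in> topspace T. inv g \<otimes> h \<otimes> g \<in> H}"
      using H_carrier
      by (intro closedin_continuous_map_preimage[OF _ closedin_H] continuous_mult_maps continuous_inv_map
          continuous_group_const) auto
  qed
  finally have clN: "closedin T N" .
  have clSN: "closedin (plus_topology T) (Some ` N)"
  proof -
    have "openin T (topspace T - N)" using clN by auto
    moreover have "{y. Some y \<in> insert None (Some ` topspace T) - Some ` N} = topspace T - N" by auto
    ultimately have "openin (plus_topology T) (insert None (Some ` topspace T) - Some ` N)"
      by (simp add: openin_plus_topology)
    moreover have "Some ` N \<subseteq> topspace (plus_topology T)" by (auto simp: topspace_plus_topology N_def)
    ultimately show ?thesis unfolding closedin_def by (metis topspace_plus_topology)
  qed
  have clNone: "closedin (plus_topology T) {None}"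
  proof -
    have "openin (plus_topology T) (Some ` topspace T)" by (simp add: openin_plus_Some)
    moreover have "Some ` topspace T = topspace (plus_topology T) - {None}" by (auto simp: topspace_plus_topology)
    moreover have "{None} \<subseteq> topspace (plus_topology T)" by (simp add: topspace_plus_topology)
    ultimately show ?thesis unfolding closedin_def by metis
  qed
  have clS0: "closedin ?S {None}"
  proof -
    have "openin ?S (Some ` W)" by simp
    moreover have "Some ` W = topspace ?S - {None}" by auto
    moreover have "{None} \<subseteq> topspace ?S" by simp
    ultimately show ?thesis unfolding closedin_def by metis
  qed
  have clV: "closedin ?S ?V"
  proof -
    have "subspace (fixed_vectors H W \<rho>)" using subspace_fixed_vectors[OF representation] one_H by blast
    then have "closed (fixed_vectors H W \<rho>)" by (rule closed_subspace)
    then have "openin (top_of_set W) (W - fixed_vectors H W \<rho>)"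
      by (metis Diff_eq open_Compl openin_open_Int)
    then have "openin ?S (Some ` (W - fixed_vectors H W \<rho>))" by simp
    moreover have "Some ` (W - fixed_vectors H W \<rho>) = topspace ?S - ?V" by (auto simp: fixed_vectors_def)
    moreover have "?V \<subseteq> topspace ?S" by (auto simp: fixed_vectors_def)
    ultimately show ?thesis unfolding closedin_def by metis
  qed
  have "Fset = {None} \<times> topspace ?S \<union> topspace (plus_topology T) \<times> {None} \<union> Some ` N \<times> ?V"
  proof (rule subset_antisym; rule subsetI)
    fix p assume p: "p \<in> Fset"
    then have t: "p \<in> topspace P" by (simp add: Fset_def)
    from p show "p \<in> {None} \<times> topspace ?S \<union> topspace (plus_topology T) \<times> {None} \<union> Some ` N \<times> ?V"
      by (cases rule: Fset_cases) (use t in \<open>auto simp: orb_fixed_iff N_def topspace_group\<close>)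
  next
    fix p assume "p \<in> {None} \<times> topspace ?S \<union> topspace (plus_topology T) \<times> {None} \<union> Some ` N \<times> ?V"
    then consider x where "p = (None, x)" "x \<in> topspace ?S" | a where "p = (a, None)" "a \<in> topspace (plus_topology T)"
      | g w where "p = (Some g, Some w)" "g \<in> N" "w \<in> fixed_vectors H W \<rho>"
      by (auto simp: N_def topspace_plus_topology)
    then show "p \<in> Fset"
    proof cases
      case 3
      then have "g \<in> carrier G" "w \<in> W" by (auto simp: N_def topspace_group fixed_vectors_def)
      then show ?thesis
        using 3 by (auto simp: Fset_def topspace_plus_topology topspace_group orb_fixed_iff N_def)
    qed (auto simp: Fset_def base_fixed topspace_plus_topology topspace_group)
  qed
  moreover have "closedin P ({None} \<times> topspace ?S)" "closedin P (topspace (plus_topology T) \<times> {None})"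
    "closedin P (Some ` N \<times> ?V)"
    using clNone clS0 clSN clV by (auto simp: closedin_prod_Times_iff simp del: topspace_Alexandroff_compactification)
  ultimately show ?thesis by (metis closedin_Un)
qed

text \<open>Forgetting the group coordinate identifies Z with the sphere of the fixed vectors; the
  inverse places a vector over the unit element. The two are inverse because a fixed class of (g, w)
  is the translate by \<open>g\<close> of the fixed class of (1, w).\<close>

lemma euler_number_induced:
  "euler_number (zspace G H X) {{}} ((- 1) ^ dim (fixed_vectors H W \<rho>))"
proof -
  let ?S = "Alexandroff_compactification (top_of_set W)"
  let ?U = "fixed_vectors H W \<rho>"
  let ?A = "fixed_sphere W ?U"
  let ?FX = "subtopology (gtop X) (fixed_points G H X)"
  let ?Z = "zspace G H X"
  \<comment> \<open>The axis \<open>a = None\<close> is sent to infinity, to match the collapse in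
    the smash product.\<close>
  let ?m = "\<lambda>(a, x). if a = None then None else x :: 'w option"
  have UW: "?U \<subseteq> W" by (auto simp: fixed_vectors_def)
  have sU: "subspace ?U" using subspace_fixed_vectors[OF representation] one_H by blast
  have sW: "subspace W" using representation by (simp add: linear_representation_def)
  \<comment> \<open>Closedness is read off from the preimage \<open>Fset\<close>, without first
    showing that the induced space is Hausdorff.\<close>
  have clF: "closedin (gtop X) (fixed_points G H X)"
    using quotient_map_proj closedin_Fset fixed_points_subset[of G H X]
    unfolding quotient_map_closedin Fset_def by auto
  have qF: "quotient_map (subtopology P Fset) ?FX proj"
    by (rule quotient_map_restriction[OF quotient_map_proj]) (auto simp: Fset_def clF)
  have qZ: "quotient_map (subtopology P Fset) ?Z (zproj G H X \<circ> proj)"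
    by (rule quotient_map_compose[OF qF quotient_map_zproj])
  have tF: "topspace (subtopology P Fset) = Fset" by (auto simp: Fset_def)
  have "continuous_map P ?S ?m"
  proof (rule continuous_map_from_plus_prod)
    show "continuous_map ?S ?S (\<lambda>z. ?m (None, z))" by simp
    show "continuous_map (prod_topology T ?S) ?S (\<lambda>(y, z). ?m (Some y, z))"
      using continuous_map_snd[of T ?S] by (simp add: case_prod_unfold)
  qed
  then have "continuous_map (subtopology P Fset) ?S ?m" by (rule continuous_map_from_subtopology)
  moreover have "?m p \<in> insert None (Some ` ?U)" if "p \<in> Fset" for p
    using that by (cases rule: Fset_cases) auto
  ultimately have cm: "continuous_map (subtopology P Fset) ?A ?m"
    using tF by (auto simp: fixed_sphere_def continuous_map_in_subtopology)
  \<comment> \<open>Both maps take their base value at the same points, so two elements with equal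
    image in Z are both over the base point or both over genuine orbits.\<close>
  have zero: "zproj G H X (proj p) = {} \<longleftrightarrow> ?m p = None" if "p \<in> Fset" for p
    using that
  proof (cases rule: Fset_cases)
    case (orbit g w)
    then show ?thesis using orb_not_collapsed[of g w] zproj_empty_iff[of H X "orb g w"] by simp
  qed (auto simp: zproj_base)
  obtain \<mu> where \<mu>: "continuous_map ?Z ?A \<mu>"
    "\<And>p. p \<in> topspace (subtopology P Fset) \<Longrightarrow> \<mu> ((zproj G H X \<circ> proj) p) = ?m p"
  proof (rule quotient_map_lift_exists[OF qZ cm])
    fix p q assume "p \<in> topspace (subtopology P Fset)" "q \<in> topspace (subtopology P Fset)"
      and eq: "(zproj G H X \<circ> proj) p = (zproj G H X \<circ> proj) q"
    then have p: "p \<in> Fset" and q: "q \<in> Fset" by (auto simp: Fset_def)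
    show "?m p = ?m q"
    proof (cases "?m p = None \<or> ?m q = None")
      case True
      then show ?thesis using zero[OF p] zero[OF q] eq by (metis comp_apply)
    next
      case False
      obtain g w where gw: "p = (Some g, Some w)" "g \<in> carrier G" "w \<in> W" "orb g w \<in> fixed_points G H X"
        using p False by (cases rule: Fset_cases) auto
      obtain g' w' where gw': "q = (Some g', Some w')" "g' \<in> carrier G" "w' \<in> W" "orb g' w' \<in> fixed_points G H X"
        using q False by (cases rule: Fset_cases) auto
      have "w = w'" using zproj_orb_eqD[OF gw(2-4) gw'(2-4)] eq gw(1) gw'(1) by simp
      then show ?thesis using gw gw' by simp
    qed
  qed blast
  define \<kappa> where "\<kappa> = (\<lambda>x. zproj G H X (proj (Some \<one>, x)))"
  have topA: "topspace ?A = insert None (Some ` ?U)" using UW by (auto simp: fixed_sphere_def)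
  have oneF: "(Some \<one>, x) \<in> Fset" if "x \<in> topspace ?A" for x
  proof (cases x)
    case None
    then show ?thesis by (auto simp: Fset_def topspace_plus_topology topspace_group base_fixed)
  next
    case (Some w)
    then have w: "w \<in> ?U" "w \<in> W" using that UW by (auto simp: topA)
    have "orb \<one> w \<in> fixed_points G H X" using orb_fixed_iff[of \<one> w] w H_carrier by auto
    then show ?thesis using Some w by (auto simp: Fset_def topspace_plus_topology topspace_group)
  qed
  have "continuous_map ?A (subtopology P Fset) (\<lambda>x. (Some \<one>, x))"
  proof -
    have "continuous_map ?A (plus_topology T) (\<lambda>x. Some \<one>)" by (simp add: topspace_plus_topology topspace_group)
    moreover have "continuous_map ?A ?S (\<lambda>x. x)"
      unfolding fixed_sphere_def by (intro continuous_map_from_subtopology) (simp add: continuous_map_id[unfolded id_def])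
    ultimately show ?thesis using oneF by (auto simp: continuous_map_in_subtopology intro: continuous_map_pairedI)
  qed
  from continuous_map_compose[OF this quotient_imp_continuous_map[OF qZ]]
  have c\<kappa>: "continuous_map ?A ?Z \<kappa>" by (simp add: \<kappa>_def o_def)
  have \<mu>\<kappa>: "\<mu> (\<kappa> x) = x" if "x \<in> topspace ?A" for x
    using \<mu>(2)[of "(Some \<one>, x)"] oneF[OF that] unfolding tF by (simp add: \<kappa>_def)
  have \<kappa>\<mu>: "\<kappa> (\<mu> z) = z" if z: "z \<in> topspace ?Z" for z
  proof -
    obtain p where p: "p \<in> Fset" "z = zproj G H X (proj p)"
      using z quotient_imp_surjective_map[OF qZ, symmetric] unfolding tF o_def by blast
    have "\<mu> z = ?m p" using \<mu>(2)[unfolded tF, OF p(1)] unfolding p(2) o_def .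
    moreover have "\<kappa> (?m p) = z"
      using p(1)
    proof (cases rule: Fset_cases)
      case (wedge a x)
      then have "?m p = None" by auto
      moreover have "\<kappa> None = z" unfolding \<kappa>_def p(2) wedge(3) by simp
      ultimately show ?thesis by metis
    next
      case (orbit g w)
      have "orb \<one> w \<in> fixed_points G H X" using orb_fixed_iff[of \<one> w] orbit H_carrier by auto
      moreover have "gact X g (orb \<one> w) = orb g w" using gact_orb[of \<one> g w] orbit(2) by simp
      ultimately have "zproj G H X (orb g w) = zproj G H X (orb \<one> w)"
        using zproj_translate_fixed[OF closed_subgroup_H pointed_gspace_X, of "orb \<one> w" g] orbit(2,5) by simp
      then have "\<kappa> (Some w) = z" using orbit(6) p(2) by (simp add: \<kappa>_def)
      then show ?thesis unfolding orbit(1) by simp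
    qed
    ultimately show ?thesis by simp
  qed
  have "homeomorphic_maps ?A ?Z \<kappa> \<mu>" using \<mu>(1) c\<kappa> \<mu>\<kappa> \<kappa>\<mu> by (simp add: homeomorphic_maps_def)
  moreover have "\<kappa> None = {}" by (simp add: \<kappa>_def zproj_base)
  moreover have "\<mu> {} = None" using \<mu>\<kappa>[of None] topA \<open>\<kappa> None = {}\<close> by simp
  ultimately have "relative_homology_group p ?A {None} \<cong> relative_homology_group p ?Z {{}}" for p
    using homeomorphic_maps_relative_homology_group_isomorphisms[of ?A ?Z \<kappa> \<mu> "{None}" "{{}}" p]
    by (auto intro: is_isoI group_isomorphisms_imp_iso)
  then show ?thesis by (rule euler_number_iso[OF _ euler_number_fixed_sphere[OF sU sW UW]])
qed

end

section \<open>The Euler ring\<close>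

text \<open>A point is coded by the indices of the basic open sets that contain it, and sets of
  natural numbers inject into the reals. For the group this is the first step towards a model of an
  induced sphere on a subset of \<open>real\<close>.\<close>

lemma injection_of_second_countable:
  assumes "Hausdorff_space Y" "second_countable Y"
  shows "\<exists>f :: 'a \<Rightarrow> real. inj_on f (topspace (Y :: 'a topology))"
proof -
  obtain \<B> where B: "countable \<B>" "\<And>V. V \<in> \<B> \<Longrightarrow> openin Y V"
    "\<And>U x. openin Y U \<Longrightarrow> x \<in> U \<Longrightarrow> \<exists>V\<in>\<B>. x \<in> V \<and> V \<subseteq> U"
    using assms(2) unfolding second_countable_def by metis
  obtain r :: "nat set \<Rightarrow> real" where r: "inj r"
    using nat_sets_eqpoll_reals by (auto simp: eqpoll_def bij_betw_def)
  define F where "F = (\<lambda>x. r {n. x \<in> from_nat_into \<B> n})"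
  have "inj_on F (topspace Y)"
  proof (rule inj_onI, rule ccontr)
    fix x y assume xy: "x \<in> topspace Y" "y \<in> topspace Y" "F x = F y" "x \<noteq> y"
    then obtain U where U: "openin Y U" "x \<in> U" "y \<notin> U"
      using assms(1) unfolding Hausdorff_space_def disjnt_def by (metis disjoint_iff)
    then obtain V where V: "V \<in> \<B>" "x \<in> V" "V \<subseteq> U" using B(3) by blast
    then obtain n where "V = from_nat_into \<B> n" using B(1) by (metis from_nat_into_surj)
    moreover have "{n. x \<in> from_nat_into \<B> n} = {n. y \<in> from_nat_into \<B> n}"
      using xy(3) r unfolding F_def by (auto dest: injD)
    ultimately show False using V U by blast
  qed
  then show ?thesis by blast
qed

lemma injection_of_euclidean: "\<exists>f :: 'w::euclidean_space \<Rightarrow> real. inj f"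
proof -
  obtain \<B> :: "'w set set" where B: "countable \<B>" "topological_basis \<B>"
    using ex_countable_basis by blast
  have "\<exists>V\<in>\<B>. x \<in> V \<and> V \<subseteq> U" if "open U" "x \<in> U" for U x
    using topological_basisE[OF B(2) that] by metis
  then have "second_countable (euclidean :: 'w topology)"
    unfolding second_countable_def using B(1) topological_basis_open[OF B(2)]
    by (intro exI[of _ \<B>]) (simp flip: open_openin)
  then show ?thesis using injection_of_second_countable[of "euclidean :: 'w topology"] by auto
qed

lemma injection_of_pairs:
  assumes "inj_on (f :: 'a \<Rightarrow> real) A" "inj (g :: 'c \<Rightarrow> real)"
  shows "\<exists>h :: ('a option \<times> 'c option) \<Rightarrow> real. inj_on h (insert None (Some ` A) \<times> UNIV)"
proof -
  have inj1: "\<exists>e :: real option \<Rightarrow> real. inj e"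
  proof -
    \<comment> \<open>The exponential is positive and leaves -1 free for the added point.\<close>
    have "inj (case_option (- 1 :: real) exp)"
    proof (rule injI)
      fix x y :: "real option"
      assume "case_option (- 1 :: real) exp x = case_option (- 1) exp y"
      moreover have "exp z \<noteq> (-1::real)" for z using exp_gt_zero[of z] by linarith
      moreover have "(-1::real) \<noteq> exp z" for z using exp_gt_zero[of z] by linarith
      ultimately show "x = y" by (cases x; cases y) simp_all
    qed
    then show ?thesis by blast
  qed
  then obtain e :: "real option \<Rightarrow> real" where e: "inj e" by blast
  obtain d :: "real \<times> real \<Rightarrow> real" where d: "inj d"
    using injection_of_euclidean by blast
  define h where "h = (\<lambda>(a, x). d (e (map_option f a), e (map_option g x)))"
  have "inj_on h (insert None (Some ` A) \<times> UNIV)"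
  proof (rule inj_onI, clarify)
    fix a x a' x'
    assume a: "a \<in> insert None (Some ` A)" "a' \<in> insert None (Some ` A)" and eq: "h (a, x) = h (a', x')"
    then have "map_option f a = map_option f a'" "map_option g x = map_option g x'"
      using d e by (auto simp: h_def dest: injD)
    moreover have "x = x'" if "map_option g x = map_option g x'"
      using that assms(2) by (metis option.inj_map injD)
    ultimately show "a = a' \<and> x = x'" using a assms(1) by (auto dest: inj_onD)
  qed
  then show ?thesis by blast
qed

context compact_topological_group
begin

lemma G_homotopy_equivalent_refl:
  assumes X: "pointed_gspace G T X"
  shows "G_homotopy_equivalent G X X"
proof -
  have "pointed_equivariant G X X id" by (simp add: pointed_equivariant_def)
  then show ?thesis unfolding G_homotopy_equivalent_def
    by (intro exI[of _ id]) (auto intro: homotopic_with_equal)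
qed

text \<open>The structure of \<open>X\<close> is transported along the injection. Spaces without a
  model in the universe would all share the empty type, from which no coefficient can be
  read.\<close>

lemma homotopy_type_nonempty:
  fixes \<iota> :: "'x \<Rightarrow> real"
  assumes X: "pointed_gspace G T X" and inj: "inj_on \<iota> (topspace (gtop X))"
  shows "homotopy_type G T X \<noteq> {}"
proof -
  let ?j = "inv_into (topspace (gtop X)) \<iota>"
  define Y where "Y = \<lparr>gtop = quot_topology (gtop X) \<iota>, gact = (\<lambda>g y. \<iota> (gact X g (?j y))), gbase = \<iota> (gbase X)\<rparr>"
  have q: "quotient_map (gtop X) (gtop Y) \<iota>" by (simp add: Y_def quotient_map_quot_topology)
  have topY: "topspace (gtop Y) = \<iota> ` topspace (gtop X)" using quotient_imp_surjective_map[OF q] by simp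
  have ji: "?j (\<iota> x) = x" if "x \<in> topspace (gtop X)" for x using inj that by simp
  have ij: "\<iota> (?j y) = y" and jin: "?j y \<in> topspace (gtop X)" if "y \<in> topspace (gtop Y)" for y
    using that topY by (auto simp: f_inv_into_f inv_into_into)
  have contj: "continuous_map (gtop Y) (gtop X) ?j"
  proof (rule continuous_compose_quotient_map[OF q])
    show "continuous_map (gtop X) (gtop X) (?j \<circ> \<iota>)"
      by (rule continuous_map_eq[OF continuous_map_id]) (simp add: ji)
  qed
  have bX: "gbase X \<in> topspace (gtop X)" by (rule gbase_in[OF X])
  have Yg: "pointed_gspace G T Y"
    unfolding pointed_gspace_def
  proof (intro conjI ballI)
    have "continuous_map (prod_topology T (gtop Y)) (gtop Y) (\<lambda>z. \<iota> (gact X (fst z) (?j (snd z))))"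
    proof -
      have "continuous_map (prod_topology T (gtop Y)) (gtop X) (\<lambda>z. ?j (snd z))"
        using continuous_map_compose[OF continuous_map_snd contj] by (simp add: o_def)
      then have "continuous_map (prod_topology T (gtop Y)) (gtop X) (\<lambda>z. gact X (fst z) (?j (snd z)))"
        by (intro continuous_gact[OF X] continuous_map_fst)
      from continuous_map_compose[OF this quotient_imp_continuous_map[OF q]] show ?thesis by (simp add: o_def)
    qed
    then show "continuous_map (prod_topology T (gtop Y)) (gtop Y) (\<lambda>(g, x). gact Y g x)"
      by (simp add: Y_def case_prod_unfold)
    show "gbase Y \<in> topspace (gtop Y)" using bX by (simp add: topY) (simp add: Y_def)
  next
    fix x assume "x \<in> topspace (gtop Y)"
    then show "gact Y \<one> x = x" using ij jin gspaceD(1)[OF X] by (simp add: Y_def)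
  next
    fix g h x assume "g \<in> carrier G" "h \<in> carrier G" "x \<in> topspace (gtop Y)"
    then show "gact Y (g \<otimes> h) x = gact Y g (gact Y h x)"
      using ji jin gspaceD(2)[OF X] gact_closed[OF X] by (simp add: Y_def)
  next
    fix g assume "g \<in> carrier G"
    then show "gact Y g (gbase Y) = gbase Y" using ji[OF bX] gspaceD(3)[OF X bX] by (simp add: Y_def)
  qed
  have e1: "pointed_equivariant G X Y \<iota>" using ji by (simp add: pointed_equivariant_def Y_def)
  have e2: "pointed_equivariant G Y X ?j"
    using ji[OF bX] ji jin gact_closed[OF X] by (simp add: pointed_equivariant_def Y_def)
  have "G_homotopy_equivalent G X Y"
    unfolding G_homotopy_equivalent_def
  proof (intro exI conjI)
    show "continuous_map (gtop X) (gtop Y) \<iota>" by (rule quotient_imp_continuous_map[OF q])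
    show "pointed_equivariant G X Y \<iota>" "pointed_equivariant G Y X ?j" by (fact e1, fact e2)
    show "continuous_map (gtop Y) (gtop X) ?j" by (rule contj)
    show "homotopic_with (pointed_equivariant G X X) (gtop X) (gtop X) (?j \<circ> \<iota>) id"
    proof (rule homotopic_with_equal)
      show "pointed_equivariant G X X (?j \<circ> \<iota>)"
        using ji bX gact_closed[OF X] by (simp add: pointed_equivariant_def)
      show "continuous_map (gtop X) (gtop X) (?j \<circ> \<iota>)"
        by (rule continuous_map_eq[OF continuous_map_id]) (simp add: ji)
    qed (auto simp: pointed_equivariant_def ji)
    show "homotopic_with (pointed_equivariant G Y Y) (gtop Y) (gtop Y) (\<iota> \<circ> ?j) id"
    proof (rule homotopic_with_equal)
      have "gact Y g y \<in> topspace (gtop Y)" if "g \<in> carrier G" "y \<in> topspace (gtop Y)" for g y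
        by (rule gact_closed[OF Yg that(2,1)])
      then show "pointed_equivariant G Y Y (\<iota> \<circ> ?j)"
        using ij gbase_in[OF Yg] by (simp add: pointed_equivariant_def)
      show "continuous_map (gtop Y) (gtop Y) (\<iota> \<circ> ?j)"
        by (rule continuous_map_eq[OF continuous_map_id]) (simp add: ij)
    qed (auto simp: pointed_equivariant_def ij)
  qed
  then show ?thesis using Yg by (auto simp: homotopy_type_def)
qed

text \<open>The coefficient at \<open>\<chi>\<^sub>G(G/H\<^sup>+)\<close>. On homotopy types without a finite Euler characteristic
  its value is arbitrary; these do not occur in the relations.\<close>

definition type_coefficient :: "'g set \<Rightarrow> ('g, real) gspace set \<Rightarrow> int" where
  "type_coefficient H h = (SOME c. \<exists>Y\<in>h. euler_number (zspace G H Y) {{}} c)"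

text \<open>By homotopy invariance all members of the type have the same Euler number, so the choice
  in \<open>type_coefficient\<close> is forced as soon as there is a member.\<close>

lemma type_coefficient_eq:
  assumes H: "closed_subgroup G T H" and X: "pointed_gspace G T X"
    and ne: "homotopy_type G T X \<noteq> {}" and e: "euler_number (zspace G H X) {{}} c"
  shows "type_coefficient H (homotopy_type G T X) = c"
proof -
  have Hs: "subgroup H G" using H by (simp add: closed_subgroup_def)
  have all: "euler_number (zspace G H Y) {{}} c" if "Y \<in> homotopy_type G T X" for Y
    using that euler_number_zspace_homotopy[OF Hs X _ _ e] by (auto simp: homotopy_type_def)
  obtain Y where Y: "Y \<in> homotopy_type G T X" using ne by auto
  have "\<exists>Y\<in>homotopy_type G T X. euler_number (zspace G H Y) {{}} (type_coefficient H (homotopy_type G T X))"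
    unfolding type_coefficient_def by (rule someI[of _ c]) (use all Y in blast)
  then show ?thesis using all euler_number_unique by blast
qed

lemma homotopy_type_real_nonempty:
  fixes X :: "('g, real) gspace"
  assumes "pointed_gspace G T X" shows "homotopy_type G T X \<noteq> {}"
  using G_homotopy_equivalent_refl[OF assms] assms by (auto simp: homotopy_type_def)

text \<open>The additive extension to the free abelian group. Multiples of the single generator
  \<open>()\<close> stand for the integers, so that additivity is that of
  \<open>frag_extend\<close>.\<close>

definition euler_coefficient :: "'g set \<Rightarrow> (('g, real) gspace set \<Rightarrow>\<^sub>0 int) \<Rightarrow> int" where
  "euler_coefficient H x = Poly_Mapping.lookup (frag_extend (\<lambda>h. frag_cmul (type_coefficient H h) (frag_of ())) x) ()"

lemma euler_coefficient_add: "euler_coefficient H (x + y) = euler_coefficient H x + euler_coefficient H y"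
  and euler_coefficient_diff: "euler_coefficient H (x - y) = euler_coefficient H x - euler_coefficient H y"
  and euler_coefficient_minus: "euler_coefficient H (- x) = - euler_coefficient H x"
  and euler_coefficient_0: "euler_coefficient H 0 = 0"
  and euler_coefficient_of: "euler_coefficient H (frag_of h) = type_coefficient H h"
  by (simp_all add: euler_coefficient_def frag_extend_add frag_extend_diff frag_extend_minus
      Poly_Mapping.lookup_add Poly_Mapping.lookup_minus)

text \<open>On a generating relation the value is a - (a + b) + b, by the additivity of the cell
  counts.\<close>

lemma euler_coefficient_relations:
  assumes H: "closed_subgroup G T H" and x: "x \<in> euler_relations G T"
  shows "euler_coefficient H x = 0"
proof -
  let ?R = "{frag_of (homotopy_type G T (gsubspace X A)) - frag_of (homotopy_type G T X)
          + frag_of (homotopy_type G T (gcollapse X A)) |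
        (X :: ('g, real) gspace) A. pointed_gcw_subcomplex G T X A}"
  \<comment> \<open>The inverses in \<^const>\<open>generate\<close> are unspecified outside of the carrier, so it matters that
    \<open>A\<close> and \<open>X/A\<close> are G-CW-complexes again.\<close>
  have R: "y \<in> carrier (euler_free G T) \<and> euler_coefficient H y = 0" if y: "y \<in> ?R" for y
  proof -
    obtain X :: "('g, real) gspace" and A where XA: "pointed_gcw_subcomplex G T X A"
      "y = frag_of (homotopy_type G T (gsubspace X A)) - frag_of (homotopy_type G T X)
          + frag_of (homotopy_type G T (gcollapse X A))" using y by blast
    obtain a b where ab: "pointed_gcw_complex G T X"
      "pointed_gcw_complex G T (gsubspace X A)" "pointed_gcw_complex G T (gcollapse X A)"
      "euler_number (zspace G H (gsubspace X A)) {{}} a"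
      "euler_number (zspace G H (gcollapse X A)) {{}} b"
      "euler_number (zspace G H X) {{}} (a + b)"
      by (rule subcomplex_euler_number[OF H XA(1)])
    have g: "pointed_gspace G T Z" if "pointed_gcw_complex G T Z" for Z :: "('g, real) gspace"
      using that by (auto simp: pointed_gcw_complex_def gcw_structure_def)
    have types: "homotopy_type G T Z \<in> gcw_homotopy_types G T" if "pointed_gcw_complex G T Z" for Z :: "('g, real) gspace"
      using that by (auto simp: gcw_homotopy_types_def)
    have "Poly_Mapping.keys y \<subseteq> gcw_homotopy_types G T"
    proof -
      have "Poly_Mapping.keys (frag_of h1 - frag_of h2 + frag_of h3) \<subseteq> {h1, h2, h3}"
        for h1 h2 h3 :: "('g, real) gspace set"
        using keys_add[of "frag_of h1 - frag_of h2" "frag_of h3"] keys_diff[of "frag_of h1" "frag_of h2"] by auto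
      then show ?thesis unfolding XA(2) using types ab(1-3) by blast
    qed
    moreover have "type_coefficient H (homotopy_type G T (gsubspace X A)) = a"
      "type_coefficient H (homotopy_type G T (gcollapse X A)) = b"
      "type_coefficient H (homotopy_type G T X) = a + b"
      using ab g by (auto intro!: type_coefficient_eq[OF H] homotopy_type_real_nonempty)
    ultimately show ?thesis unfolding XA(2)
      by (simp add: euler_free_def euler_coefficient_add euler_coefficient_diff euler_coefficient_of)
  qed
  have "x \<in> generate (euler_free G T) ?R" using x by (simp add: euler_relations_def)
  then show ?thesis
  proof (induction rule: generate.induct)
    case one
    then show ?case by (simp add: euler_free_def euler_coefficient_0)
  next
    case (incl h)
    then show ?case using R by blast
  next
    case (inv h)
    then have "h \<in> carrier (euler_free G T)" "euler_coefficient H h = 0" using R by blast+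
    then show ?case by (simp add: euler_free_def euler_coefficient_minus)
  next
    case (eng h1 h2)
    then show ?case by (simp add: euler_free_def euler_coefficient_add)
  qed
qed

text \<open>The representative of the first coset also lies in the second, so the two generators
  differ by a relation, whose coefficient is 0.\<close>

lemma euler_char_coefficient:
  assumes H: "closed_subgroup G T H" and eq: "euler_char G T X = euler_char G T Y"
  shows "type_coefficient H (homotopy_type G T X) = type_coefficient H (homotopy_type G T Y)"
proof -
  have "0 \<in> euler_relations G T"
    using generate.one[of "euler_free G T"] by (simp add: euler_relations_def euler_free_def)
  then have "frag_of (homotopy_type G T X) \<in> euler_char G T X"
    unfolding euler_char_def r_coset_def by (auto simp: euler_free_def intro: bexI[of _ 0])
  then obtain r where "r \<in> euler_relations G T" "frag_of (homotopy_type G T X) = r + frag_of (homotopy_type G T Y)"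
    unfolding eq unfolding euler_char_def r_coset_def by (auto simp: euler_free_def)
  then have "euler_coefficient H (frag_of (homotopy_type G T X)) = euler_coefficient H (frag_of (homotopy_type G T Y))"
    using euler_coefficient_relations[OF H] by (simp add: euler_coefficient_add)
  then show ?thesis by (simp add: euler_coefficient_of)
qed

end

context induced_sphere
begin

lemma type_coefficient_induced:
  assumes "second_countable T"
  shows "type_coefficient H (homotopy_type G T X) = (- 1) ^ dim (fixed_vectors H W \<rho>)"
proof (rule type_coefficient_eq[OF closed_subgroup_H pointed_gspace_X _ euler_number_induced])
  obtain f :: "'g \<Rightarrow> real" where f: "inj_on f (topspace T)"
    using injection_of_second_countable[OF Hausdorff_group assms] by blast
  obtain g :: "'w \<Rightarrow> real" where g: "inj g" using injection_of_euclidean by blast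
  obtain h :: "'g option \<times> 'w option \<Rightarrow> real" where h: "inj_on h (insert None (Some ` topspace T) \<times> UNIV)"
    using injection_of_pairs[OF f g] by blast
  \<comment> \<open>One representative in G^+ x S^W is picked for each class; this embeds the space
    of classes into a set that already injects into the reals.\<close>
  let ?s = "inv_into (topspace P) proj"
  have im: "proj ` topspace P = topspace (gtop X)"
    by (rule quotient_imp_surjective_map[OF quotient_map_proj])
  have s: "?s x \<in> topspace P" if "x \<in> topspace (gtop X)" for x
    using that inv_into_into[of x proj "topspace P"] unfolding im by blast
  have "inj_on ?s (topspace (gtop X))"
    unfolding im[symmetric] by (rule inj_on_inv_into) simp
  moreover have "inj_on h (?s ` topspace (gtop X))"
  proof (rule inj_on_subset[OF h], rule image_subsetI)
    fix x assume "x \<in> topspace (gtop X)"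
    then show "?s x \<in> insert None (Some ` topspace T) \<times> UNIV"
      using s[of x] unfolding topspace_P topspace_group by auto
  qed
  ultimately have "inj_on (h \<circ> ?s) (topspace (gtop X))" by (rule comp_inj_on)
  then show "homotopy_type G T X \<noteq> {}" by (rule homotopy_type_nonempty[OF pointed_gspace_X])
qed

end

theorem theorem3p7:
  fixes G :: "('g, 'b) monoid_scheme" and T :: "'g topology" and H :: "'g set"
    and W :: "'w::euclidean_space set" and \<rho> :: "'g \<Rightarrow> 'w \<Rightarrow> 'w"
    and V :: "'v::euclidean_space set" and \<sigma> :: "'g \<Rightarrow> 'v \<Rightarrow> 'v"
  assumes "compact_lie_group G T"
    and "closed_subgroup G T H"
    and "orthogonal_representation G T H V \<sigma>"
    and "orthogonal_representation G T H W \<rho>"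
    and "odd (dim (fixed_vectors H V \<sigma>))"
  shows "euler_char G T (induced_gspace G T H (rep_sphere (W \<times> V) (direct_sum_action \<rho> \<sigma>)))
       \<noteq> euler_char G T (induced_gspace G T H (rep_sphere W \<rho>))"
proof
  assume eq: "euler_char G T (induced_gspace G T H (rep_sphere (W \<times> V) (direct_sum_action \<rho> \<sigma>)))
       = euler_char G T (induced_gspace G T H (rep_sphere W \<rho>))"
  interpret compact_topological_group G T using assms(1) by (rule compact_lie_group_imp)
  have sc: "second_countable T" using assms(1) by (auto simp: compact_lie_group_def lie_group_def)
  have V: "linear_representation G H V \<sigma>" and W: "linear_representation G H W \<rho>"
    using assms(3,4) by (auto intro: orthogonal_imp_linear_representation)
  interpret W: induced_sphere G T H W \<rho>
    by unfold_locales (fact assms(2), fact W)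
  interpret WV: induced_sphere G T H "W \<times> V" "direct_sum_action \<rho> \<sigma>"
    by unfold_locales (fact assms(2), rule linear_representation_sum[OF W V])
  have "H \<noteq> {}" using W.one_H by auto
  then have "dim (fixed_vectors H (W \<times> V) (direct_sum_action \<rho> \<sigma>)) =
      dim (fixed_vectors H W \<rho>) + dim (fixed_vectors H V \<sigma>)"
    unfolding fixed_vectors_sum
    by (intro dim_Times subspace_fixed_vectors[OF W] subspace_fixed_vectors[OF V])
  \<comment> \<open>With d and e the dimensions of the fixed vectors of \<open>W\<close> and
    \<open>V\<close>, equality of the coefficients at \<open>H\<close> would mean (-1)^(d + e) =
    (-1)^d, although e is odd.\<close>
  then show False
    using euler_char_coefficient[OF assms(2) eq] assms(5)
    unfolding W.type_coefficient_induced[OF sc] WV.type_coefficient_induced[OF sc]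
    by (simp add: power_add)
qed

end
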